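(* Let $EI,\rho,I_d>0$ and let $\varpi\in\mathbb{R}$ satisfy $|\varpi|<3\sqrt{EI/\rho}$. Let $f:\mathbb{R}\to\mathbb{R}$ be a non-decreasing differentiable function with $f(0)=0$, and suppose that there exist constants $c,c_1,c_2,\sigma>0$ such that $$c|s|\le|f(s)|\le c^{-1}|s|\ \text{ for all } |s|<\sigma,\qquad c_1|s|\le|f(s)|\le c_2|s|\ \text{ for all } |s|\ge\sigma.$$ Let $\gamma:\mathbb{R}\to\mathbb{R}$ be Lipschitz on each bounded subset of $\mathbb{R}$ and such that, for some $\kappa>0$, $\gamma(s)s\ge0$ and $|\gamma(s)|\ge\kappa|s|$ for all $s\in\mathbb{R}$. Then for each initial datum $(\phi_0,\omega_0)\in\mathcal{D}(\mathcal{A})=\mathcal{D}(A)\times\mathbb{R}$, with $\phi_0=(y_0,y_1)$, the solution $(\phi(t),\omega(t))=(y(\cdot,t),y_t(\cdot,t),\omega(t))$ of the closed-loop system $$ \begin{cases} \rho y_{tt}+EI\,y_{xxxx}=\rho\,\omega^2(t)\,y, & (x,t)\in(0,1)\times(0,\infty),\\ y(0,t)=y_x(0,t)=0, & t>0,\\ y_{xx}(1,t)=-f(y_{tx}(1,t)), & t>0,\\ y_{xxx}(1,t)=f(y_t(1,t)), & t>0,\\ \dot\omega(t)=\dfrac{-\gamma(\omega(t)-\varpi)-2\rho\,\omega(t)\int_0^1y(x,t)y_t(x,t)\,dx}{I_d+\rho\int_0^1y(x,t)^2\,dx}, & t>0,\\ y(x,0)=y_0(x),\quad y_t(x,0)=y_1(x),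 & x\in(0,1),\\ \omega(0)=\omega_0 \end{cases} $$ tends exponentially to $(0,\varpi)$ in $\mathcal{X}$ as $t\to+\infty$; that is, there exist constants $C,\alpha>0$ (possibly depending on the initial datum) such that $\|(\phi(t),\omega(t))-(0,\varpi)\|_{\mathcal{X}}\le Ce^{-\alpha t}$ for all $t\ge0$.
   Context: For an integer $n\ge2$, $H_l^n=\{u\in H^n(0,1):\ u(0)=u_x(0)=0\}$. The real Hilbert space $\mathcal{X}=\mathcal{H}\times\mathbb{R}$, $\mathcal{H}=H_l^2\times L^2(0,1)$, has inner product $$\langle(y,z,\omega),(\tilde y,\tilde z,\tilde\omega)\rangle_{\mathcal{X}}=\int_0^1\left(EI\,y_{xx}\tilde y_{xx}-\rho\varpi^2y\tilde y+\rho z\tilde z\right)dx+\omega\tilde\omega,$$ whose norm is equivalent to the usual norm of $H^2(0,1)\times L^2(0,1)\times\mathbb{R}$ when $|\varpi|<3\sqrt{EI/\rho}$. The nonlinear operator $A$ on $\mathcal{H}$ is $$\mathcal{D}(A)=\{(y,z)\in H_l^4\times H_l^2:\ y_{xxx}(1)=f(z(1)),\ y_{xx}(1)=-f(z_x(1))\},\qquad A(y,z)=\left(-z,\tfrac{EI}{\rho}y_{xxxx}-\varpi^2y\right).$$ With $\phi=(y,z)$, $z=y_t$, the closed-loop system is the evolution equation $(\dot\phi,\dot\omega)+(\mathcal{A}+\mathcal{B})(\phi,\omega)=0$ in $\mathcal{X}$, where $\mathcal{A}(\phi,\omega)=(A\phi,0)$ with $\mathcal{D}(\mathcal{A})=\mathcal{D}(A)\times\mathbb{R}$,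 and $$\mathcal{B}(\phi,\omega)=\left(0,\ (\varpi^2-\omega^2)y,\ \frac{\gamma(\omega-\varpi)+2\rho\,\omega\langle y,z\rangle_{L^2(0,1)}}{I_d+\rho\|y\|_{L^2(0,1)}^2}\right).$$ Under the hypotheses of the claim on $\varpi$, $f$ and $\gamma$, $\mathcal{A}$ is m-accretive with dense domain and $\mathcal{B}$ is Lipschitz on bounded sets; for every initial datum in $\mathcal{D}(\mathcal{A})$ the system has a unique global bounded solution on $(0,\infty)$. *)

theory Defs
  imports "HOL-Analysis.Analysis" "HOL-Library.Function_Algebras"
begin

text \<open>
  Elements of function spaces on the interval (0,1) are represented by arbitrary functions
  \<^typ>\<open>real \<Rightarrow> real\<close>; every notion below depends only on the class of the function
  modulo equality almost everywhere on (0,1).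
\<close>

abbreviation I01 :: "real measure" where
  "I01 \<equiv> lebesgue_on {0<..<1}"

definition L2 :: "(real \<Rightarrow> real) set" where
  "L2 = {u. u \<in> borel_measurable I01 \<and> integrable I01 (\<lambda>x. (u x)\<^sup>2)}"

definition L2_inner :: "(real \<Rightarrow> real) \<Rightarrow> (real \<Rightarrow> real) \<Rightarrow> real" where
  "L2_inner u v = (\<integral>x. u x * v x \<partial>I01)"

text \<open>Test functions are C1 with compact support in the open interval; the second argument
  is the derivative.\<close>

definition test_function :: "(real \<Rightarrow> real) \<Rightarrow> (real \<Rightarrow> real) \<Rightarrow> bool" where
  "test_function \<psi> \<psi>' \<longleftrightarrow>
     (\<forall>x. (\<psi> has_real_derivative \<psi>' x) (at x)) \<and> continuous_on UNIV \<psi>' \<and>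
     (\<exists>a b. 0 < a \<and> b < 1 \<and> (\<forall>x. x \<notin> {a..b} \<longrightarrow> \<psi> x = 0))"

definition has_weak_deriv :: "(real \<Rightarrow> real) \<Rightarrow> (real \<Rightarrow> real) \<Rightarrow> bool" where
  "has_weak_deriv u g \<longleftrightarrow> u \<in> L2 \<and> g \<in> L2 \<and>
     (\<forall>\<psi> \<psi>'. test_function \<psi> \<psi>' \<longrightarrow>
        (\<integral>x. u x * \<psi>' x \<partial>I01) = - (\<integral>x. g x * \<psi> x \<partial>I01))"

text \<open>The weak derivative is unique only almost everywhere; \<open>wderiv\<close> picks a representative.\<close>

definition wderiv :: "(real \<Rightarrow> real) \<Rightarrow> real \<Rightarrow> real" where
  "wderiv u = (SOME g. has_weak_deriv u g)"

primrec sobolev :: "nat \<Rightarrow> (real \<Rightarrow> real) set" where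
  "sobolev 0 = L2"
| "sobolev (Suc n) = {u. \<exists>g \<in> sobolev n. has_weak_deriv u g}"

text \<open>Point values, in particular boundary values, are those of the representative that is
  continuous on the closed interval.\<close>

definition point_value :: "(real \<Rightarrow> real) \<Rightarrow> real \<Rightarrow> real" where
  "point_value u p =
     (THE c. \<exists>v. continuous_on {0..1} v \<and> (AE x in I01. u x = v x) \<and> v p = c)"

text \<open>Used only for \<open>n \<ge> 2\<close>.\<close>

definition Hl :: "nat \<Rightarrow> (real \<Rightarrow> real) set" where
  "Hl n = {u \<in> sobolev n. point_value u 0 = 0 \<and> point_value (wderiv u) 0 = 0}"

type_synonym state = "(real \<Rightarrow> real) \<times> (real \<Rightarrow> real) \<times> real"

definition X_space :: "state set" where
  "X_space = {(y, z, \<omega>). y \<in> Hl 2 \<and> z \<in> L2}"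

definition X_eq :: "state \<Rightarrow> state \<Rightarrow> bool" where
  "X_eq = (\<lambda>(y, z, \<omega>) (y', z', \<omega>').
     (AE x in I01. y x = y' x) \<and> (AE x in I01. z x = z' x) \<and> \<omega> = \<omega>')"

definition X_inner :: "real \<Rightarrow> real \<Rightarrow> real \<Rightarrow> state \<Rightarrow> state \<Rightarrow> real" where
  "X_inner EI \<rho> varpi = (\<lambda>(y, z, \<omega>) (y', z', \<omega>').
     (\<integral>x. EI * (wderiv ^^ 2) y x * (wderiv ^^ 2) y' x - \<rho> * varpi\<^sup>2 * y x * y' x
           + \<rho> * z x * z' x \<partial>I01) + \<omega> * \<omega>')"

definition X_norm :: "real \<Rightarrow> real \<Rightarrow> real \<Rightarrow> state \<Rightarrow> real" where
  "X_norm EI \<rho> varpi u = sqrt (X_inner EI \<rho> varpi u u)"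

definition X_scale :: "real \<Rightarrow> state \<Rightarrow> state" where
  "X_scale r = (\<lambda>(y, z, \<omega>). (\<lambda>x. r * y x, \<lambda>x. r * z x, r * \<omega>))"

definition dom_A :: "(real \<Rightarrow> real) \<Rightarrow> ((real \<Rightarrow> real) \<times> (real \<Rightarrow> real)) set" where
  "dom_A f = {(y, z). y \<in> Hl 4 \<and> z \<in> Hl 2 \<and>
     point_value ((wderiv ^^ 3) y) 1 = f (point_value z 1) \<and>
     point_value ((wderiv ^^ 2) y) 1 = - f (point_value (wderiv z) 1)}"

definition op_A ::
    "real \<Rightarrow> real \<Rightarrow> real \<Rightarrow> (real \<Rightarrow> real) \<times> (real \<Rightarrow> real) \<Rightarrow> (real \<Rightarrow> real) \<times> (real \<Rightarrow> real)" where
  "op_A EI \<rho> varpi = (\<lambda>(y, z).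
     (\<lambda>x. - z x, \<lambda>x. EI / \<rho> * (wderiv ^^ 4) y x - varpi\<^sup>2 * y x))"

definition dom_calA :: "(real \<Rightarrow> real) \<Rightarrow> state set" where
  "dom_calA f = {(y, z, \<omega>). (y, z) \<in> dom_A f}"

definition calA :: "real \<Rightarrow> real \<Rightarrow> real \<Rightarrow> state \<Rightarrow> state" where
  "calA EI \<rho> varpi = (\<lambda>(y, z, \<omega>).
     (fst (op_A EI \<rho> varpi (y, z)), snd (op_A EI \<rho> varpi (y, z)), 0))"

definition calB :: "real \<Rightarrow> real \<Rightarrow> real \<Rightarrow> (real \<Rightarrow> real) \<Rightarrow> state \<Rightarrow> state" where
  "calB \<rho> I_d varpi \<gamma> = (\<lambda>(y, z, \<omega>).
     (\<lambda>x. 0, \<lambda>x. (varpi\<^sup>2 - \<omega>\<^sup>2) * y x,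
      (\<gamma> (\<omega> - varpi) + 2 * \<rho> * \<omega> * L2_inner y z) / (I_d + \<rho> * L2_inner y y)))"

text \<open>Absolute continuity on \<open>[a,b]\<close> of a state-valued function with respect to a norm \<open>N\<close>.\<close>

definition abs_cont_on :: "(state \<Rightarrow> real) \<Rightarrow> real \<Rightarrow> real \<Rightarrow> (real \<Rightarrow> state) \<Rightarrow> bool" where
  "abs_cont_on N a b u \<longleftrightarrow> (\<forall>\<epsilon>>0. \<exists>\<delta>>0. \<forall>(n::nat) l r.
     (\<forall>k<n. a \<le> l k \<and> l k \<le> r k \<and> r k \<le> b) \<and>
     disjoint_family_on (\<lambda>k. {l k<..<r k}) {..<n} \<and> (\<Sum>k<n. r k - l k) < \<delta> \<longrightarrow>
     (\<Sum>k<n. N (u (r k) - u (l k))) < \<epsilon>)"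

text \<open>
  Global strong solutions of \<open>du/dt + (A + B) u = 0\<close> in the sense of the theory of accretive
  operators: locally absolutely continuous in the norm of the state space, in the domain of the
  operator and satisfying the equation (with the derivative in that norm) at almost every time.
  The boundary conditions at 0 and at 1 are part of membership in the domain, and the first
  component of the equation says \<open>z = y\<^sub>t\<close>.
\<close>

definition strong_solution ::
    "real \<Rightarrow> real \<Rightarrow> real \<Rightarrow> real \<Rightarrow> (real \<Rightarrow> real) \<Rightarrow> (real \<Rightarrow> real) \<Rightarrow> state \<Rightarrow> (real \<Rightarrow> state) \<Rightarrow> bool"
  where
  "strong_solution EI \<rho> I_d varpi f \<gamma> u0 u \<longleftrightarrow>
     (\<forall>t\<ge>0. u t \<in> X_space) \<and>
     X_eq (u 0) u0 \<and>
     (\<forall>T>0. abs_cont_on (X_norm EI \<rho> varpi) 0 T u) \<and>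
     (AE t in lebesgue_on {0<..}. u t \<in> dom_calA f \<and>
        ((\<lambda>h. X_norm EI \<rho> varpi
                (X_scale (1 / h) (u (t + h) - u t)
                 + (calA EI \<rho> varpi (u t) + calB \<rho> I_d varpi \<gamma> (u t)))) \<longlongrightarrow> 0) (at 0))"

end

theory Submission imports Defs begin

text \<open>
  Write \<open>p = y\<^sub>x\<^sub>x\<close>, \<open>\<eta> = \<omega> - \<varpi>\<close>. The energy
  \<open>V = (EI |p|\<^sup>2 - \<rho> \<varpi>\<^sup>2 |y|\<^sup>2 + \<rho> |z|\<^sup>2) / 2 + (I\<^sub>d + \<rho> |y|\<^sup>2) \<eta>\<^sup>2 / 2\<close> satisfies
  \<open>V' = - \<gamma>(\<eta>) \<eta> - EI (f(z(1)) z(1) + f(z\<^sub>x(1)) z\<^sub>x(1))\<close> for almost every time, so it is nonincreasing and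
  the solution is bounded. The multiplier \<open>F = \<rho> \<integral> x y\<^sub>x z\<close> has
  \<open>F' \<le> - \<rho>/2 |z|\<^sup>2 - d |p|\<^sup>2 + K\<^sub>1 (z(1)\<^sup>2 + z\<^sub>x(1)\<^sup>2) + K\<^sub>2 \<eta>\<^sup>2\<close> with \<open>d > 0\<close>, because
  \<open>y(1)\<^sup>2 \<le> |p|\<^sup>2 / 3\<close> and \<open>\<rho> \<varpi>\<^sup>2 < 9 EI\<close>, and because the linear growth of \<open>f\<close> controls the boundary terms.
  For small \<open>\<epsilon>\<close> the functional \<open>W = V + \<epsilon> F\<close> is equivalent to \<open>|p|\<^sup>2 + |z|\<^sup>2 + \<eta>\<^sup>2\<close> and satisfies
  \<open>W' \<le> - \<beta> W\<close>. As \<open>W\<close> is absolutely continuous along the solution, this inequality for almost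
  every time yields exponential decay.
\<close>

section \<open>Absolute continuity\<close>

text \<open>The equation and membership in the domain are available only at almost every time, so
  every monotonicity claim is reduced to a real function that is absolutely continuous in time and
  has a derivative of the right sign off a null set. The same principle, applied in space, gives
  integration by parts for continuous representatives. These carry the whole calculus in space,
  because \<open>wderiv\<close> is a choice, linear only almost everywhere, and boundary values
  require continuity. Two constants bound y by p. The estimate |y|^2 \<le> |p|^2 / 12 alone would
  make the norm coercive for \<rho> varpi^2 < 12 EI; the multiplier, however, leaves the tip value
  y(1)^2 \<le> |p|^2 / 3, and this term is what asks for 9 EI. The rotation enters F' through (varpi
  + \<eta>)^2. Its terms in \<eta> have degree above two in the state and become quadratic only
  after V \<le> V(0) has bounded p and \<eta>. Hence boundedness precedes the choice of \<epsilon>,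
  and the constants obtained, including the rate, depend on the initial datum.\<close>

definition short_family :: "real \<Rightarrow> real \<Rightarrow> real \<Rightarrow> nat \<Rightarrow> (nat \<Rightarrow> real) \<Rightarrow> (nat \<Rightarrow> real) \<Rightarrow> bool" where
  "short_family a b \<delta> n l r \<longleftrightarrow> (\<forall>k<n. a \<le> l k \<and> l k \<le> r k \<and> r k \<le> b) \<and>
     disjoint_family_on (\<lambda>k. {l k<..<r k}) {..<n} \<and> (\<Sum>k<n. r k - l k) < \<delta>"

text \<open>\<open>D\<close> is an arbitrary function of the endpoints, so that one notion covers
  increments of real functions, of states in a norm, of components in \<open>L2_norm\<close>,
  integrals over subintervals and plain lengths.\<close>

definition ac_increments :: "real \<Rightarrow> real \<Rightarrow> (real \<Rightarrow> real \<Rightarrow> real) \<Rightarrow> bool" where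
  "ac_increments a b D \<longleftrightarrow>
     (\<forall>\<epsilon>>0. \<exists>\<delta>>0. \<forall>n l r. short_family a b \<delta> n l r \<longrightarrow> (\<Sum>k<n. D (l k) (r k)) < \<epsilon>)"

lemma abs_cont_on_iff: "abs_cont_on N a b u \<longleftrightarrow> ac_increments a b (\<lambda>l r. N (u r - u l))"
  unfolding abs_cont_on_def ac_increments_def short_family_def ..

lemma ac_incrementsE:
  assumes "ac_increments a b D" "e > 0"
  obtains d where "d > 0" "\<And>n l r. short_family a b d n l r \<Longrightarrow> (\<Sum>k<n. D (l k) (r k)) < e"
  using assms unfolding ac_increments_def by blast

lemma ac_increments_length: "ac_increments a b (\<lambda>l r. r - l)"
  unfolding ac_increments_def short_family_def by blast

lemma ac_increments_add:
  assumes "ac_increments a b D" "ac_increments a b E"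
  shows "ac_increments a b (\<lambda>l r. D l r + E l r)"
  unfolding ac_increments_def
proof (intro allI impI)
  fix e :: real assume "e > 0"
  then have "e/2 > 0" by simp
  obtain d1 where d1: "d1 > 0" "\<And>n l r. short_family a b d1 n l r \<Longrightarrow> (\<Sum>k<n. D (l k) (r k)) < e/2"
    using ac_incrementsE[OF assms(1) \<open>e/2 > 0\<close>] by blast
  obtain d2 where d2: "d2 > 0" "\<And>n l r. short_family a b d2 n l r \<Longrightarrow> (\<Sum>k<n. E (l k) (r k)) < e/2"
    using ac_incrementsE[OF assms(2) \<open>e/2 > 0\<close>] by blast
  show "\<exists>\<delta>>0. \<forall>n l r. short_family a b \<delta> n l r \<longrightarrow> (\<Sum>k<n. D (l k) (r k) + E (l k) (r k)) < e"
  proof (intro exI[of _ "min d1 d2"] conjI allI impI)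
    fix n l r assume "short_family a b (min d1 d2) n l r"
    then have "short_family a b d1 n l r" "short_family a b d2 n l r" by (auto simp: short_family_def)
    from d1(2)[OF this(1)] d2(2)[OF this(2)]
    show "(\<Sum>k<n. D (l k) (r k) + E (l k) (r k)) < e"
      by (simp add: sum.distrib)
  qed (use d1 d2 in auto)
qed

text \<open>Whatever is dominated by absolutely continuous increments is absolutely continuous; most
  later instances are obtained by such a comparison.\<close>

lemma ac_increments_le:
  assumes D: "ac_increments a b D" and "K \<ge> 0"
    and le: "\<And>l r. a \<le> l \<Longrightarrow> l \<le> r \<Longrightarrow> r \<le> b \<Longrightarrow> E l r \<le> K * D l r"
  shows "ac_increments a b E"
  unfolding ac_increments_def
proof (intro allI impI)
  fix e :: real assume "e > 0"
  \<comment> \<open>Dividing by \<open>K + 1\<close> instead of \<open>K\<close> also covers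
    \<open>K = 0\<close>.\<close>
  then have "e / (K + 1) > 0" using \<open>K \<ge> 0\<close> by simp
  then obtain d where d: "d > 0" "\<And>n l r. short_family a b d n l r \<Longrightarrow> (\<Sum>k<n. D (l k) (r k)) < e / (K + 1)"
    using ac_incrementsE[OF D] by blast
  show "\<exists>\<delta>>0. \<forall>n l r. short_family a b \<delta> n l r \<longrightarrow> (\<Sum>k<n. E (l k) (r k)) < e"
  proof (intro exI[of _ d] conjI allI impI)
    fix n l r
    assume A: "short_family a b d n l r"
    then have "(\<Sum>k<n. E (l k) (r k)) \<le> (\<Sum>k<n. K * D (l k) (r k))"
      by (intro sum_mono le) (auto simp: short_family_def)
    also have "\<dots> = K * (\<Sum>k<n. D (l k) (r k))" by (simp add: sum_distrib_left)
    also have "\<dots> \<le> K * (e / (K + 1))"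
      using d(2)[OF A] \<open>K \<ge> 0\<close> by (intro mult_left_mono) auto
    also have "\<dots> < e" using \<open>K \<ge> 0\<close> \<open>e > 0\<close> by (simp add: field_simps)
    finally show "(\<Sum>k<n. E (l k) (r k)) < e" .
  qed (use d in auto)
qed

text \<open>Where the derivative is nonpositive, a fine tagged partition controls the increments by
  their lengths; the tags in the exceptional null set contribute little by absolute continuity.\<close>

lemma ac_nonincreasing:
  fixes g :: "real \<Rightarrow> real"
  assumes "a \<le> b"
    and ac: "ac_increments a b (\<lambda>l r. \<bar>g r - g l\<bar>)"
    and N: "negligible N"
    and der: "\<And>t. t \<in> {a..b} - N \<Longrightarrow> \<exists>D\<le>0. (g has_real_derivative D) (at t within {a..b})"
  shows "g b \<le> g a"
proof (rule field_le_epsilon)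
  fix e0 :: real assume "e0 > 0"
  \<comment> \<open>Intervals with good tags will cost \<open>e\<close> per unit of length, at most
    \<open>e * (b - a)\<close> in all; those tagged in \<open>N\<close> cost one further
    \<open>e\<close>.\<close>
  define e where "e = e0 / (b - a + 1)"
  have "e > 0" using \<open>e0 > 0\<close> \<open>a \<le> b\<close> by (simp add: e_def)
  obtain d where d: "d > 0"
    "\<And>n l r. short_family a b d n l r \<Longrightarrow> (\<Sum>k<n. \<bar>g (r k) - g (l k)\<bar>) < e"
    using ac_incrementsE[OF ac \<open>e > 0\<close>] by blast
  \<comment> \<open>Intervals tagged in \<open>N\<close> will be forced into \<open>U\<close>, so
    that their total length stays below the \<open>d\<close> of absolute continuity.\<close>
  obtain U where U: "open U" "N \<subseteq> U" "U - N \<in> lmeasurable" "emeasure lebesgue (U - N) < ennreal d"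
    using sets_lebesgue_outer_open[OF negligible_imp_sets[OF N] d(1)] by metis
  have Um: "U \<in> lmeasurable" "measure lebesgue U < d"
  proof -
    have Ns: "N \<in> lmeasurable" "measure lebesgue N = 0" using N negligible_iff_measure by auto
    have UN: "U = (U - N) \<union> N" using U by auto
    show "U \<in> lmeasurable" using UN U(3) Ns(1) by (metis fmeasurable.Un)
    have "measure lebesgue U = measure lebesgue (U - N)"
      using measure_Diff_null_set[of U lebesgue N] N \<open>U \<in> lmeasurable\<close>
      by (simp add: negligible_iff_null_sets fmeasurableD)
    also have "\<dots> < d" using U(3,4) d(1)
      by (simp add: emeasure_eq_measure2 ennreal_less_iff)
    finally show "measure lebesgue U < d" .
  qed
  \<comment> \<open>The estimate is split at the tag: as the derivative is at most 0, the step to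
    the right of \<open>t\<close> and the step from the left of \<open>t\<close> each gain at most
    \<open>e\<close> times their length. A tag lies in its interval, so the two halves add
    up.\<close>
  have "\<exists>s>0. (t \<notin> N \<longrightarrow> (\<forall>x\<in>{a..b}. \<bar>x - t\<bar> < s \<longrightarrow> (x \<ge> t \<longrightarrow> g x - g t \<le> e * (x - t)) \<and>
                (x \<le> t \<longrightarrow> g t - g x \<le> e * (t - x)))) \<and> (t \<in> N \<longrightarrow> ball t s \<subseteq> U)" if t: "t \<in> {a..b}" for t
  proof (cases "t \<in> N")
    case True
    then show ?thesis using U(1,2) openE by blast
  next
    case False
    then obtain D where D: "D \<le> 0" "(g has_real_derivative D) (at t within {a..b})" using der t by blast
    then have "(g has_derivative (\<lambda>h. D * h)) (at t within {a..b})"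
      by (simp add: has_field_derivative_def)
    then obtain s where s: "s > 0" "\<And>x. x \<in> {a..b} \<Longrightarrow> \<bar>x - t\<bar> < s \<Longrightarrow> \<bar>g x - g t - D * (x - t)\<bar> \<le> e * \<bar>x - t\<bar>"
      using \<open>e > 0\<close> unfolding has_derivative_within_alt by (auto simp: real_norm_def)
    have "g x - g t \<le> e * (x - t)" if "x \<in> {a..b}" "\<bar>x - t\<bar> < s" "x \<ge> t" for x
      using s(2)[OF that(1,2)] that(3) mult_nonpos_nonneg[of D "x - t"] D(1) by auto
    moreover have "g t - g x \<le> e * (t - x)" if "x \<in> {a..b}" "\<bar>x - t\<bar> < s" "x \<le> t" for x
      using s(2)[OF that(1,2)] that(3) mult_nonpos_nonpos[of D "x - t"] D(1) by auto
    ultimately show ?thesis using False s(1) by blast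
  qed
  then have "\<forall>t\<in>{a..b}. \<exists>s. s > 0 \<and> (t \<notin> N \<longrightarrow> (\<forall>x\<in>{a..b}. \<bar>x - t\<bar> < s \<longrightarrow> (x \<ge> t \<longrightarrow> g x - g t \<le> e * (x - t)) \<and>
                (x \<le> t \<longrightarrow> g t - g x \<le> e * (t - x)))) \<and> (t \<in> N \<longrightarrow> ball t s \<subseteq> U)" by blast
  from bchoice[OF this] obtain s where s0: "\<forall>t\<in>{a..b}. s t > 0 \<and> (t \<notin> N \<longrightarrow> (\<forall>x\<in>{a..b}. \<bar>x - t\<bar> < s t \<longrightarrow> (x \<ge> t \<longrightarrow> g x - g t \<le> e * (x - t)) \<and>
                (x \<le> t \<longrightarrow> g t - g x \<le> e * (t - x)))) \<and> (t \<in> N \<longrightarrow> ball t (s t) \<subseteq> U)" by blast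
  have s: "\<And>t. t \<in> {a..b} \<Longrightarrow> s t > 0"
    "\<And>t x. t \<in> {a..b} - N \<Longrightarrow> x \<in> {a..b} \<Longrightarrow> \<bar>x - t\<bar> < s t \<Longrightarrow> x \<ge> t \<Longrightarrow> g x - g t \<le> e * (x - t)"
    "\<And>t x. t \<in> {a..b} - N \<Longrightarrow> x \<in> {a..b} \<Longrightarrow> \<bar>x - t\<bar> < s t \<Longrightarrow> x \<le> t \<Longrightarrow> g t - g x \<le> e * (t - x)"
    "\<And>t. t \<in> {a..b} \<inter> N \<Longrightarrow> ball t (s t) \<subseteq> U"
    using s0 by blast+
  define G where "G t = ball t (if t \<in> {a..b} then s t else 1)" for t
  have "gauge G" unfolding gauge_def G_def using s(1) by auto
  then obtain p where p: "p tagged_division_of {a..b}" "G fine p"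
    using fine_division_exists_real by blast
  have fin: "finite p" using tagged_division_ofD(1)[OF p(1)] .
  have tag: "x \<in> K" "K \<subseteq> {a..b}" "\<exists>l r. K = {l..r} \<and> l \<le> r \<and> a \<le> l \<and> r \<le> b" "K \<subseteq> G x" if "(x, K) \<in> p" for x K
  proof -
    note xK = that
    show 1: "x \<in> K" "K \<subseteq> {a..b}"
      using tagged_division_ofD(2,3)[OF p(1) xK] by blast+
    obtain l r where "K = cbox l r" using tagged_division_ofD(4)[OF p(1) xK] by blast
    then show "\<exists>l r. K = {l..r} \<and> l \<le> r \<and> a \<le> l \<and> r \<le> b" using 1
      by (intro exI[of _ l] exI[of _ r]) auto
    show "K \<subseteq> G x" using fineD[OF p(2) xK] .
  qed
  define q where "q = {(x, K) \<in> p. x \<in> N}"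
  have q: "q \<subseteq> p" "finite q" using fin by (auto simp: q_def intro: finite_subset)
  have tot: "(\<Sum>(x,K)\<in>p. g (Sup K) - g (Inf K)) = g b - g a"
    using additive_tagged_division_1[OF \<open>a \<le> b\<close> p(1), of g] .
  have len: "(\<Sum>(x,K)\<in>p. Sup K - Inf K) = b - a"
    using additive_tagged_division_1[OF \<open>a \<le> b\<close> p(1), of "\<lambda>x. x"] .
  have 1: "(\<Sum>(x,K)\<in>p - q. g (Sup K) - g (Inf K)) \<le> (\<Sum>(x,K)\<in>p - q. e * (Sup K - Inf K))"
  proof (rule sum_mono, clarify)
    fix x K assume A: "(x, K) \<in> p" "(x, K) \<notin> q"
    then obtain l r where K: "K = {l..r}" "l \<le> r" "a \<le> l" "r \<le> b" using tag(3) by blast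
    have x: "x \<in> {l..r}" "x \<in> {a..b} - N" using tag(1,2)[OF A(1)] A K by (auto simp: q_def)
    then have "{l..r} \<subseteq> ball x (s x)" using tag(4)[OF A(1)] K by (auto simp: G_def)
    then have lr: "\<bar>l - x\<bar> < s x" "\<bar>r - x\<bar> < s x" using K(2)
      by (auto simp: subset_eq dist_real_def abs_minus_commute)
    have "g r - g x \<le> e * (r - x)" "g x - g l \<le> e * (x - l)"
      using s(2)[OF x(2) _ lr(2)] s(3)[OF x(2) _ lr(1)] x K by auto
    then show "g (Sup K) - g (Inf K) \<le> e * (Sup K - Inf K)"
      using K by (simp add: algebra_simps)
  qed
  have 2: "(\<Sum>(x,K)\<in>p - q. e * (Sup K - Inf K)) \<le> (\<Sum>(x,K)\<in>p. e * (Sup K - Inf K))"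
  proof (rule sum_mono2[OF fin])
    fix xK assume "xK \<in> p - (p - q)"
    then obtain x K where "xK = (x, K)" "(x, K) \<in> p" by (cases xK) auto
    then show "0 \<le> (case xK of (x, K) \<Rightarrow> e * (Sup K - Inf K))" using tag(3)[of x K] \<open>e > 0\<close> by auto
  qed auto
  have 3: "(\<Sum>(x,K)\<in>p. e * (Sup K - Inf K)) = e * (b - a)"
    unfolding len[symmetric] by (simp add: sum_distrib_left case_prod_unfold)
  have 4: "(\<Sum>(x,K)\<in>q. g (Sup K) - g (Inf K)) \<le> e"
  proof -
    \<comment> \<open>Absolute continuity speaks of indexed families, so the part \<open>q\<close>
      of the division with tags in \<open>N\<close> is enumerated.\<close>
    obtain h where h: "bij_betw h {..<card q} q"
      using ex_bij_betw_nat_finite[OF q(2)] by (auto simp: atLeast0LessThan)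
    define l where "l k = Inf (snd (h k))" for k
    define r where "r k = Sup (snd (h k))" for k
    have hk: "h k \<in> q" if "k < card q" for k using h that by (auto simp: bij_betw_def)
    have K: "snd (h k) = {l k..r k}" "l k \<le> r k" "a \<le> l k" "r k \<le> b" if "k < card q" for k
    proof -
      have "(fst (h k), snd (h k)) \<in> p" using hk[OF that] q by auto
      from tag(3)[OF this] obtain l' r' where "snd (h k) = {l'..r'}" "l' \<le> r'" "a \<le> l'" "r' \<le> b" by blast
      then show "snd (h k) = {l k..r k}" "l k \<le> r k" "a \<le> l k" "r k \<le> b" by (auto simp: l_def r_def)
    qed
    have disj: "disjoint_family_on (\<lambda>k. {l k<..<r k}) {..<card q}"
      unfolding disjoint_family_on_def
    proof (intro ballI impI)
      fix m n assume mn: "m \<in> {..<card q}" "n \<in> {..<card q}" "m \<noteq> n"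
      then have "h m \<noteq> h n" using h by (auto simp: bij_betw_def inj_on_def)
      then have "(fst (h m), snd (h m)) \<noteq> (fst (h n), snd (h n))" by (simp add: prod_eq_iff)
      moreover have "(fst (h m), snd (h m)) \<in> p" "(fst (h n), snd (h n)) \<in> p" using hk mn q by auto
      ultimately have "interior (snd (h m)) \<inter> interior (snd (h n)) = {}"
        using tagged_division_ofD(5)[OF p(1), of "fst (h m)" "snd (h m)" "fst (h n)" "snd (h n)"] by blast
      then show "{l m<..<r m} \<inter> {l n<..<r n} = {}" using K mn by (simp add: interior_atLeastAtMost_real)
    qed
    have "(\<Sum>k<card q. r k - l k) = (\<Sum>k<card q. measure lebesgue {l k<..<r k})"
      using K by (intro sum.cong) auto
    also have "\<dots> = measure lebesgue (\<Union>k<card q. {l k<..<r k})"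
      using disj by (intro measure_finite_Union[symmetric]) (auto simp: K(2))
    also have "\<dots> \<le> measure lebesgue U"
    proof (rule measure_mono_fmeasurable)
      show "(\<Union>k<card q. {l k<..<r k}) \<subseteq> U"
      proof clarify
        fix x k assume "k < card q" and x: "x \<in> {l k<..<r k}"
        have c: "(fst (h k), snd (h k)) \<in> p" "fst (h k) \<in> N" using hk[OF \<open>k < card q\<close>] by (auto simp: q_def)
        moreover have "fst (h k) \<in> {a..b}" using tag(1,2)[OF c(1)] by blast
        ultimately have "snd (h k) \<subseteq> ball (fst (h k)) (s (fst (h k)))" "ball (fst (h k)) (s (fst (h k))) \<subseteq> U"
          using tag(4)[OF c(1)] s(4)[of "fst (h k)"] by (auto simp: G_def)
        then have "{l k..r k} \<subseteq> U" unfolding K(1)[OF \<open>k < card q\<close>] by (rule subset_trans)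
        then show "x \<in> U" using x by (meson atLeastAtMost_iff greaterThanLessThan_iff less_imp_le subsetD)
      qed
    qed (use Um in auto)
    finally have "(\<Sum>k<card q. r k - l k) < d" using Um by simp
    then have "(\<Sum>k<card q. \<bar>g (r k) - g (l k)\<bar>) < e"
      using d(2)[of "card q" l r] K disj by (simp add: short_family_def)
    moreover have "(\<Sum>(x,K)\<in>q. g (Sup K) - g (Inf K)) = (\<Sum>k<card q. g (r k) - g (l k))"
      by (subst sum.reindex_bij_betw[OF h, symmetric]) (simp add: l_def r_def case_prod_unfold)
    moreover have "(\<Sum>k<card q. g (r k) - g (l k)) \<le> (\<Sum>k<card q. \<bar>g (r k) - g (l k)\<bar>)"
      by (intro sum_mono) auto
    ultimately show ?thesis by linarith
  qed
  have "g b - g a = (\<Sum>(x,K)\<in>p - q. g (Sup K) - g (Inf K)) + (\<Sum>(x,K)\<in>q. g (Sup K) - g (Inf K))"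
    unfolding tot[symmetric] by (rule sum.subset_diff[OF q(1) fin])
  also have "\<dots> \<le> e * (b - a + 1)" using 1 2 3 4 by (simp add: algebra_simps)
  also have "\<dots> = e0" using \<open>a \<le> b\<close> by (simp add: e_def)
  finally show "g b \<le> g a + e0" by simp
qed

section \<open>The space \<open>L\<^sup>2(0,1)\<close>\<close>

definition L2_norm :: "(real \<Rightarrow> real) \<Rightarrow> real" where
  "L2_norm u = sqrt (L2_inner u u)"

lemma emeasure_I01: "emeasure I01 (space I01) = 1"
  by (simp add: emeasure_restrict_space)

lemma finite_measure_I01: "finite_measure I01"
  by (rule finite_measureI) (simp add: emeasure_restrict_space)

lemma L2_D: assumes "u \<in> L2" shows "u \<in> borel_measurable I01" "integrable I01 (\<lambda>x. (u x)\<^sup>2)"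
  using assms by (auto simp: L2_def)

lemma L2_mult_integrable:
  assumes "u \<in> L2" "v \<in> L2"
  shows "integrable I01 (\<lambda>x. u x * v x)"
proof (rule Bochner_Integration.integrable_bound)
  show "integrable I01 (\<lambda>x. (u x)\<^sup>2 + (v x)\<^sup>2)" using assms by (auto simp: L2_def)
  show "(\<lambda>x. u x * v x) \<in> borel_measurable I01" using assms by (auto simp: L2_def)
  have "\<bar>u x * v x\<bar> \<le> (u x)\<^sup>2 + (v x)\<^sup>2" for x
  proof -
    have "2 * \<bar>u x * v x\<bar> \<le> (u x)\<^sup>2 + (v x)\<^sup>2"
      using sum_squares_bound[of "\<bar>u x\<bar>" "\<bar>v x\<bar>"] by (simp add: abs_mult)
    then show ?thesis using abs_ge_zero[of "u x * v x"] by linarith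
  qed
  then show "AE x in I01. norm (u x * v x) \<le> norm ((u x)\<^sup>2 + (v x)\<^sup>2)"
    by auto
qed

lemma L2_add: assumes "u \<in> L2" "v \<in> L2" shows "(\<lambda>x. u x + v x) \<in> L2"
proof -
  have "integrable I01 (\<lambda>x. (u x)\<^sup>2 + (v x)\<^sup>2 + 2 * (u x * v x))"
    using assms L2_mult_integrable[OF assms] by (auto simp: L2_def)
  also have "(\<lambda>x. (u x)\<^sup>2 + (v x)\<^sup>2 + 2 * (u x * v x)) = (\<lambda>x. (u x + v x)\<^sup>2)"
    by (auto simp: power2_eq_square algebra_simps)
  finally show ?thesis using assms by (auto simp: L2_def)
qed

lemma L2_bounded_mult:
  assumes "u \<in> L2" "v \<in> borel_measurable I01" "\<And>x. x \<in> {0<..<1} \<Longrightarrow> \<bar>v x\<bar> \<le> B"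
  shows "(\<lambda>x. v x * u x) \<in> L2"
proof -
  have "integrable I01 (\<lambda>x. (v x * u x)\<^sup>2)"
  proof (rule Bochner_Integration.integrable_bound)
    show "integrable I01 (\<lambda>x. B\<^sup>2 * (u x)\<^sup>2)" using assms by (auto simp: L2_def)
    show "(\<lambda>x. (v x * u x)\<^sup>2) \<in> borel_measurable I01" using assms by (auto simp: L2_def)
    have "(v x * u x)\<^sup>2 \<le> B\<^sup>2 * (u x)\<^sup>2" if "x \<in> {0<..<1}" for x
      unfolding power_mult_distrib
      using assms(3)[OF that] by (intro mult_right_mono) (auto simp: abs_le_square_iff[symmetric])
    then show "AE x in I01. norm ((v x * u x)\<^sup>2) \<le> norm (B\<^sup>2 * (u x)\<^sup>2)"
      by (intro AE_I2) auto
  qed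
  then show ?thesis using assms by (auto simp: L2_def)
qed

lemma L2_cmult: "u \<in> L2 \<Longrightarrow> (\<lambda>x. c * u x) \<in> L2"
  by (rule L2_bounded_mult[where B="\<bar>c\<bar>"]) auto

lemma L2_minus: "u \<in> L2 \<Longrightarrow> (\<lambda>x. - u x) \<in> L2"
  using L2_cmult[of u "-1"] by simp

lemma L2_diff: "u \<in> L2 \<Longrightarrow> v \<in> L2 \<Longrightarrow> (\<lambda>x. u x - v x) \<in> L2"
  using L2_add[OF _ L2_minus, of u v] by simp

lemma L2_bounded:
  assumes "v \<in> borel_measurable I01" "\<And>x. x \<in> {0<..<1} \<Longrightarrow> \<bar>v x\<bar> \<le> B"
  shows "v \<in> L2"
proof -
  interpret finite_measure I01 by (rule finite_measure_I01)
  have "(\<lambda>x. 1) \<in> L2" by (auto simp: L2_def)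
  from L2_bounded_mult[OF this assms] show ?thesis by simp
qed

lemma L2_const: "(\<lambda>x. c) \<in> L2"
  by (rule L2_bounded[where B="\<bar>c\<bar>"]) auto

lemma L2_continuous:
  assumes "continuous_on {0..1} v" shows "v \<in> L2"
proof -
  have "compact (v ` {0..1})" using assms by (intro compact_continuous_image) auto
  then obtain B where "\<forall>x\<in>{0..1}. \<bar>v x\<bar> \<le> B"
    by (auto dest!: compact_imp_bounded simp: bounded_iff)
  moreover have "v \<in> borel_measurable I01"
    using assms by (intro continuous_imp_measurable_on_sets_lebesgue continuous_on_subset[OF assms]) auto
  ultimately show ?thesis by (intro L2_bounded) auto
qed

lemma L2_AE_cong:
  assumes "u \<in> L2" "AE x in I01. u x = v x" shows "v \<in> L2"
proof -
  have v: "v \<in> borel_measurable I01"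
  proof -
    have "(\<lambda>x. if x \<in> {0<..<1} then u x else 0) \<in> borel_measurable lebesgue"
      by (rule borel_measurable_if_I[OF L2_D(1)[OF assms(1)]]) simp
    then have "(\<lambda>x. if x \<in> {0<..<1} then v x else 0) \<in> borel_measurable lebesgue"
      by (rule borel_measurable_AE) (use assms(2) in \<open>auto simp: AE_restrict_space_iff elim!: AE_mp\<close>)
    then show ?thesis by (rule borel_measurable_if_D)
  qed
  moreover have "integrable I01 (\<lambda>x. (v x)\<^sup>2)"
    by (rule integrable_cong_AE_imp[OF L2_D(2)[OF assms(1)]]) (use v assms(2) in auto)
  ultimately show ?thesis by (simp add: L2_def)
qed

lemma L2_integrable: "u \<in> L2 \<Longrightarrow> integrable I01 u"
  using L2_mult_integrable[OF _ L2_const[of 1]] by simp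

lemma L2_inner_commute: "L2_inner u v = L2_inner v u"
  by (simp add: L2_inner_def mult.commute)

lemma L2_inner_add_left:
  "u \<in> L2 \<Longrightarrow> v \<in> L2 \<Longrightarrow> w \<in> L2 \<Longrightarrow> L2_inner (\<lambda>x. u x + v x) w = L2_inner u w + L2_inner v w"
  unfolding L2_inner_def by (simp add: distrib_right L2_mult_integrable)

lemma L2_inner_diff_left:
  "u \<in> L2 \<Longrightarrow> v \<in> L2 \<Longrightarrow> w \<in> L2 \<Longrightarrow> L2_inner (\<lambda>x. u x - v x) w = L2_inner u w - L2_inner v w"
  unfolding L2_inner_def by (simp add: left_diff_distrib L2_mult_integrable)

lemma L2_inner_cmult_left: "L2_inner (\<lambda>x. c * u x) w = c * L2_inner u w"
  unfolding L2_inner_def by (simp add: mult.assoc)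

lemma L2_inner_add_right:
  "u \<in> L2 \<Longrightarrow> v \<in> L2 \<Longrightarrow> w \<in> L2 \<Longrightarrow> L2_inner w (\<lambda>x. u x + v x) = L2_inner w u + L2_inner w v"
  by (simp add: L2_inner_commute[of w] L2_inner_add_left)

lemma L2_inner_diff_right:
  "u \<in> L2 \<Longrightarrow> v \<in> L2 \<Longrightarrow> w \<in> L2 \<Longrightarrow> L2_inner w (\<lambda>x. u x - v x) = L2_inner w u - L2_inner w v"
  by (simp add: L2_inner_commute[of w] L2_inner_diff_left)

lemma L2_inner_cmult_right: "L2_inner w (\<lambda>x. c * u x) = c * L2_inner w u"
  by (simp add: L2_inner_commute[of w] L2_inner_cmult_left)

lemma L2_inner_nonneg: "0 \<le> L2_inner u u"
  unfolding L2_inner_def by (rule integral_nonneg_AE) auto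

lemma L2_inner_AE_cong:
  assumes "AE x in I01. u x = u' x" "AE x in I01. v x = v' x"
    and "u \<in> L2" "v \<in> L2"
  shows "L2_inner u v = L2_inner u' v'"
  unfolding L2_inner_def
proof (rule integral_cong_AE)
  have "u' \<in> L2" "v' \<in> L2" using assms L2_AE_cong by blast+
  then show "(\<lambda>x. u x * v x) \<in> borel_measurable I01" "(\<lambda>x. u' x * v' x) \<in> borel_measurable I01"
    using assms by (auto simp: L2_def)
  show "AE x in I01. u x * v x = u' x * v' x" using assms(1,2) by eventually_elim auto
qed

lemma discriminant_nonpos:
  fixes a b c :: real
  assumes "\<And>t. 0 \<le> a + 2 * t * b + t\<^sup>2 * c" "0 \<le> c"
  shows "b\<^sup>2 \<le> a * c"
proof (cases "c = 0")
  case True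
  have "b = 0"
  proof (rule ccontr)
    assume "b \<noteq> 0"
    \<comment> \<open>At this \<open>t\<close> the expression, affine because \<open>c = 0\<close>,
      equals -1.\<close>
    then show False using assms(1)[of "- (a + 1) / (2 * b)"] True by (simp add: field_simps)
  qed
  then show ?thesis using True by simp
next
  case False
  then have "c > 0" using assms(2) by simp
  \<comment> \<open>The quadratic is evaluated at its minimiser and multiplied by \<open>c\<close>
    to clear denominators.\<close>
  have "0 \<le> c * (a + 2 * (- b / c) * b + (- b / c)\<^sup>2 * c)"
    using assms(1)[of "- b / c"] \<open>c > 0\<close> by (intro mult_nonneg_nonneg) auto
  also have "\<dots> = a * c - b\<^sup>2" using \<open>c > 0\<close> by (simp add: field_simps power2_eq_square)
  finally show ?thesis by simp
qed

lemma L2_Cauchy_Schwarz_sq: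
  assumes "u \<in> L2" "v \<in> L2"
  shows "(L2_inner u v)\<^sup>2 \<le> L2_inner u u * L2_inner v v"
proof (rule discriminant_nonpos)
  fix t
  have "0 \<le> L2_inner (\<lambda>x. u x + t * v x) (\<lambda>x. u x + t * v x)" by (rule L2_inner_nonneg)
  also have "\<dots> = L2_inner u u + 2 * t * L2_inner u v + t\<^sup>2 * L2_inner v v"
    using assms by (simp add: L2_inner_add_left L2_inner_add_right L2_cmult L2_add L2_inner_cmult_left
      L2_inner_cmult_right L2_inner_commute[of v u] power2_eq_square algebra_simps)
  finally show "0 \<le> L2_inner u u + 2 * t * L2_inner u v + t\<^sup>2 * L2_inner v v" .
qed (rule L2_inner_nonneg)

lemma L2_norm_nonneg: "0 \<le> L2_norm u"
  by (simp add: L2_norm_def L2_inner_nonneg)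

lemma L2_norm_power2: "(L2_norm u)\<^sup>2 = L2_inner u u"
  by (simp add: L2_norm_def L2_inner_nonneg)

lemma L2_Cauchy_Schwarz:
  assumes "u \<in> L2" "v \<in> L2"
  shows "\<bar>L2_inner u v\<bar> \<le> L2_norm u * L2_norm v"
  by (rule power2_le_imp_le)
    (use L2_Cauchy_Schwarz_sq[OF assms] in \<open>auto simp: power_mult_distrib L2_norm_power2 L2_norm_nonneg\<close>)

lemma L2_norm_triangle:
  assumes "u \<in> L2" "v \<in> L2"
  shows "L2_norm (\<lambda>x. u x + v x) \<le> L2_norm u + L2_norm v"
proof (rule power2_le_imp_le)
  have "(L2_norm (\<lambda>x. u x + v x))\<^sup>2 = (L2_norm u)\<^sup>2 + 2 * L2_inner u v + (L2_norm v)\<^sup>2"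
    using assms by (simp add: L2_norm_power2 L2_inner_add_left L2_inner_add_right L2_add
      L2_inner_commute[of v u])
  also have "\<dots> \<le> (L2_norm u + L2_norm v)\<^sup>2"
    using L2_Cauchy_Schwarz[OF assms] by (simp add: power2_sum)
  finally show "(L2_norm (\<lambda>x. u x + v x))\<^sup>2 \<le> (L2_norm u + L2_norm v)\<^sup>2" .
qed (simp add: L2_norm_nonneg)

lemma L2_norm_diff_commute: "L2_norm (\<lambda>x. u x - v x) = L2_norm (\<lambda>x. v x - u x)"
  by (simp add: L2_norm_def L2_inner_def algebra_simps)

lemma L2_norm_diff_le:
  assumes "u \<in> L2" "v \<in> L2"
  shows "\<bar>L2_norm u - L2_norm v\<bar> \<le> L2_norm (\<lambda>x. u x - v x)"
  using L2_norm_triangle[OF L2_diff[OF assms] assms(2)]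
    L2_norm_triangle[OF L2_diff[OF assms(2,1)] assms(1)] L2_norm_diff_commute[of u v] by simp

lemma L2_norm_AE_cong:
  assumes "AE x in I01. u x = u' x" "u \<in> L2" shows "L2_norm u = L2_norm u'"
  using L2_inner_AE_cong[OF assms(1,1,2,2)] by (simp add: L2_norm_def)

lemma L2_norm_bounded_mult:
  assumes "u \<in> L2" "v \<in> borel_measurable I01" "\<And>x. x \<in> {0<..<1} \<Longrightarrow> \<bar>v x\<bar> \<le> 1"
  shows "L2_norm (\<lambda>x. v x * u x) \<le> L2_norm u"
proof -
  have "(v x * u x)\<^sup>2 \<le> (u x)\<^sup>2" if "x \<in> {0<..<1}" for x
    using assms(3)[OF that] abs_square_le_1[of "v x"]
    by (simp add: power_mult_distrib mult_left_le_one_le)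
  then show ?thesis
    unfolding L2_norm_def L2_inner_def power2_eq_square[symmetric] using assms
    by (intro real_sqrt_le_mono integral_mono L2_D(2) L2_bounded_mult) auto
qed

lemma L2_inner_le_integral:
  assumes "u \<in> L2" "continuous_on {0..1} b" "AE x in I01. (u x)\<^sup>2 \<le> b x"
  shows "L2_inner u u \<le> integral {0..1} b"
proof -
  have b: "integrable I01 b" using assms(2) by (intro L2_integrable L2_continuous)
  have "L2_inner u u \<le> (\<integral>x. b x \<partial>I01)"
    unfolding L2_inner_def power2_eq_square[symmetric]
    by (rule integral_mono_AE) (use assms b L2_D in auto)
  also have "\<dots> = integral {0..1} b"
    using lebesgue_integral_eq_integral[OF b] by (simp add: integral_open_interval_real)
  finally show ?thesis .
qed

section \<open>Integrals of square integrable functions over subintervals\<close>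

lemma L2_absolutely_integrable:
  assumes "g \<in> L2" "0 \<le> a" "b \<le> 1"
  shows "g absolutely_integrable_on {a..b}"
proof -
  have "g absolutely_integrable_on {0<..<1}"
    using L2_integrable[OF assms(1)] by (simp add: integrable_restrict_space set_integrable_def)
  then have "g absolutely_integrable_on {0..1}"
    using absolutely_integrable_on_open_interval[where f=g and a=0 and b=1] by (simp add: box_real)
  then show ?thesis
    by (rule set_integrable_subset) (use assms in auto)
qed

lemma L2_integral_I01: "g \<in> L2 \<Longrightarrow> (\<integral>x. g x \<partial>I01) = integral {0..1} g"
  using lebesgue_integral_eq_integral[OF L2_integrable] by (simp add: integral_open_interval_real)

lemma L2_integrable_on: "g \<in> L2 \<Longrightarrow> 0 \<le> a \<Longrightarrow> b \<le> 1 \<Longrightarrow> g integrable_on {a..b}"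
  using L2_absolutely_integrable set_lebesgue_integral_eq_integral(1) by blast

text \<open>Young's inequality, integrated. The square term is kept as an integral over all of (0,1)
  against an indicator, so that a sum over disjoint intervals collapses to one integral bounded by
  the squared norm of \<open>g\<close>.\<close>

lemma L2_abs_integral_le:
  assumes g: "g \<in> L2" and "0 \<le> l" "l \<le> r" "r \<le> 1" and "K > 0"
  shows "\<bar>integral {l..r} g\<bar> \<le> K/2 * (r - l) + (\<integral>x. indicator {l<..<r} x * (g x)\<^sup>2 \<partial>I01) / (2 * K)"
proof -
  have gi: "g absolutely_integrable_on {l<..<r}"
    using L2_absolutely_integrable[OF assms(1,2,4)] absolutely_integrable_on_open_interval[where f=g and a=l and b=r] by (simp add: box_real)
  define k where "k x = K/2 * indicator {l<..<r} x + indicator {l<..<r} x * (g x)\<^sup>2 / (2 * K)" for x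
  interpret finite_measure I01 by (rule finite_measure_I01)
  have sets: "{l<..<r} \<in> sets I01" using assms by (auto simp: sets_restrict_space_iff)
  have i1: "integrable I01 (\<lambda>x. indicator {l<..<r} x * (g x)\<^sup>2)"
    using integrable_mult_indicator[OF sets L2_D(2)[OF g]] by simp
  have i2: "integrable I01 (indicator {l<..<r} :: real \<Rightarrow> real)"
    using integrable_mult_indicator[OF sets, of "\<lambda>x. 1::real"] by simp
  have ki: "integrable I01 k" unfolding k_def using i1 i2
    by (intro Bochner_Integration.integrable_add integrable_mult_right integrable_divide)
  have sub: "{l<..<r} \<subseteq> {0<..<1}" using assms by auto
  have "\<bar>integral {l..r} g\<bar> = \<bar>integral {l<..<r} g\<bar>" by (simp add: integral_open_interval_real)
  also have "\<dots> = \<bar>\<integral>x. indicator {l<..<r} x * g x \<partial>I01\<bar>"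
  proof -
    have "(\<integral>x. indicator {l<..<r} x * g x \<partial>I01) = (\<integral>x. indicator {0<..<1} x * (indicator {l<..<r} x * g x) \<partial>lebesgue)"
      by (simp add: integral_restrict_space)
    also have "\<dots> = (\<integral>x. indicator {l<..<r} x * g x \<partial>lebesgue)"
      using sub by (intro Bochner_Integration.integral_cong) (auto simp: indicator_def)
    also have "\<dots> = integral {l<..<r} g"
      using set_lebesgue_integral_eq_integral(2)[OF gi] by (simp add: set_lebesgue_integral_def)
    finally show ?thesis by simp
  qed
  also have "\<dots> \<le> (\<integral>x. \<bar>indicator {l<..<r} x * g x\<bar> \<partial>I01)" by (rule integral_abs_bound)
  also have "\<dots> \<le> (\<integral>x. k x \<partial>I01)"
  proof (rule integral_mono)
    show "integrable I01 (\<lambda>x. \<bar>indicator {l<..<r} x * g x\<bar>)"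
      using integrable_mult_indicator[OF sets L2_integrable[OF g]] by simp
    have "\<bar>g x\<bar> \<le> K/2 + (g x)\<^sup>2 / (2 * K)" for x
    proof -
      have "0 \<le> (\<bar>g x\<bar> - K)\<^sup>2 / (2 * K)" using \<open>K > 0\<close> by simp
      also have "\<dots> = K/2 + (g x)\<^sup>2 / (2 * K) - \<bar>g x\<bar>"
        using \<open>K > 0\<close> by (simp add: power2_diff field_simps) (simp add: power2_eq_square)
      finally show ?thesis by simp
    qed
    then show "\<bar>indicator {l<..<r} x * g x\<bar> \<le> k x" for x
      by (auto simp: k_def indicator_def)
  qed (rule ki)
  also have "\<dots> = K/2 * measure I01 {l<..<r} + (\<integral>x. indicator {l<..<r} x * (g x)\<^sup>2 \<partial>I01) / (2 * K)"
  proof -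
    have sp: "{l<..<r} \<inter> space I01 = {l<..<r}" using sub by auto
    have "(\<integral>x. indicator {l<..<r} x \<partial>I01) = measure I01 {l<..<r}"
      using sp by (simp only: Bochner_Integration.integral_indicator)
    then show ?thesis unfolding k_def using i1 i2
      by (simp del: Bochner_Integration.integral_indicator)
  qed
  also have "measure I01 {l<..<r} = r - l"
    using assms sub by (simp add: measure_restrict_space)
  finally show ?thesis .
qed

text \<open>Splitting \<open>|g| \<le> K/2 + g\<^sup>2/(2K)\<close> with \<open>K\<close> large makes the second part small and the first
  proportional to the total length.\<close>

lemma ac_increments_integral:
  assumes g: "g \<in> L2"
  shows "ac_increments 0 1 (\<lambda>l r. \<bar>integral {l..r} g\<bar>)"
  unfolding ac_increments_def
proof (intro allI impI)
  fix e :: real assume "e > 0"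
  define Q where "Q = L2_inner g g"
  \<comment> \<open>With this \<open>K\<close> the square terms sum to at most \<open>e / 2\<close>,
    and total length below \<open>e / K\<close> keeps the linear terms under \<open>e / 2\<close>.
    The 1 keeps \<open>K\<close> positive if \<open>Q = 0\<close>.\<close>
  define K where "K = (Q + 1) / e"
  have "Q \<ge> 0" by (simp add: Q_def L2_inner_nonneg)
  then have "K > 0" using \<open>e > 0\<close> by (simp add: K_def)
  show "\<exists>\<delta>>0. \<forall>n l r. short_family 0 1 \<delta> n l r \<longrightarrow> (\<Sum>k<n. \<bar>integral {l k..r k} g\<bar>) < e"
  proof (intro exI[of _ "e / K"] conjI allI impI)
    fix n l r assume A: "short_family 0 1 (e / K) n l r"
    have sets: "{l k<..<r k} \<in> sets I01" if "k < n" for k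
    proof -
      have "{l k<..<r k} \<subseteq> {0<..<1}" using A that by (force simp: short_family_def)
      then show ?thesis by (auto simp: sets_restrict_space_iff)
    qed
    have i1: "integrable I01 (\<lambda>x. indicator {l k<..<r k} x * (g x)\<^sup>2)" if "k < n" for k
      using integrable_mult_indicator[OF sets[OF that] L2_D(2)[OF g]] by simp
    have "(\<Sum>k<n. \<bar>integral {l k..r k} g\<bar>) \<le>
        (\<Sum>k<n. K/2 * (r k - l k) + (\<integral>x. indicator {l k<..<r k} x * (g x)\<^sup>2 \<partial>I01) / (2 * K))"
      using A \<open>K > 0\<close> g by (intro sum_mono L2_abs_integral_le) (auto simp: short_family_def)
    also have "\<dots> = K/2 * (\<Sum>k<n. r k - l k) + (\<Sum>k<n. \<integral>x. indicator {l k<..<r k} x * (g x)\<^sup>2 \<partial>I01) / (2 * K)"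
      by (simp add: sum.distrib sum_distrib_left sum_divide_distrib)
    also have "(\<Sum>k<n. \<integral>x. indicator {l k<..<r k} x * (g x)\<^sup>2 \<partial>I01) =
        (\<integral>x. (\<Sum>k<n. indicator {l k<..<r k} x * (g x)\<^sup>2) \<partial>I01)"
      using i1 by (intro Bochner_Integration.integral_sum[symmetric]) auto
    also have "\<dots> \<le> Q"
      unfolding Q_def L2_inner_def power2_eq_square[symmetric]
    proof (rule integral_mono)
      show "integrable I01 (\<lambda>x. \<Sum>k<n. indicator {l k<..<r k} x * (g x)\<^sup>2)"
        by (intro Bochner_Integration.integrable_sum i1) auto
      have "(\<Sum>k<n. indicator {l k<..<r k} x) \<le> (1::real)" for x
      proof -
        have "(\<Sum>k<n. indicator {l k<..<r k} x) = (indicator (\<Union>k<n. {l k<..<r k}) x :: real)"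
          using A by (intro indicator_UN_disjoint[symmetric]) (auto simp: short_family_def)
        then show ?thesis by simp
      qed
      then show "(\<Sum>k<n. indicator {l k<..<r k} x * (g x)\<^sup>2) \<le> (g x)\<^sup>2" for x
        unfolding sum_distrib_right[symmetric]
        by (intro mult_left_le_one_le) (auto intro: sum_nonneg)
    qed (use g L2_D in auto)
    finally have "(\<Sum>k<n. \<bar>integral {l k..r k} g\<bar>) \<le> K/2 * (\<Sum>k<n. r k - l k) + Q / (2 * K)"
      using \<open>K > 0\<close> by (simp add: divide_right_mono)
    moreover have "K/2 * (\<Sum>k<n. r k - l k) < K/2 * (e/K)"
      using A \<open>K > 0\<close> by (intro mult_strict_left_mono) (auto simp: short_family_def)
    moreover have "K/2 * (e/K) = e/2" using \<open>K > 0\<close> by simp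
    moreover have "Q / (2 * K) \<le> e/2"
      using \<open>e > 0\<close> \<open>Q \<ge> 0\<close> by (simp add: K_def field_simps)
    ultimately show "(\<Sum>k<n. \<bar>integral {l k..r k} g\<bar>) < e" by linarith
  qed (use \<open>e > 0\<close> \<open>K > 0\<close> in auto)
qed

section \<open>Absolutely continuous representatives and weak derivatives\<close>

text \<open>\<open>F\<close> is the representative, continuous on \<open>[0,1]\<close>, of an \<open>H\<^sup>1\<close> function whose weak derivative is \<open>g\<close>.\<close>

definition H1_rep :: "(real \<Rightarrow> real) \<Rightarrow> (real \<Rightarrow> real) \<Rightarrow> bool" where
  "H1_rep F g \<longleftrightarrow> g \<in> L2 \<and> (\<forall>x\<in>{0..1}. F x - F 0 = integral {0..x} g)"

lemma H1_rep_increment: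
  assumes "H1_rep F g" "0 \<le> l" "l \<le> r" "r \<le> 1"
  shows "F r - F l = integral {l..r} g"
proof -
  have "integral {0..l} g + integral {l..r} g = integral {0..r} g"
    using assms L2_integrable_on[of g 0 r]
    by (intro Henstock_Kurzweil_Integration.integral_combine) (auto simp: H1_rep_def)
  moreover have "F r - F 0 = integral {0..r} g" "F l - F 0 = integral {0..l} g"
    using assms by (auto simp: H1_rep_def)
  ultimately show ?thesis by simp
qed

lemma H1_rep_continuous: 
  assumes "H1_rep F g" shows "continuous_on {0..1} F"
proof -
  have "continuous_on {0..1} (\<lambda>x. F 0 + integral {0..x} g)"
    using assms L2_integrable_on[of g 0 1]
    by (intro continuous_intros indefinite_integral_continuous_1) (auto simp: H1_rep_def)
  then show ?thesis
  proof (rule continuous_on_eq)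
    show "F 0 + integral {0..x} g = F x" if "x \<in> {0..1}" for x
      using H1_rep_increment[OF assms, of 0 x] that by simp
  qed
qed

lemma H1_rep_L2: assumes "H1_rep F g" shows "F \<in> L2" "g \<in> L2"
  using assms L2_continuous[OF H1_rep_continuous[OF assms]] by (auto simp: H1_rep_def)

text \<open>Lets a derivative be exchanged for its own continuous representative, so that the
  representatives of successive derivatives form a chain.\<close>

lemma H1_rep_AE_cong:
  assumes "H1_rep F g" "AE x in I01. g x = h x"
  shows "H1_rep F h"
proof -
  have h: "h \<in> L2" using L2_AE_cong[OF H1_rep_L2(2)[OF assms(1)] assms(2)] .
  have "AE x in lebesgue. x \<in> {0<..<1} \<longrightarrow> g x = h x"
    using assms(2) by (simp add: AE_restrict_space_iff)
  then obtain N where N: "N \<in> null_sets lebesgue" "\<And>x. x \<notin> N \<Longrightarrow> x \<in> {0<..<1} \<longrightarrow> g x = h x"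
    unfolding completion.AE_iff_null_sets by auto
  have "integral {0..x} g = integral {0..x} h" if "x \<in> {0..1}" for x
  proof (rule integral_spike)
    show "negligible (N \<union> {0, 1})" using N(1) by (simp add: negligible_iff_null_sets)
    show "h y = g y" if "y \<in> {0..x} - (N \<union> {0, 1})" for y
      using that \<open>x \<in> {0..1}\<close> N(2)[of y] by auto
  qed
  then show ?thesis using assms(1) h by (simp add: H1_rep_def)
qed

section \<open>Lebesgue differentiation and derivatives of representatives\<close>

lemma one_sided_Lebesgue_differentiation:
  fixes g :: "real \<Rightarrow> real"
  assumes "\<And>a b. g integrable_on {a..b}"
  obtains N where "negligible N"
    "\<And>x e. x \<notin> N \<Longrightarrow> 0 < e \<Longrightarrow> \<exists>d>0. \<forall>h. 0 < h \<and> h < d \<longrightarrow> \<bar>integral {x..x+h} g / h - g x\<bar> < e"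
proof -
  have "g integrable_on cbox a b" for a b
    using assms by (simp add: box_real)
  from integrable_ccontinuous_explicit[OF this] obtain N where N: "negligible N"
    "\<And>x e. \<lbrakk>x \<notin> N; 0 < e\<rbrakk> \<Longrightarrow>
       \<exists>d>0. \<forall>h. 0 < h \<and> h < d \<longrightarrow> norm (integral (cbox x (x + h *\<^sub>R One)) g /\<^sub>R h ^ DIM(real) - g x) < e"
    by metis
  then show thesis by (intro that[of N]) (auto simp: divide_inverse mult.commute)
qed

text \<open>Left averages of \<open>g\<close> at \<open>x\<close> are right averages of the
  reflected function at \<open>- x\<close>; the exceptional set is therefore the union of a null set
  and the mirror image of another.\<close>

lemma two_sided_Lebesgue_differentiation:
  fixes g :: "real \<Rightarrow> real"
  assumes g: "\<And>a b. g integrable_on {a..b}"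
  obtains N where "negligible N"
    "\<And>x e. x \<notin> N \<Longrightarrow> 0 < e \<Longrightarrow> \<exists>d>0. \<forall>h. 0 < h \<and> h < d \<longrightarrow>
       \<bar>integral {x..x+h} g / h - g x\<bar> < e \<and> \<bar>integral {x-h..x} g / h - g x\<bar> < e"
proof -
  obtain N1 where N1: "negligible N1"
    "\<And>x e. x \<notin> N1 \<Longrightarrow> 0 < e \<Longrightarrow> \<exists>d>0. \<forall>h. 0 < h \<and> h < d \<longrightarrow> \<bar>integral {x..x+h} g / h - g x\<bar> < e"
    using one_sided_Lebesgue_differentiation[OF g] by blast
  have "(\<lambda>x. g (- x)) integrable_on {a..b}" for a b
    using Henstock_Kurzweil_Integration.integrable_reflect_real[where f=g and a="-b" and b="-a"] g[of "-b" "-a"] by simp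
  then obtain N2 where N2: "negligible N2"
    "\<And>x e. x \<notin> N2 \<Longrightarrow> 0 < e \<Longrightarrow> \<exists>d>0. \<forall>h. 0 < h \<and> h < d \<longrightarrow> \<bar>integral {x..x+h} (\<lambda>x. g (- x)) / h - g (- x)\<bar> < e"
    using one_sided_Lebesgue_differentiation[of "\<lambda>x. g (- x)"] by metis
  have r: "integral {-x..-x+h} (\<lambda>x. g (- x)) = integral {x-h..x} g" for x h
    using Henstock_Kurzweil_Integration.integral_reflect_real[where f=g and b=x and a="x-h"] by (simp add: add.commute)
  show thesis
  proof (rule that[of "N1 \<union> uminus ` N2"])
    have "negligible (uminus ` N2)"
      by (rule negligible_differentiable_image_negligible[OF _ N2(1)]) (auto intro!: derivative_intros)
    then show "negligible (N1 \<union> uminus ` N2)" using N1(1) by simp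
    fix x e :: real assume x: "x \<notin> N1 \<union> uminus ` N2" and "0 < e"
    then have "x \<notin> N1" "- x \<notin> N2" by (auto simp: image_iff)
    obtain d1 where d1: "d1 > 0" "\<And>h. 0 < h \<and> h < d1 \<Longrightarrow> \<bar>integral {x..x+h} g / h - g x\<bar> < e"
      using N1(2)[OF \<open>x \<notin> N1\<close> \<open>0 < e\<close>] by auto
    obtain d2 where d2: "d2 > 0" "\<And>h. 0 < h \<and> h < d2 \<Longrightarrow> \<bar>integral {x-h..x} g / h - g x\<bar> < e"
      using N2(2)[OF \<open>- x \<notin> N2\<close> \<open>0 < e\<close>] unfolding r by auto
    show "\<exists>d>0. \<forall>h. 0 < h \<and> h < d \<longrightarrow>
       \<bar>integral {x..x+h} g / h - g x\<bar> < e \<and> \<bar>integral {x-h..x} g / h - g x\<bar> < e"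
      using d1 d2 by (intro exI[of _ "min d1 d2"]) auto
  qed
qed

lemma H1_rep_derivative:
  assumes "H1_rep F g"
  obtains N where "negligible N"
    "\<And>x. x \<in> {0..1} - N \<Longrightarrow> (F has_real_derivative g x) (at x within {0..1})"
proof -
  \<comment> \<open>Extension by zero makes the function integrable on every interval, as the
    differentiation theorem demands. At the end points only quotients from inside [0,1]
    matter.\<close>
  define g' where "g' x = (if x \<in> {0..1} then g x else 0)" for x
  have g: "g integrable_on {0..1}" using assms L2_integrable_on[of g 0 1] by (auto simp: H1_rep_def)
  then have U: "g' integrable_on UNIV" unfolding g'_def by (simp only: integrable_restrict_UNIV)
  have "g' integrable_on {a..b}" for a b
    using integrable_on_subcbox[OF U, of a b] by simp
  then obtain N where N: "negligible N"
    "\<And>x e. x \<notin> N \<Longrightarrow> 0 < e \<Longrightarrow> \<exists>d>0. \<forall>h. 0 < h \<and> h < d \<longrightarrow>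
       \<bar>integral {x..x+h} g' / h - g' x\<bar> < e \<and> \<bar>integral {x-h..x} g' / h - g' x\<bar> < e"
    using two_sided_Lebesgue_differentiation by blast
  have incr: "F r - F l = integral {l..r} g'" if "0 \<le> l" "l \<le> r" "r \<le> 1" for l r
    unfolding H1_rep_increment[OF assms that]
    by (rule Henstock_Kurzweil_Integration.integral_cong) (use that in \<open>auto simp: g'_def\<close>)
  show thesis
  proof (rule that[OF N(1)])
    fix x assume x: "x \<in> {0..1} - N"
    have "((\<lambda>y. (F y - F x) / (y - x)) \<longlongrightarrow> g x) (at x within {0..1})"
      unfolding Lim_within
    proof (intro allI impI)
      fix e :: real assume "e > 0"
      obtain d where d: "d > 0" "\<And>h. 0 < h \<and> h < d \<Longrightarrow>
         \<bar>integral {x..x+h} g' / h - g' x\<bar> < e \<and> \<bar>integral {x-h..x} g' / h - g' x\<bar> < e"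
        using N(2)[of x e] x \<open>e > 0\<close> by auto
      have "dist ((F y - F x) / (y - x)) (g x) < e" if y: "y \<in> {0..1}" "0 < dist y x" "dist y x < d" for y
      proof (cases "y > x")
        case True
        have "(F y - F x) / (y - x) = integral {x..x+(y-x)} g' / (y - x)"
          using incr[of x y] x y True by simp
        then show ?thesis using d(2)[of "y - x"] y True x by (simp add: dist_real_def g'_def)
      next
        case False
        then have "y < x" using y by auto
        have "(F y - F x) / (y - x) = (F x - F y) / (x - y)" by (metis minus_diff_eq minus_divide_divide)
        also have "\<dots> = integral {x-(x-y)..x} g' / (x - y)"
          using incr[of y x] x y \<open>y < x\<close> by simp
        finally show ?thesis using d(2)[of "x - y"] y \<open>y < x\<close> x by (simp add: dist_real_def g'_def)
      qed
      then show "\<exists>d>0. \<forall>y\<in>{0..1}. 0 < dist y x \<and> dist y x < d \<longrightarrow> dist ((F y - F x) / (y - x)) (g x) < e"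
        using d(1) by blast
    qed
    then show "(F has_real_derivative g x) (at x within {0..1})"
      by (simp add: has_field_derivative_iff)
  qed
qed

lemma ac_increments_subinterval:
  assumes "ac_increments a b D" "a \<le> a'" "b' \<le> b"
  shows "ac_increments a' b' D"
proof -
  have sf: "short_family a b \<delta> n l r" if "short_family a' b' \<delta> n l r" for \<delta> n l r
    using that assms(2,3) by (force simp: short_family_def)
  show ?thesis unfolding ac_increments_def
  proof (intro allI impI)
    fix e :: real assume "e > 0"
    obtain d where "d > 0" "\<And>n l r. short_family a b d n l r \<Longrightarrow> (\<Sum>k<n. D (l k) (r k)) < e"
      using ac_incrementsE[OF assms(1) \<open>e > 0\<close>] by blast
    then show "\<exists>d>0. \<forall>n l r. short_family a' b' d n l r \<longrightarrow> (\<Sum>k<n. D (l k) (r k)) < e"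
      by (intro exI[of _ d]) (simp add: sf)
  qed
qed

lemma continuous_on_Icc_bounded:
  fixes F :: "real \<Rightarrow> real"
  assumes "continuous_on {a..b} F"
  obtains B where "B \<ge> 0" "\<And>x. x \<in> {a..b} \<Longrightarrow> \<bar>F x\<bar> \<le> B"
proof -
  have "compact (F ` {a..b})" using assms by (intro compact_continuous_image) auto
  then obtain B where "\<forall>x\<in>{a..b}. \<bar>F x\<bar> \<le> B"
    by (auto dest!: compact_imp_bounded simp: bounded_iff)
  then show thesis by (intro that[of "max 0 B"]) (auto simp: le_max_iff_disj)
qed

lemma L2_continuous_mult:
  assumes "u \<in> L2" "continuous_on {0..1} v"
  shows "(\<lambda>x. v x * u x) \<in> L2"
proof -
  obtain B where "\<And>x. x \<in> {0..1} \<Longrightarrow> \<bar>v x\<bar> \<le> B" using continuous_on_Icc_bounded[OF assms(2)] by blast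
  then show ?thesis using L2_D(1)[OF L2_continuous[OF assms(2)]] assms(1)
    by (intro L2_bounded_mult[where B=B]) auto
qed

lemma H1_rep_ac:
  assumes "H1_rep F g" shows "ac_increments 0 1 (\<lambda>l r. \<bar>F r - F l\<bar>)"
proof (rule ac_increments_le[OF ac_increments_integral[OF H1_rep_L2(2)[OF assms]], where K=1])
  show "\<bar>F r - F l\<bar> \<le> 1 * \<bar>integral {l..r} g\<bar>" if "0 \<le> l" "l \<le> r" "r \<le> 1" for l r
    using H1_rep_increment[OF assms that] by simp
qed simp

lemma H1_rep_integral: "g \<in> L2 \<Longrightarrow> H1_rep (\<lambda>x. c + integral {0..x} g) g"
  by (simp add: H1_rep_def)

text \<open>The difference of the two sides is absolutely continuous and has derivative zero almost everywhere.\<close>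

lemma H1_rep_integration_by_parts:
  assumes F: "H1_rep F f" and G: "H1_rep G g" and x: "x \<in> {0..1}"
  shows "integral {0..x} (\<lambda>s. F s * g s + G s * f s) = F x * G x - F 0 * G 0"
proof -
  define k where "k s = F s * g s + G s * f s" for s
  define K where "K s = 0 + integral {0..s} k" for s
  have k: "k \<in> L2" unfolding k_def
    using assms by (intro L2_add L2_continuous_mult H1_rep_continuous[OF F] H1_rep_continuous[OF G]) (auto simp: H1_rep_def)
  have K: "H1_rep K k" unfolding K_def by (rule H1_rep_integral[OF k])
  define H where "H s = F s * G s - K s" for s
  obtain B1 where B1: "B1 \<ge> 0" "\<And>x. x \<in> {0..1} \<Longrightarrow> \<bar>F x\<bar> \<le> B1"
    using continuous_on_Icc_bounded[OF H1_rep_continuous[OF F]] by blast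
  obtain B2 where B2: "B2 \<ge> 0" "\<And>x. x \<in> {0..1} \<Longrightarrow> \<bar>G x\<bar> \<le> B2"
    using continuous_on_Icc_bounded[OF H1_rep_continuous[OF G]] by blast
  \<comment> \<open>One constant above both factors of the product and above the coefficient 1 of
    the increments of \<open>K\<close>.\<close>
  define B where "B = B1 + B2 + 1"
  have ac: "ac_increments 0 1 (\<lambda>l r. \<bar>H r - H l\<bar>)"
  proof (rule ac_increments_le[where K=B])
    show "ac_increments 0 1 (\<lambda>l r. (\<bar>F r - F l\<bar> + \<bar>G r - G l\<bar>) + \<bar>K r - K l\<bar>)"
      by (intro ac_increments_add H1_rep_ac[OF F] H1_rep_ac[OF G] H1_rep_ac[OF K])
    show "B \<ge> 0" using B1 B2 by (simp add: B_def)
    fix l r :: real assume lr: "0 \<le> l" "l \<le> r" "r \<le> 1"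
    have "H r - H l = F r * (G r - G l) + G l * (F r - F l) - (K r - K l)"
      by (simp add: H_def algebra_simps)
    also have "\<bar>\<dots>\<bar> \<le> \<bar>F r\<bar> * \<bar>G r - G l\<bar> + \<bar>G l\<bar> * \<bar>F r - F l\<bar> + \<bar>K r - K l\<bar>"
      unfolding abs_mult[symmetric] by linarith
    also have "\<dots> \<le> B * \<bar>G r - G l\<bar> + B * \<bar>F r - F l\<bar> + B * \<bar>K r - K l\<bar>"
    proof -
      have "\<bar>F r\<bar> \<le> B" "\<bar>G l\<bar> \<le> B" "1 \<le> B"
        using B1(2)[of r] B1(1) B2(2)[of l] B2(1) lr by (auto simp: B_def)
      then have "\<bar>F r\<bar> * \<bar>G r - G l\<bar> \<le> B * \<bar>G r - G l\<bar>" "\<bar>G l\<bar> * \<bar>F r - F l\<bar> \<le> B * \<bar>F r - F l\<bar>"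
        "1 * \<bar>K r - K l\<bar> \<le> B * \<bar>K r - K l\<bar>"
        by - (erule mult_right_mono[OF _ abs_ge_zero])+
      then show ?thesis by linarith
    qed
    finally show "\<bar>H r - H l\<bar> \<le> B * ((\<bar>F r - F l\<bar> + \<bar>G r - G l\<bar>) + \<bar>K r - K l\<bar>)"
      by (simp add: algebra_simps)
  qed
  obtain N1 where N1: "negligible N1" "\<And>x. x \<in> {0..1} - N1 \<Longrightarrow> (F has_real_derivative f x) (at x within {0..1})"
    using H1_rep_derivative[OF F] by blast
  obtain N2 where N2: "negligible N2" "\<And>x. x \<in> {0..1} - N2 \<Longrightarrow> (G has_real_derivative g x) (at x within {0..1})"
    using H1_rep_derivative[OF G] by blast
  obtain N3 where N3: "negligible N3" "\<And>x. x \<in> {0..1} - N3 \<Longrightarrow> (K has_real_derivative k x) (at x within {0..1})"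
    using H1_rep_derivative[OF K] by blast
  define N where "N = N1 \<union> N2 \<union> N3"
  have N: "negligible N" using N1 N2 N3 by (simp add: N_def)
  have der: "(H has_real_derivative 0) (at t within {0..x})" if "t \<in> {0..x} - N" for t
  proof -
    have "(H has_real_derivative (f t * G t + g t * F t - k t)) (at t within {0..1})"
      unfolding H_def using N1(2)[of t] N2(2)[of t] N3(2)[of t] that x
      by (auto intro!: derivative_eq_intros simp: N_def)
    then have "(H has_real_derivative 0) (at t within {0..1})" by (simp add: k_def mult.commute)
    then show ?thesis by (rule DERIV_subset) (use x in auto)
  qed
  have ac': "ac_increments 0 x (\<lambda>l r. \<bar>H r - H l\<bar>)"
    by (rule ac_increments_subinterval[OF ac]) (use x in auto)
  have "H x \<le> H 0"
    by (rule ac_nonincreasing[OF _ ac' N]) (use x der in auto)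
  moreover have "- H x \<le> - H 0"
  proof (rule ac_nonincreasing[where g="\<lambda>x. - H x", OF _ _ N])
    show "ac_increments 0 x (\<lambda>l r. \<bar>- H r - - H l\<bar>)" using ac' by (simp add: abs_minus_commute)
    show "\<exists>D\<le>0. ((\<lambda>x. - H x) has_real_derivative D) (at t within {0..x})" if "t \<in> {0..x} - N" for t
      using DERIV_minus[OF der[OF that]] by auto
  qed (use x in auto)
  ultimately have "H x = H 0" by simp
  then have "integral {0..x} k = F x * G x - F 0 * G 0" by (simp add: H_def K_def)
  then show ?thesis unfolding k_def by simp
qed

corollary H1_rep_integration_by_parts_L2:
  assumes F: "H1_rep F f" and G: "H1_rep G g"
  shows "L2_inner F g + L2_inner G f = F 1 * G 1 - F 0 * G 0"
proof -
  have i: "(\<lambda>s. F s * g s) \<in> L2" "(\<lambda>s. G s * f s) \<in> L2"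
    by (rule L2_continuous_mult[OF H1_rep_L2(2)[OF G] H1_rep_continuous[OF F]],
        rule L2_continuous_mult[OF H1_rep_L2(2)[OF F] H1_rep_continuous[OF G]])
  have "L2_inner F g + L2_inner G f = (\<integral>s. F s * g s + G s * f s \<partial>I01)"
    unfolding L2_inner_def
    using i by (intro Bochner_Integration.integral_add[symmetric] L2_integrable)
  also have "\<dots> = integral {0..1} (\<lambda>s. F s * g s + G s * f s)"
    by (intro L2_integral_I01 L2_add i)
  also have "\<dots> = F 1 * G 1 - F 0 * G 0"
    by (rule H1_rep_integration_by_parts[OF F G]) simp
  finally show ?thesis .
qed

section \<open>Vanishing weak derivatives and existence of continuous representatives\<close>

lemma AE_zero_if_interval_integrals_zero:
  assumes w: "w \<in> L2" and z: "\<And>a b. 0 < a \<Longrightarrow> a < b \<Longrightarrow> b < 1 \<Longrightarrow> integral {a..b} w = 0"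
  shows "AE x in I01. w x = 0"
proof -
  \<comment> \<open>The hypothesis makes the primitive of \<open>w\<close> constant on (0,1), while
    its derivative is \<open>w\<close> almost everywhere.\<close>
  define W where "W x = 0 + integral {0..x} w" for x
  have W: "H1_rep W w" unfolding W_def by (rule H1_rep_integral[OF w])
  obtain N where N: "negligible N" "\<And>x. x \<in> {0..1} - N \<Longrightarrow> (W has_real_derivative w x) (at x within {0..1})"
    using H1_rep_derivative[OF W] by blast
  have "w x = 0" if x: "x \<in> {0<..<1} - N" for x
  proof -
    have "(W has_real_derivative w x) (at x within {0<..<1})"
      by (rule DERIV_subset[OF N(2)]) (use x in auto)
    moreover have "at x within {0<..<1} = at x" by (rule at_within_open) (use x in auto)
    ultimately have 1: "(W has_real_derivative w x) (at x)" by simp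
    have eq: "W y = W x" if "y \<in> {0<..<1}" for y
    proof -
      have "W q - W p = 0" if "0 < p" "p < q" "q < 1" for p q
      proof -
        have "W q - W p = integral {p..q} w" by (rule H1_rep_increment[OF W]) (use that in auto)
        also have "\<dots> = 0" by (rule z[OF that])
        finally show ?thesis .
      qed
      from this[of x y] this[of y x] show ?thesis
        using x that by (cases "x = y") (auto simp: neq_iff)
    qed
    have "((\<lambda>y. W x) has_real_derivative w x) (at x)"
    proof (rule has_field_derivative_transform_within_open[OF 1])
      show "open {0<..<1::real}" "x \<in> {0<..<1}" using x by auto
      show "W y = W x" if "y \<in> {0<..<1}" for y by (rule eq[OF that])
    qed
    then show ?thesis using DERIV_unique[OF _ DERIV_const] by blast
  qed
  then have "AE x in lebesgue. x \<in> {0<..<1} \<longrightarrow> w x = 0"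
    using N(1) by (intro AE_I'[of N]) (auto simp: negligible_iff_null_sets)
  then show ?thesis by (simp add: AE_restrict_space_iff)
qed

text \<open>Ramps of slope \<open>n\<close> inside [a,b], cut off at height 1, tending to the
  indicator of the open interval as \<open>n\<close> grows. Continuity is enough: bumps enter as
  derivatives of test functions, which are only C1.\<close>

definition bump :: "real \<Rightarrow> real \<Rightarrow> nat \<Rightarrow> real \<Rightarrow> real" where
  "bump a b n x = min 1 (real n * max 0 (min (x - a) (b - x)))"

lemma continuous_bump: "continuous_on S (bump a b n)"
  unfolding bump_def by (intro continuous_intros)

lemma bump_bounds: "0 \<le> bump a b n x" "bump a b n x \<le> 1"
  by (auto simp: bump_def)

lemma bump_zero: assumes "x \<notin> {a..b}" shows "bump a b n x = 0"
proof -
  have "min (x - a) (b - x) \<le> 0" using assms by (auto simp: min_le_iff_disj)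
  then show ?thesis unfolding bump_def by (simp only: max_absorb1 mult_zero_right min_absorb2 zero_le_one)
qed

lemma bump_tendsto: "(\<lambda>n. bump a b n x) \<longlonglongrightarrow> indicator {a<..<b} x"
proof (cases "x \<in> {a<..<b}")
  case True
  define m where "m = min (x - a) (b - x)"
  have "m > 0" using True by (auto simp: m_def)
  then obtain n0 :: nat where n0: "1 / m < real n0" using reals_Archimedean2 by blast
  have "bump a b n x = 1" if "n \<ge> n0" for n
  proof -
    have "1 \<le> real n0 * m" using n0 \<open>m > 0\<close> by (simp add: field_simps)
    also have "\<dots> \<le> real n * m" using that \<open>m > 0\<close> by (intro mult_right_mono) auto
    finally show ?thesis using \<open>m > 0\<close> by (simp add: bump_def m_def[symmetric])
  qed
  then have "eventually (\<lambda>n. bump a b n x = indicator {a<..<b} x) sequentially"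
    using True by (intro eventually_sequentiallyI[of n0]) auto
  then show ?thesis by (rule tendsto_eventually)
next
  case False
  then have "min (x - a) (b - x) \<le> 0" by (auto simp: min_le_iff_disj)
  then have "bump a b n x = 0" for n unfolding bump_def by (simp only: max_absorb1 mult_zero_right min_absorb2 zero_le_one)
  then have "bump a b n x = indicator {a<..<b} x" for n using False by simp
  then show ?thesis by simp
qed

lemma integral_supported:
  fixes z :: "real \<Rightarrow> real"
  assumes "\<And>x. x \<notin> S \<Longrightarrow> z x = 0"
  shows "integral S z = integral UNIV z"
proof -
  have "(\<lambda>x. if x \<in> S then z x else 0) = z" using assms by auto
  then show ?thesis using integral_restrict_UNIV[of S z] by simp
qed

text \<open>The vanishing integral makes the antiderivative return to 0 to the right of the support.
  The lower limit -1 lies strictly to the left of the support, so at every \<open>x\<close> with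
  \<open>a \<le> x\<close> the integral has a two-sided derivative, while for \<open>x < a\<close>
  it is locally 0.\<close>

lemma test_function_antiderivative:
  assumes c: "continuous_on UNIV \<zeta>" and ab: "0 < a" "b < 1" and z: "\<And>x. x \<notin> {a..b} \<Longrightarrow> \<zeta> x = 0"
    and i: "integral {0..1} \<zeta> = 0"
  shows "test_function (\<lambda>x. integral {-1..x} \<zeta>) \<zeta>"
  unfolding test_function_def
proof (intro conjI allI c)
  have left: "integral {-1..x} \<zeta> = 0" if "x < a" for x
  proof -
    have "integral {-1..x} \<zeta> = integral {-1..x} (\<lambda>x. 0)"
      by (rule Henstock_Kurzweil_Integration.integral_cong) (use that z in auto)
    then show ?thesis by simp
  qed
  have right: "integral {-1..x} \<zeta> = 0" if "x > b" for x
  proof -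
    have "integral {-1..x} \<zeta> = integral UNIV \<zeta>" using ab that by (intro integral_supported z) auto
    also have "\<dots> = integral {0..1} \<zeta>" using ab by (intro integral_supported[symmetric] z) auto
    finally show ?thesis using i by simp
  qed
  show "\<exists>a b. 0 < a \<and> b < 1 \<and> (\<forall>x. x \<notin> {a..b} \<longrightarrow> integral {-1..x} \<zeta> = 0)"
    using ab left right by (intro exI[of _ a] exI[of _ b]) (auto simp: not_le)
  show "((\<lambda>x. integral {-1..x} \<zeta>) has_real_derivative \<zeta> x) (at x)" for x
  proof (cases "x < a")
    case True
    have "((\<lambda>x. 0) has_real_derivative \<zeta> x) (at x)" using z[of x] True by simp
    then show ?thesis
      by (rule has_field_derivative_transform_within_open[of _ _ _ "{..<a}"]) (use left True in auto)
  next
    case False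
    have "((\<lambda>x. integral {-1..x} \<zeta>) has_real_derivative \<zeta> x) (at x within {-1..x+1})"
      by (rule integral_has_real_derivative) (use False ab continuous_on_subset[OF c] in auto)
    then have "((\<lambda>x. integral {-1..x} \<zeta>) has_real_derivative \<zeta> x) (at x within {-1<..<x+1})"
      by (rule DERIV_subset) auto
    moreover have "at x within {-1<..<x+1} = at x"
      by (rule at_within_open) (use False ab in auto)
    ultimately show ?thesis by simp
  qed
qed

text \<open>A bump becomes the derivative of a test function after subtracting the multiple of a fixed bump \<open>\<eta>\<close>
  that makes its integral vanish; so \<open>w - c\<close> is orthogonal to every bump.\<close>

lemma du_Bois_Reymond:
  assumes w: "w \<in> L2" and t: "\<And>\<psi> \<psi>'. test_function \<psi> \<psi>' \<Longrightarrow> (\<integral>x. w x * \<psi>' x \<partial>I01) = 0"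
  shows "\<exists>c. AE x in I01. w x = c"
proof -
  \<comment> \<open>Slope 8 reaches height 1 at distance 1/8 from the ends, so this bump equals 1 on
    [3/8, 5/8] and its integral is at least 1/4.\<close>
  define \<eta> where "\<eta> = bump (1/4) (3/4) 8"
  define I0 where "I0 = integral {0..1} \<eta>"
  have \<eta>i: "\<eta> integrable_on {a..b}" for a b unfolding \<eta>_def by (intro integrable_continuous_real continuous_bump)
  have "I0 > 0"
  proof -
    have "\<eta> x = 1" if "x \<in> {3/8..5/8}" for x
    proof -
      define m where "m = min (x - 1/4) (3/4 - x)"
      have "1/8 \<le> m" using that by (auto simp: m_def)
      then have "1 \<le> 8 * max 0 m" by (simp add: max_def)
      then show ?thesis by (simp add: \<eta>_def bump_def m_def[symmetric])
    qed
    then have "integral {3/8..5/8::real} (\<lambda>x. 1::real) \<le> integral {3/8..5/8} \<eta>"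
      by (intro integral_le \<eta>i) auto
    also have "\<dots> \<le> I0" unfolding I0_def
      by (intro integral_subset_le \<eta>i) (auto simp: \<eta>_def bump_bounds)
    finally show ?thesis by simp
  qed
  \<comment> \<open>The only possible constant: \<open>w - c\<close> has to be orthogonal to
    \<eta>.\<close>
  define c where "c = (\<integral>x. w x * \<eta> x \<partial>I01) / I0"
  have bL: "bump a b n \<in> L2" for a b n by (intro L2_continuous continuous_bump)
  have key: "(\<integral>x. (w x - c) * bump a b n x \<partial>I01) = 0" if ab: "0 < a" "a < b" "b < 1" for a b n
  proof -
    define I where "I = integral {0..1} (bump a b n)"
    define \<zeta> where "\<zeta> x = bump a b n x - I / I0 * \<eta> x" for x
    have "integral {0..1} \<zeta> = I - I / I0 * I0"
    proof -
      have "bump a b n integrable_on {0..1}" by (intro integrable_continuous_real continuous_bump)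
      moreover have "(\<lambda>x. I / I0 * \<eta> x) integrable_on {0..1}" 
        unfolding \<eta>_def by (intro integrable_continuous_real continuous_intros continuous_bump)
      ultimately show ?thesis unfolding \<zeta>_def
        by (simp add: Henstock_Kurzweil_Integration.integral_diff I_def I0_def)
    qed
    then have "integral {0..1} \<zeta> = 0" using \<open>I0 > 0\<close> by simp
    \<comment> \<open>The enlarged interval contains the supports of both bumps and is still compact
      in (0,1).\<close>
    moreover have "\<zeta> x = 0" if "x \<notin> {min a (1/4)..max b (3/4)}" for x
    proof -
      have "x \<notin> {a..b}" "x \<notin> {1/4..3/4}" using that by auto
      then show ?thesis by (simp add: \<zeta>_def \<eta>_def bump_zero del: atLeastAtMost_iff)
    qed
    ultimately have "test_function (\<lambda>x. integral {-1..x} \<zeta>) \<zeta>"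
      by (intro test_function_antiderivative[of _ "min a (1/4)" "max b (3/4)"])
         (use ab \<open>I0 > 0\<close> in \<open>auto simp: \<zeta>_def \<eta>_def intro!: continuous_intros continuous_bump\<close>)
    from t[OF this] have 0: "(\<integral>x. w x * \<zeta> x \<partial>I01) = 0" .
    have "w x * \<zeta> x = w x * bump a b n x - I / I0 * (w x * \<eta> x)" for x
      by (simp add: \<zeta>_def algebra_simps)
    then have "(\<integral>x. w x * \<zeta> x \<partial>I01) = (\<integral>x. w x * bump a b n x \<partial>I01) - I / I0 * (\<integral>x. w x * \<eta> x \<partial>I01)"
      using L2_mult_integrable[OF w bL] by (simp add: \<eta>_def)
    then have 1: "(\<integral>x. w x * bump a b n x \<partial>I01) = c * I" using 0 by (simp add: c_def)
    have "(\<integral>x. (w x - c) * bump a b n x \<partial>I01) = (\<integral>x. w x * bump a b n x \<partial>I01) - c * (\<integral>x. bump a b n x \<partial>I01)"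
      unfolding left_diff_distrib using L2_mult_integrable[OF w bL] L2_integrable[OF bL] by simp
    also have "\<dots> = 0" using 1 L2_integral_I01[OF bL, of a b n] by (simp add: I_def)
    finally show ?thesis .
  qed
  have wc: "(\<lambda>x. w x - c) \<in> L2" by (intro L2_diff w L2_const)
  have "AE x in I01. w x - c = 0"
  proof (rule AE_zero_if_interval_integrals_zero[OF wc])
    fix a b :: real assume ab: "0 < a" "a < b" "b < 1"
    \<comment> \<open>Dominated convergence passes from bumps to indicators, which turns
      orthogonality to bumps into vanishing integrals over intervals.\<close>
    have "(\<lambda>n. \<integral>x. (w x - c) * bump a b n x \<partial>I01) \<longlonglongrightarrow> (\<integral>x. (w x - c) * indicator {a<..<b} x \<partial>I01)"
    proof (rule integral_dominated_convergence[where w="\<lambda>x. \<bar>w x - c\<bar>"])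
      have "{a<..<b} \<in> sets I01" using ab by (auto simp: sets_restrict_space_iff)
      then show "(\<lambda>x. (w x - c) * indicator {a<..<b} x) \<in> borel_measurable I01"
        using L2_D(1)[OF wc] by (intro borel_measurable_times borel_measurable_indicator)
      show "(\<lambda>x. (w x - c) * bump a b n x) \<in> borel_measurable I01" for n
        using L2_D(1)[OF wc] L2_D(1)[OF bL] by (intro borel_measurable_times)
      show "integrable I01 (\<lambda>x. \<bar>w x - c\<bar>)" using L2_integrable[OF wc] by simp
      show "AE x in I01. (\<lambda>n. (w x - c) * bump a b n x) \<longlonglongrightarrow> (w x - c) * indicator {a<..<b} x"
        by (intro AE_I2 tendsto_intros bump_tendsto)
      show "AE x in I01. norm ((w x - c) * bump a b n x) \<le> \<bar>w x - c\<bar>" for n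
        by (intro AE_I2) (auto simp: abs_mult bump_bounds abs_of_nonneg[OF bump_bounds(1)] intro!: mult_right_le_one_le)
    qed
    then have "(\<integral>x. (w x - c) * indicator {a<..<b} x \<partial>I01) = 0"
      using key[OF ab] by (simp add: LIMSEQ_const_iff)
    moreover have "(\<integral>x. (w x - c) * indicator {a<..<b} x \<partial>I01) = integral {a..b} (\<lambda>x. w x - c)"
    proof -
      have "(\<lambda>x. indicator {a<..<b} x * (w x - c)) \<in> L2"
      proof (rule L2_bounded_mult[OF wc, where B=1])
        have "{a<..<b} \<in> sets I01" using ab by (auto simp: sets_restrict_space_iff)
        then show "indicator {a<..<b} \<in> borel_measurable I01" by (rule borel_measurable_indicator)
      qed (auto simp: indicator_def)
      then have "(\<integral>x. indicator {a<..<b} x * (w x - c) \<partial>I01) = integral {0..1} (\<lambda>x. indicator {a<..<b} x * (w x - c))"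
        by (rule L2_integral_I01)
      also have "\<dots> = integral UNIV (\<lambda>x. indicator {a<..<b} x * (w x - c))"
        using ab by (intro integral_supported) (auto simp: indicator_def)
      also have "\<dots> = integral {a<..<b} (\<lambda>x. indicator {a<..<b} x * (w x - c))"
        by (intro integral_supported[symmetric]) (auto simp: indicator_def)
      also have "\<dots> = integral {a<..<b} (\<lambda>x. w x - c)"
        by (rule Henstock_Kurzweil_Integration.integral_cong) auto
      finally show ?thesis by (simp add: integral_open_interval_real mult.commute)
    qed
    ultimately show "integral {a..b} (\<lambda>x. w x - c) = 0" by simp
  qed
  then show ?thesis by (intro exI[of _ c]) auto
qed

lemma H1_rep_C1:
  assumes "\<And>x. x \<in> {0..1} \<Longrightarrow> (F has_real_derivative f x) (at x within {0..1})" "continuous_on {0..1} f"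
  shows "H1_rep F f"
  unfolding H1_rep_def
proof (intro conjI ballI)
  show "f \<in> L2" by (rule L2_continuous[OF assms(2)])
  fix x :: real assume x: "x \<in> {0..1}"
  have "(f has_integral (F x - F 0)) {0..x}"
    by (rule fundamental_theorem_of_calculus)
       (use x in \<open>auto simp: has_real_derivative_iff_has_vector_derivative[symmetric] intro!: DERIV_subset[OF assms(1)]\<close>)
  then show "F x - F 0 = integral {0..x} f" by (simp add: integral_unique)
qed

text \<open>Integration by parts shows that \<open>u\<close> minus the primitive of \<open>g\<close>
  is orthogonal to every derivative of a test function; by \<open>du_Bois_Reymond\<close> it is a
  constant, which is then added to the primitive.\<close>

theorem weak_deriv_H1_rep:
  assumes "has_weak_deriv u g"
  obtains F where "H1_rep F g" "AE x in I01. u x = F x"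
proof -
  have u: "u \<in> L2" and g: "g \<in> L2" and wk: "\<And>\<psi> \<psi>'. test_function \<psi> \<psi>' \<Longrightarrow>
      (\<integral>x. u x * \<psi>' x \<partial>I01) = - (\<integral>x. g x * \<psi> x \<partial>I01)"
    using assms by (auto simp: has_weak_deriv_def)
  define F where "F x = 0 + integral {0..x} g" for x
  have F: "H1_rep F g" unfolding F_def by (rule H1_rep_integral[OF g])
  have "\<exists>c. AE x in I01. u x - F x = c"
  proof (rule du_Bois_Reymond)
    show "(\<lambda>x. u x - F x) \<in> L2" using u H1_rep_L2[OF F] by (intro L2_diff)
    fix \<psi> \<psi>' assume ts: "test_function \<psi> \<psi>'"
    have \<psi>: "H1_rep \<psi> \<psi>'"
      by (rule H1_rep_C1) (use ts in \<open>auto simp: test_function_def intro: has_field_derivative_at_within continuous_on_subset\<close>)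
    have "\<psi> 0 = 0" "\<psi> 1 = 0" using ts by (auto simp: test_function_def)
    then have "L2_inner F \<psi>' + L2_inner \<psi> g = 0"
      using H1_rep_integration_by_parts_L2[OF F \<psi>] by simp
    moreover have "L2_inner u \<psi>' = - L2_inner \<psi> g"
      using wk[OF ts] by (simp add: L2_inner_def mult.commute)
    ultimately have "L2_inner (\<lambda>x. u x - F x) \<psi>' = 0"
      using u H1_rep_L2[OF F] H1_rep_L2[OF \<psi>] by (simp add: L2_inner_diff_left)
    then show "(\<integral>x. (u x - F x) * \<psi>' x \<partial>I01) = 0" by (simp add: L2_inner_def)
  qed
  then obtain c where c: "AE x in I01. u x - F x = c" by blast
  show thesis
  proof (rule that)
    show "H1_rep (\<lambda>x. c + F x) g" using F by (simp add: H1_rep_def)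
    show "AE x in I01. u x = c + F x" using c by eventually_elim auto
  qed
qed

text \<open>The points of (0,1) where two continuous functions differ form an open set; being null,
  it is empty. The end points follow by closure.\<close>

lemma continuous_AE_eq:
  fixes F G :: "real \<Rightarrow> real"
  assumes "continuous_on {0..1} F" "continuous_on {0..1} G" "AE x in I01. F x = G x" "x \<in> {0..1}"
  shows "F x = G x"
proof -
  define D where "D x = F x - G x" for x
  have D: "continuous_on {0..1} D" unfolding D_def by (rule continuous_on_diff[OF assms(1,2)])
  define S where "S = {0<..<1} \<inter> D -` (- {0})"
  have "open S" unfolding S_def
    by (rule continuous_open_preimage) (use D in \<open>auto intro: continuous_on_subset\<close>)
  have "AE x in lebesgue. x \<in> {0<..<1} \<longrightarrow> D x = 0"
    using assms(3) by (simp add: AE_restrict_space_iff D_def)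
  then obtain N where N: "N \<in> null_sets lebesgue" "\<And>x. x \<notin> N \<Longrightarrow> x \<in> {0<..<1} \<longrightarrow> D x = 0"
    unfolding completion.AE_iff_null_sets by auto
  have "S \<subseteq> N" using N(2) by (auto simp: S_def)
  then have "negligible S" using N(1) negligible_subset by (auto simp: negligible_iff_null_sets[symmetric])
  then have "S = {}" using open_not_negligible[OF \<open>open S\<close>] by blast
  then have "D y = 0" if "y \<in> {0<..<1}" for y using that by (auto simp: S_def)
  moreover have cl: "closure {0<..<1::real} = {0..1}" by simp
  ultimately have "D x = 0"
    using continuous_constant_on_closure[of "{0<..<1}" D 0 x] D assms(4) by auto
  then show ?thesis by (simp add: D_def)
qed

lemma H1_rep_unique:
  assumes F: "H1_rep F f" and G: "H1_rep G g" and eq: "AE x in I01. F x = G x"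
  shows "\<And>x. x \<in> {0..1} \<Longrightarrow> F x = G x" "AE x in I01. f x = g x"
proof -
  show *: "F x = G x" if "x \<in> {0..1}" for x
    using continuous_AE_eq[OF H1_rep_continuous[OF F] H1_rep_continuous[OF G] eq that] .
  have fg: "f \<in> L2" "g \<in> L2" using F G H1_rep_L2 by auto
  have "AE x in I01. f x - g x = 0"
  proof (rule AE_zero_if_interval_integrals_zero[OF L2_diff[OF fg]])
    fix a b :: real assume ab: "0 < a" "a < b" "b < 1"
    have "integral {a..b} (\<lambda>x. f x - g x) = integral {a..b} f - integral {a..b} g"
      using ab by (intro Henstock_Kurzweil_Integration.integral_diff L2_integrable_on fg) auto
    then show "integral {a..b} (\<lambda>x. f x - g x) = 0"
      using H1_rep_increment[OF F, of a b] H1_rep_increment[OF G, of a b] *[of a] *[of b] ab by simp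
  qed
  then show "AE x in I01. f x = g x" by eventually_elim auto
qed

section \<open>The spaces \<open>H\<^sub>l\<^sup>n\<close>\<close>

lemma test_function_L2:
  assumes "test_function \<psi> \<psi>'" shows "\<psi> \<in> L2" "\<psi>' \<in> L2"
proof -
  have "continuous_on UNIV \<psi>"
    using assms by (auto simp: test_function_def intro!: DERIV_continuous_on)
  then show "\<psi> \<in> L2" by (intro L2_continuous) (auto intro: continuous_on_subset)
  show "\<psi>' \<in> L2"
    using assms by (intro L2_continuous) (auto simp: test_function_def intro: continuous_on_subset)
qed

lemma has_weak_deriv_L2: assumes "has_weak_deriv u g" shows "u \<in> L2" "g \<in> L2"
  using assms by (auto simp: has_weak_deriv_def)

lemma has_weak_deriv_iff:
  "has_weak_deriv u g \<longleftrightarrow> u \<in> L2 \<and> g \<in> L2 \<and>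
     (\<forall>\<psi> \<psi>'. test_function \<psi> \<psi>' \<longrightarrow> L2_inner u \<psi>' = - L2_inner g \<psi>)"
  by (simp add: has_weak_deriv_def L2_inner_def)

lemma has_weak_deriv_lincomb:
  assumes "has_weak_deriv u g" "has_weak_deriv v h"
  shows "has_weak_deriv (\<lambda>x. a * u x + b * v x) (\<lambda>x. a * g x + b * h x)"
  unfolding has_weak_deriv_iff
proof (intro conjI allI impI)
  note L = has_weak_deriv_L2[OF assms(1)] has_weak_deriv_L2[OF assms(2)]
  show "(\<lambda>x. a * u x + b * v x) \<in> L2" "(\<lambda>x. a * g x + b * h x) \<in> L2"
    by (intro L2_add L2_cmult L)+
  fix \<psi> \<psi>' assume t: "test_function \<psi> \<psi>'"
  have "L2_inner u \<psi>' = - L2_inner g \<psi>" "L2_inner v \<psi>' = - L2_inner h \<psi>"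
    using assms t by (auto simp: has_weak_deriv_iff)
  then show "L2_inner (\<lambda>x. a * u x + b * v x) \<psi>' = - L2_inner (\<lambda>x. a * g x + b * h x) \<psi>"
    using L test_function_L2[OF t] by (simp add: L2_inner_add_left L2_cmult L2_inner_cmult_left)
qed

lemma has_weak_deriv_AE_cong:
  assumes "has_weak_deriv u g" "AE x in I01. u x = u' x" "AE x in I01. g x = g' x"
  shows "has_weak_deriv u' g'"
  unfolding has_weak_deriv_iff
proof (intro conjI allI impI)
  note L = has_weak_deriv_L2[OF assms(1)]
  show "u' \<in> L2" "g' \<in> L2" using L2_AE_cong[OF L(1) assms(2)] L2_AE_cong[OF L(2) assms(3)] by auto
  fix \<psi> \<psi>' assume t: "test_function \<psi> \<psi>'"
  have "L2_inner u \<psi>' = L2_inner u' \<psi>'" "L2_inner g \<psi> = L2_inner g' \<psi>"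
    by (rule L2_inner_AE_cong; (rule assms L test_function_L2[OF t] AE_I2 refl)+)+
  then show "L2_inner u' \<psi>' = - L2_inner g' \<psi>"
    using assms(1) t by (simp add: has_weak_deriv_iff)
qed

lemma has_weak_deriv_unique:
  assumes "has_weak_deriv u g" "has_weak_deriv u h"
  shows "AE x in I01. g x = h x"
proof -
  obtain F where F: "H1_rep F g" "AE x in I01. u x = F x" using weak_deriv_H1_rep[OF assms(1)] .
  obtain G where G: "H1_rep G h" "AE x in I01. u x = G x" using weak_deriv_H1_rep[OF assms(2)] .
  have "AE x in I01. F x = G x" using F(2) G(2) by eventually_elim simp
  then show ?thesis by (rule H1_rep_unique(2)[OF F(1) G(1)])
qed

lemma has_weak_deriv_wderiv:
  assumes "has_weak_deriv u g"
  shows "has_weak_deriv u (wderiv u)" "AE x in I01. wderiv u x = g x"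
proof -
  show *: "has_weak_deriv u (wderiv u)" unfolding wderiv_def by (rule someI[of "has_weak_deriv u", OF assms])
  show "AE x in I01. wderiv u x = g x" by (rule has_weak_deriv_unique[OF * assms])
qed

lemma sobolev_AE_cong:
  assumes "u \<in> sobolev n" "AE x in I01. u x = v x" shows "v \<in> sobolev n"
proof (cases n)
  case 0
  then show ?thesis using assms L2_AE_cong by auto
next
  case (Suc m)
  then obtain g where "g \<in> sobolev m" "has_weak_deriv u g" using assms by auto
  moreover have "has_weak_deriv v g"
    by (rule has_weak_deriv_AE_cong[OF calculation(2) assms(2)]) simp
  ultimately show ?thesis using Suc by auto
qed

text \<open>Uniqueness almost everywhere moves membership from the existential witness to the chosen
  \<open>wderiv\<close>; from here on iterated \<open>wderiv\<close> can stand for the weak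
  derivatives.\<close>

lemma sobolev_Suc:
  "u \<in> sobolev (Suc n) \<longleftrightarrow> has_weak_deriv u (wderiv u) \<and> wderiv u \<in> sobolev n"
proof
  assume "u \<in> sobolev (Suc n)"
  then obtain g where g: "g \<in> sobolev n" "has_weak_deriv u g" by auto
  have "AE x in I01. g x = wderiv u x" using has_weak_deriv_wderiv(2)[OF g(2)] by eventually_elim simp
  then show "has_weak_deriv u (wderiv u) \<and> wderiv u \<in> sobolev n"
    using has_weak_deriv_wderiv(1)[OF g(2)] sobolev_AE_cong[OF g(1)] by blast
qed auto

text \<open>The definite description in \<open>point_value\<close> is meaningful because continuous
  functions equal almost everywhere agree at every point, including the end points.\<close>

lemma point_value_eqI:
  assumes "continuous_on {0..1} v" "AE x in I01. u x = v x" "p \<in> {0..1}"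
  shows "point_value u p = v p"
  unfolding point_value_def
proof (rule the_equality)
  show "\<exists>v'. continuous_on {0..1} v' \<and> (AE x in I01. u x = v' x) \<and> v' p = v p" using assms by blast
  fix c assume "\<exists>v'. continuous_on {0..1} v' \<and> (AE x in I01. u x = v' x) \<and> v' p = c"
  then obtain v' where v': "continuous_on {0..1} v'" "AE x in I01. u x = v' x" "v' p = c" by blast
  have "AE x in I01. v' x = v x" using v'(2) assms(2) by eventually_elim simp
  from continuous_AE_eq[OF v'(1) assms(1) this assms(3)] v'(3) show "c = v p" by simp
qed

text \<open>The derivative of \<open>Y0\<close> is taken to be the continuous \<open>Y1\<close>
  itself rather than \<open>wderiv u\<close>; this is what allows repeated classical integration by
  parts. Applied again to the second derivative it serves the fourth order space.\<close>

lemma sobolev_2_rep: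
  assumes "has_weak_deriv u (wderiv u)" "has_weak_deriv (wderiv u) ((wderiv ^^ 2) u)"
  obtains Y0 Y1 where "H1_rep Y0 Y1" "H1_rep Y1 ((wderiv ^^ 2) u)"
    "AE x in I01. u x = Y0 x" "AE x in I01. wderiv u x = Y1 x"
    "\<forall>p\<in>{0..1}. point_value u p = Y0 p"
    "\<forall>p\<in>{0..1}. point_value (wderiv u) p = Y1 p"
proof -
  obtain Y0 where Y0: "H1_rep Y0 (wderiv u)" "AE x in I01. u x = Y0 x" using weak_deriv_H1_rep[OF assms(1)] .
  obtain Y1 where Y1: "H1_rep Y1 ((wderiv ^^ 2) u)" "AE x in I01. wderiv u x = Y1 x"
    using weak_deriv_H1_rep[OF assms(2)] .
  show thesis
    by (rule that[OF H1_rep_AE_cong[OF Y0(1) Y1(2)] Y1(1) Y0(2) Y1(2)])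
       (auto intro!: point_value_eqI H1_rep_continuous[OF Y0(1)] H1_rep_continuous[OF Y1(1)] Y0(2) Y1(2))
qed

lemma funpow_wderiv: "(wderiv ^^ 2) u = wderiv (wderiv u)"
  "(wderiv ^^ 3) u = wderiv ((wderiv ^^ 2) u)" "(wderiv ^^ 4) u = (wderiv ^^ 2) ((wderiv ^^ 2) u)"
  by (simp_all add: numeral_eq_Suc)

lemma Hl_2_iff:
  "u \<in> Hl 2 \<longleftrightarrow> has_weak_deriv u (wderiv u) \<and> has_weak_deriv (wderiv u) ((wderiv ^^ 2) u) \<and>
     point_value u 0 = 0 \<and> point_value (wderiv u) 0 = 0"
proof -
  have "sobolev 2 = sobolev (Suc (Suc 0))" by (simp add: numeral_2_eq_2)
  then have "u \<in> sobolev 2 \<longleftrightarrow> has_weak_deriv u (wderiv u) \<and>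
      has_weak_deriv (wderiv u) (wderiv (wderiv u)) \<and> wderiv (wderiv u) \<in> L2"
    by (simp only: sobolev_Suc) simp
  then show ?thesis unfolding Hl_def funpow_wderiv using has_weak_deriv_L2 by auto
qed

lemma Hl_2_rep:
  assumes "u \<in> Hl 2"
  obtains Y0 Y1 where "H1_rep Y0 Y1" "H1_rep Y1 ((wderiv ^^ 2) u)"
    "AE x in I01. u x = Y0 x" "AE x in I01. wderiv u x = Y1 x"
    "\<forall>p\<in>{0..1}. point_value u p = Y0 p"
    "\<forall>p\<in>{0..1}. point_value (wderiv u) p = Y1 p" "Y0 0 = 0" "Y1 0 = 0"
proof -
  obtain Y0 Y1 where Y: "H1_rep Y0 Y1" "H1_rep Y1 ((wderiv ^^ 2) u)"
    "AE x in I01. u x = Y0 x" "AE x in I01. wderiv u x = Y1 x"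
    "\<forall>p\<in>{0..1}. point_value u p = Y0 p"
    "\<forall>p\<in>{0..1}. point_value (wderiv u) p = Y1 p"
    using sobolev_2_rep[of u] assms unfolding Hl_2_iff by blast
  show thesis
    by (rule that[OF Y]) (use assms bspec[OF Y(5), of 0] bspec[OF Y(6), of 0] in \<open>auto simp: Hl_2_iff\<close>)
qed

lemma Hl_2_L2:
  assumes "u \<in> Hl 2" shows "u \<in> L2" "wderiv u \<in> L2" "(wderiv ^^ 2) u \<in> L2"
  using assms has_weak_deriv_L2 by (auto simp: Hl_2_iff)

lemma Hl_4_rep:
  assumes "u \<in> Hl 4"
  obtains Y0 Y1 Y2 Y3 where "H1_rep Y0 Y1" "H1_rep Y1 Y2" "H1_rep Y2 Y3" "H1_rep Y3 ((wderiv ^^ 4) u)"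
    "AE x in I01. u x = Y0 x" "AE x in I01. wderiv u x = Y1 x" "AE x in I01. (wderiv ^^ 2) u x = Y2 x"
    "point_value ((wderiv ^^ 2) u) 1 = Y2 1" "point_value ((wderiv ^^ 3) u) 1 = Y3 1"
    "Y0 0 = 0" "Y1 0 = 0" "u \<in> Hl 2"
proof -
  have "sobolev 4 = sobolev (Suc (Suc (Suc (Suc 0))))" by (simp add: numeral_eq_Suc)
  then have "u \<in> sobolev 4 \<longleftrightarrow> has_weak_deriv u (wderiv u) \<and>
      has_weak_deriv (wderiv u) (wderiv (wderiv u)) \<and>
      has_weak_deriv (wderiv (wderiv u)) (wderiv (wderiv (wderiv u))) \<and>
      has_weak_deriv (wderiv (wderiv (wderiv u))) (wderiv (wderiv (wderiv (wderiv u)))) \<and>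
      wderiv (wderiv (wderiv (wderiv u))) \<in> L2"
    by (simp only: sobolev_Suc) simp
  then have w: "has_weak_deriv u (wderiv u)" "has_weak_deriv (wderiv u) ((wderiv ^^ 2) u)"
    "has_weak_deriv ((wderiv ^^ 2) u) (wderiv ((wderiv ^^ 2) u))"
    "has_weak_deriv (wderiv ((wderiv ^^ 2) u)) ((wderiv ^^ 2) ((wderiv ^^ 2) u))"
    using assms by (auto simp: Hl_def funpow_wderiv)
  have u2: "u \<in> Hl 2" using assms w by (simp add: Hl_2_iff) (simp add: Hl_def)
  obtain Y0 Y1 where Y: "H1_rep Y0 Y1" "H1_rep Y1 ((wderiv ^^ 2) u)"
    "AE x in I01. u x = Y0 x" "AE x in I01. wderiv u x = Y1 x"
    "\<forall>p\<in>{0..1}. point_value u p = Y0 p"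
    "\<forall>p\<in>{0..1}. point_value (wderiv u) p = Y1 p" "Y0 0 = 0" "Y1 0 = 0"
    using Hl_2_rep[OF u2] .
  obtain Y2 Y3 where Z: "H1_rep Y2 Y3" "H1_rep Y3 ((wderiv ^^ 2) ((wderiv ^^ 2) u))"
    "AE x in I01. (wderiv ^^ 2) u x = Y2 x" "AE x in I01. wderiv ((wderiv ^^ 2) u) x = Y3 x"
    "\<forall>p\<in>{0..1}. point_value ((wderiv ^^ 2) u) p = Y2 p"
    "\<forall>p\<in>{0..1}. point_value (wderiv ((wderiv ^^ 2) u)) p = Y3 p"
    using sobolev_2_rep[OF w(3,4)] .
  show thesis
    by (rule that[OF Y(1) H1_rep_AE_cong[OF Y(2) Z(3)] Z(1) _ Y(3,4) Z(3) _ _ Y(7,8) u2])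
       (use Z in \<open>auto simp: funpow_wderiv\<close>)
qed

text \<open>As \<open>wderiv\<close> is a choice, its linearity has to be recovered almost
  everywhere from uniqueness, one order at a time. The conditions at 0 are read off the combined
  continuous representatives.\<close>

lemma Hl_2_lincomb:
  fixes a b :: real
  assumes u: "u \<in> Hl 2" and v: "v \<in> Hl 2"
  defines "w \<equiv> \<lambda>x. a * u x + b * v x"
  shows "w \<in> Hl 2"
    and "AE x in I01. wderiv w x = a * wderiv u x + b * wderiv v x"
    and "AE x in I01. (wderiv ^^ 2) w x = a * (wderiv ^^ 2) u x + b * (wderiv ^^ 2) v x"
proof -
  have w1: "has_weak_deriv w (\<lambda>x. a * wderiv u x + b * wderiv v x)"
    unfolding w_def using u v by (intro has_weak_deriv_lincomb) (auto simp: Hl_2_iff)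
  note ww = has_weak_deriv_wderiv[OF w1]
  show 1: "AE x in I01. wderiv w x = a * wderiv u x + b * wderiv v x" by (rule ww(2))
  have w2: "has_weak_deriv (wderiv w) (\<lambda>x. a * (wderiv ^^ 2) u x + b * (wderiv ^^ 2) v x)"
  proof (rule has_weak_deriv_AE_cong)
    show "has_weak_deriv (\<lambda>x. a * wderiv u x + b * wderiv v x) (\<lambda>x. a * (wderiv ^^ 2) u x + b * (wderiv ^^ 2) v x)"
      using u v by (intro has_weak_deriv_lincomb) (auto simp: Hl_2_iff)
    show "AE x in I01. a * wderiv u x + b * wderiv v x = wderiv w x" using 1 by eventually_elim simp
  qed simp
  note www = has_weak_deriv_wderiv[OF w2]
  show "AE x in I01. (wderiv ^^ 2) w x = a * (wderiv ^^ 2) u x + b * (wderiv ^^ 2) v x"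
    using www(2) by (simp add: funpow_wderiv)
  obtain Y0 Y1 where Y: "H1_rep Y0 Y1" "H1_rep Y1 ((wderiv ^^ 2) u)"
    "AE x in I01. u x = Y0 x" "AE x in I01. wderiv u x = Y1 x"
    "\<forall>p\<in>{0..1}. point_value u p = Y0 p"
    "\<forall>p\<in>{0..1}. point_value (wderiv u) p = Y1 p" "Y0 0 = 0" "Y1 0 = 0"
    using Hl_2_rep[OF u] .
  obtain Z0 Z1 where Z: "H1_rep Z0 Z1" "H1_rep Z1 ((wderiv ^^ 2) v)"
    "AE x in I01. v x = Z0 x" "AE x in I01. wderiv v x = Z1 x"
    "\<forall>p\<in>{0..1}. point_value v p = Z0 p"
    "\<forall>p\<in>{0..1}. point_value (wderiv v) p = Z1 p" "Z0 0 = 0" "Z1 0 = 0"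
    using Hl_2_rep[OF v] .
  have "point_value w 0 = a * Y0 0 + b * Z0 0"
  proof (rule point_value_eqI)
    show "continuous_on {0..1} (\<lambda>x. a * Y0 x + b * Z0 x)"
      by (intro continuous_on_add continuous_on_mult continuous_on_const H1_rep_continuous[OF Y(1)] H1_rep_continuous[OF Z(1)])
    show "AE x in I01. w x = a * Y0 x + b * Z0 x" using Y(3) Z(3) by eventually_elim (simp add: w_def)
  qed simp
  moreover have "point_value (wderiv w) 0 = a * Y1 0 + b * Z1 0"
  proof (rule point_value_eqI)
    show "continuous_on {0..1} (\<lambda>x. a * Y1 x + b * Z1 x)"
      by (intro continuous_on_add continuous_on_mult continuous_on_const H1_rep_continuous[OF Y(2)] H1_rep_continuous[OF Z(2)])
    show "AE x in I01. wderiv w x = a * Y1 x + b * Z1 x" using 1 Y(4) Z(4) by eventually_elim simp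
  qed simp
  ultimately show "w \<in> Hl 2"
    using ww(1) www(1) Y(7,8) Z(7,8) by (simp add: Hl_2_iff funpow_wderiv)
qed

section \<open>Bounds for functions that vanish at the left end\<close>

lemma H1_rep_sq_bound:
  assumes "H1_rep F f" "F 0 = 0" "x \<in> {0..1}"
  shows "(F x)\<^sup>2 \<le> L2_inner f f"
proof -
  have f: "f \<in> L2" using H1_rep_L2 assms by blast
  \<comment> \<open>\<open>F x\<close> is the inner product of \<open>f\<close> with this indicator,
    whose squared norm is at most 1; Cauchy-Schwarz does the rest.\<close>
  define h where "h = (indicator {0..x} :: real \<Rightarrow> real)"
  have hm: "h \<in> borel_measurable I01"
    unfolding h_def by (intro measurable_restrict_space1 borel_measurable_indicator) simp
  have h: "h \<in> L2" by (rule L2_bounded[OF hm, of 1]) (auto simp: h_def indicator_def)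
  have "F x = integral {0..x} f" using H1_rep_increment[OF assms(1), of 0 x] assms by simp
  also have "\<dots> = integral {0..x} (\<lambda>s. h s * f s)"
    by (rule Henstock_Kurzweil_Integration.integral_cong) (simp add: h_def)
  also have "\<dots> = integral UNIV (\<lambda>s. h s * f s)"
    by (intro integral_supported) (auto simp: h_def)
  also have "\<dots> = integral {0..1} (\<lambda>s. h s * f s)"
    using assms(3) by (intro integral_supported[symmetric]) (auto simp: h_def indicator_def)
  also have "\<dots> = L2_inner h f"
    unfolding L2_inner_def
    by (intro L2_integral_I01[symmetric] L2_bounded_mult[OF f hm, of 1]) (auto simp: h_def indicator_def)
  finally have "(F x)\<^sup>2 \<le> L2_inner h h * L2_inner f f" using L2_Cauchy_Schwarz_sq[OF h f] by simp
  also have "\<dots> \<le> 1 * L2_inner f f"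
  proof (rule mult_right_mono)
    have "L2_inner h h \<le> integral {0..1::real} (\<lambda>x. 1::real)"
      by (rule L2_inner_le_integral[OF h]) (auto simp: h_def indicator_def intro!: AE_I2)
    then show "L2_inner h h \<le> 1" by simp
  qed (rule L2_inner_nonneg)
  finally show ?thesis by simp
qed

text \<open>Taylor's formula with integral remainder represents \<open>Y0 x\<close> as the inner
  product of \<open>p\<close> with the kernel max(0, x - s), whose squared norm is x^3 / 3.\<close>

lemma Hl_2_rep_cubic_bound:
  assumes Y0: "H1_rep Y0 Y1" and Y1: "H1_rep Y1 p" and z: "Y0 0 = 0" "Y1 0 = 0" and x: "x \<in> {0..1}"
  shows "(Y0 x)\<^sup>2 \<le> x ^ 3 / 3 * L2_inner p p"
proof -
  have p: "p \<in> L2" using H1_rep_L2 Y1 by blast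
  define h where "h s = max 0 (x - s)" for s
  have hc: "continuous_on {0..1} h" unfolding h_def by (intro continuous_intros)
  have h: "h \<in> L2" by (rule L2_continuous[OF hc])
  \<comment> \<open>Of the primitives of 1, this one vanishes at the upper limit; the boundary term
    at 0 vanishes because \<open>Y1 0 = 0\<close>.\<close>
  have F: "H1_rep (\<lambda>s. s - x) (\<lambda>s. 1)"
    by (rule H1_rep_C1) (auto intro!: derivative_eq_intros)
  have pi: "(\<lambda>s. (s - x) * p s) integrable_on {0..x}"
    by (intro L2_integrable_on L2_continuous_mult p continuous_intros) (use x in auto)
  have "integral {0..x} (\<lambda>s. (s - x) * p s + Y1 s * 1) = (x - x) * Y1 x - (0 - x) * Y1 0"
    by (rule H1_rep_integration_by_parts[OF F Y1 x])
  moreover have "integral {0..x} (\<lambda>s. (s - x) * p s + Y1 s * 1) = integral {0..x} (\<lambda>s. (s - x) * p s) + integral {0..x} Y1"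
    using H1_rep_L2(1)[OF Y1] x
    by (subst Henstock_Kurzweil_Integration.integral_add[OF pi]) (auto intro!: L2_integrable_on)
  moreover have "Y0 x = integral {0..x} Y1" using H1_rep_increment[OF Y0, of 0 x] x z by simp
  ultimately have "Y0 x = - integral {0..x} (\<lambda>s. (s - x) * p s)" using z by simp
  also have "\<dots> = integral {0..x} (\<lambda>s. h s * p s)"
    unfolding integral_neg[symmetric]
    by (rule Henstock_Kurzweil_Integration.integral_cong) (auto simp: h_def algebra_simps)
  also have "\<dots> = integral {0..1} (\<lambda>s. h s * p s)"
  proof -
    have "integral {0..x} (\<lambda>s. h s * p s) + integral {x..1} (\<lambda>s. h s * p s) = integral {0..1} (\<lambda>s. h s * p s)"
      using x by (intro Henstock_Kurzweil_Integration.integral_combine L2_integrable_on L2_continuous_mult p hc) auto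
    moreover have "integral {x..1} (\<lambda>s. h s * p s) = integral {x..1} (\<lambda>s. 0)"
      by (rule Henstock_Kurzweil_Integration.integral_cong) (auto simp: h_def)
    ultimately show ?thesis by simp
  qed
  also have "\<dots> = L2_inner h p"
    unfolding L2_inner_def by (intro L2_integral_I01[symmetric] L2_continuous_mult p hc)
  finally have "(Y0 x)\<^sup>2 \<le> L2_inner h h * L2_inner p p" using L2_Cauchy_Schwarz_sq[OF h p] by simp
  also have "L2_inner h h = integral {0..1} (\<lambda>s. h s * h s)"
    unfolding L2_inner_def by (intro L2_integral_I01 L2_continuous_mult h hc)
  also have "\<dots> = integral {0..x} (\<lambda>s. h s * h s)"
  proof -
    have "integral {0..x} (\<lambda>s. h s * h s) + integral {x..1} (\<lambda>s. h s * h s) = integral {0..1} (\<lambda>s. h s * h s)"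
      using x by (intro Henstock_Kurzweil_Integration.integral_combine L2_integrable_on L2_continuous_mult h hc) auto
    moreover have "integral {x..1} (\<lambda>s. h s * h s) = integral {x..1} (\<lambda>s. 0)"
      by (rule Henstock_Kurzweil_Integration.integral_cong) (auto simp: h_def)
    ultimately show ?thesis by simp
  qed
  also have "\<dots> = integral {0..x} (\<lambda>s. (x - s)\<^sup>2)"
    by (rule Henstock_Kurzweil_Integration.integral_cong) (auto simp: h_def power2_eq_square)
  also have "\<dots> = x ^ 3 / 3"
  proof (rule integral_unique)
    have "((\<lambda>s. (x - s)\<^sup>2) has_integral (- ((x - x) ^ 3 / 3) - (- ((x - 0) ^ 3 / 3)))) {0..x}"
      by (rule fundamental_theorem_of_calculus)
         (use x in \<open>auto intro!: derivative_eq_intros simp: has_real_derivative_iff_has_vector_derivative[symmetric]\<close>)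
    then show "((\<lambda>s. (x - s)\<^sup>2) has_integral x ^ 3 / 3) {0..x}" by simp
  qed
  finally show ?thesis .
qed

text \<open>The cubic bound gives 1/3 at the tip and, integrated over (0,1), the constant
  1/12.\<close>

lemma Hl_2_bounds:
  assumes "y \<in> Hl 2"
  shows "L2_inner y y \<le> L2_inner ((wderiv ^^ 2) y) ((wderiv ^^ 2) y) / 12"
    and "L2_inner (wderiv y) (wderiv y) \<le> L2_inner ((wderiv ^^ 2) y) ((wderiv ^^ 2) y)"
    and "(point_value y 1)\<^sup>2 \<le> L2_inner ((wderiv ^^ 2) y) ((wderiv ^^ 2) y) / 3"
    and "(point_value (wderiv y) 1)\<^sup>2 \<le> L2_inner ((wderiv ^^ 2) y) ((wderiv ^^ 2) y)"
proof -
  define P where "P = L2_inner ((wderiv ^^ 2) y) ((wderiv ^^ 2) y)"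
  obtain Y0 Y1 where Y: "H1_rep Y0 Y1" "H1_rep Y1 ((wderiv ^^ 2) y)"
    "AE x in I01. y x = Y0 x" "AE x in I01. wderiv y x = Y1 x"
    "\<forall>p\<in>{0..1}. point_value y p = Y0 p"
    "\<forall>p\<in>{0..1}. point_value (wderiv y) p = Y1 p" "Y0 0 = 0" "Y1 0 = 0"
    using Hl_2_rep[OF assms] .
  note b0 = Hl_2_rep_cubic_bound[OF Y(1,2,7,8), folded P_def]
  note b1 = H1_rep_sq_bound[OF Y(2,8), folded P_def]
  show "(point_value y 1)\<^sup>2 \<le> P / 3" using b0[of 1] bspec[OF Y(5), of 1] by simp
  show "(point_value (wderiv y) 1)\<^sup>2 \<le> P" using b1[of 1] bspec[OF Y(6), of 1] by simp
  have "L2_inner y y \<le> integral {0..1} (\<lambda>x. x ^ 3 / 3 * P)"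
  proof (rule L2_inner_le_integral[OF Hl_2_L2(1)[OF assms]])
    show "AE x in I01. (y x)\<^sup>2 \<le> x ^ 3 / 3 * P"
      using Y(3) AE_space by eventually_elim (use b0 in auto)
  qed (auto intro!: continuous_intros)
  also have "\<dots> = P / 12"
  proof (rule integral_unique)
    have "((\<lambda>x. x ^ 3 / 3 * P) has_integral (1 ^ 4 / 12 * P - 0 ^ 4 / 12 * P)) {0..1::real}"
      by (rule fundamental_theorem_of_calculus)
         (auto intro!: derivative_eq_intros simp: has_real_derivative_iff_has_vector_derivative[symmetric])
    then show "((\<lambda>x. x ^ 3 / 3 * P) has_integral P / 12) {0..1::real}" by simp
  qed
  finally show "L2_inner y y \<le> P / 12" .
  have "L2_inner (wderiv y) (wderiv y) \<le> integral {0..1} (\<lambda>x::real. P)"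
  proof (rule L2_inner_le_integral[OF Hl_2_L2(2)[OF assms]])
    show "AE x in I01. (wderiv y x)\<^sup>2 \<le> P"
      using Y(4) AE_space by eventually_elim (use b1 in auto)
  qed auto
  then show "L2_inner (wderiv y) (wderiv y) \<le> P" by simp
qed

section \<open>Multiplier identities and boundary dissipation\<close>

lemma H1_rep_mult:
  assumes F: "H1_rep F f" and G: "H1_rep G g"
  shows "H1_rep (\<lambda>x. F x * G x) (\<lambda>x. F x * g x + G x * f x)"
  unfolding H1_rep_def
proof (intro conjI ballI)
  show "(\<lambda>x. F x * g x + G x * f x) \<in> L2"
    by (intro L2_add L2_continuous_mult H1_rep_continuous[OF F] H1_rep_continuous[OF G] H1_rep_L2(2)[OF F] H1_rep_L2(2)[OF G])
  show "F x * G x - F 0 * G 0 = integral {0..x} (\<lambda>x. F x * g x + G x * f x)" if "x \<in> {0..1}" for x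
    using H1_rep_integration_by_parts[OF F G that] by simp
qed

lemma H1_rep_ident: "H1_rep (\<lambda>x. x) (\<lambda>x. 1)"
  by (rule H1_rep_C1) (auto intro!: derivative_eq_intros)

lemma L2_ident_mult: "u \<in> L2 \<Longrightarrow> (\<lambda>x. x * u x) \<in> L2"
  by (rule L2_continuous_mult) (auto intro: continuous_intros)

lemma L2_inner_ident_mult: "L2_inner (\<lambda>x. x * u x) v = L2_inner u (\<lambda>x. x * v x)"
  by (simp add: L2_inner_def ac_simps)

text \<open>Integrating x F F' by parts reproduces the same integral with the opposite sign, plus
  the squared norm of \<open>F\<close>. The weight x removes the boundary term at 0.\<close>

lemma L2_inner_multiplier:
  assumes F: "H1_rep F f"
  shows "L2_inner (\<lambda>x. x * f x) F = ((F 1)\<^sup>2 - L2_inner F F) / 2"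
proof -
  have xF: "H1_rep (\<lambda>x. x * F x) (\<lambda>x. x * f x + F x * 1)" by (rule H1_rep_mult[OF H1_rep_ident F])
  have "L2_inner F (\<lambda>x. x * f x + F x * 1) + L2_inner (\<lambda>x. x * F x) f = F 1 * (1 * F 1) - F 0 * (0 * F 0)"
    by (rule H1_rep_integration_by_parts_L2[OF F xF])
  moreover have "L2_inner F (\<lambda>x. x * f x + F x * 1) = L2_inner F (\<lambda>x. x * f x) + L2_inner F F"
    using H1_rep_L2[OF F] by (simp add: L2_inner_add_right L2_ident_mult)
  moreover have "L2_inner (\<lambda>x. x * F x) f = L2_inner F (\<lambda>x. x * f x)" by (rule L2_inner_ident_mult)
  ultimately show ?thesis by (simp add: L2_inner_commute[of F "\<lambda>x. x * f x"] power2_eq_square)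
qed

text \<open>Two integrations by parts move the fourth derivative onto z. At 0 the terms vanish since
  z and its derivative do; at 1 the two feedback conditions have just the signs that make both
  contributions nonpositive when \<open>f\<close> is monotone with \<open>f 0 = 0\<close>.\<close>

lemma dom_A_dissipation:
  assumes "(y, z) \<in> dom_A f"
  shows "L2_inner ((wderiv ^^ 2) y) ((wderiv ^^ 2) z) - L2_inner ((wderiv ^^ 4) y) z =
    - (f (point_value z 1) * point_value z 1 + f (point_value (wderiv z) 1) * point_value (wderiv z) 1)"
proof -
  have y: "y \<in> Hl 4" and z: "z \<in> Hl 2" using assms by (auto simp: dom_A_def)
  obtain Y0 Y1 Y2 Y3 where Y: "H1_rep Y0 Y1" "H1_rep Y1 Y2" "H1_rep Y2 Y3" "H1_rep Y3 ((wderiv ^^ 4) y)"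
    "AE x in I01. y x = Y0 x" "AE x in I01. wderiv y x = Y1 x" "AE x in I01. (wderiv ^^ 2) y x = Y2 x"
    "point_value ((wderiv ^^ 2) y) 1 = Y2 1" "point_value ((wderiv ^^ 3) y) 1 = Y3 1"
    "Y0 0 = 0" "Y1 0 = 0" "y \<in> Hl 2"
    using Hl_4_rep[OF y] .
  obtain Z0 Z1 where Z: "H1_rep Z0 Z1" "H1_rep Z1 ((wderiv ^^ 2) z)"
    "AE x in I01. z x = Z0 x" "AE x in I01. wderiv z x = Z1 x"
    "\<forall>p\<in>{0..1}. point_value z p = Z0 p"
    "\<forall>p\<in>{0..1}. point_value (wderiv z) p = Z1 p" "Z0 0 = 0" "Z1 0 = 0"
    using Hl_2_rep[OF z] .
  have 1: "L2_inner Z0 ((wderiv ^^ 4) y) + L2_inner Y3 Z1 = Z0 1 * Y3 1"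
    using H1_rep_integration_by_parts_L2[OF Z(1) Y(4)] Z by simp
  have 2: "L2_inner Z1 Y3 + L2_inner Y2 ((wderiv ^^ 2) z) = Z1 1 * Y2 1"
    using H1_rep_integration_by_parts_L2[OF Z(2) Y(3)] Z by simp
  have 3: "L2_inner ((wderiv ^^ 2) y) ((wderiv ^^ 2) z) = L2_inner Y2 ((wderiv ^^ 2) z)"
    by (rule L2_inner_AE_cong[OF Y(7) _ Hl_2_L2(3)[OF Y(12)] Hl_2_L2(3)[OF z]]) simp
  have 4: "L2_inner ((wderiv ^^ 4) y) z = L2_inner ((wderiv ^^ 4) y) Z0"
    by (rule L2_inner_AE_cong[OF _ Z(3) H1_rep_L2(2)[OF Y(4)] Hl_2_L2(1)[OF z]]) simp
  have "Y3 1 = f (Z0 1)" "Y2 1 = - f (Z1 1)"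
    using assms Y(8,9) bspec[OF Z(5), of 1] bspec[OF Z(6), of 1] by (auto simp: dom_A_def)
  then show ?thesis using 1 2 3 4 bspec[OF Z(5), of 1] bspec[OF Z(6), of 1]
    by (simp add: L2_inner_commute[of Z0] L2_inner_commute[of Z1] algebra_simps)
qed

text \<open>The factor 3/2 is 1 + 1/2: the derivative of the weight x produces one full squared norm
  of the second derivative, and \<open>L2_inner_multiplier\<close> applied to that derivative
  another half.\<close>

lemma Hl_4_multiplier:
  assumes "y \<in> Hl 4"
  shows "L2_inner (\<lambda>x. x * wderiv y x) ((wderiv ^^ 4) y) =
     point_value (wderiv y) 1 * (point_value ((wderiv ^^ 3) y) 1 - point_value ((wderiv ^^ 2) y) 1)
     - (point_value ((wderiv ^^ 2) y) 1)\<^sup>2 / 2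
     + 3 / 2 * L2_inner ((wderiv ^^ 2) y) ((wderiv ^^ 2) y)"
proof -
  obtain Y0 Y1 Y2 Y3 where Y: "H1_rep Y0 Y1" "H1_rep Y1 Y2" "H1_rep Y2 Y3" "H1_rep Y3 ((wderiv ^^ 4) y)"
    "AE x in I01. y x = Y0 x" "AE x in I01. wderiv y x = Y1 x" "AE x in I01. (wderiv ^^ 2) y x = Y2 x"
    "point_value ((wderiv ^^ 2) y) 1 = Y2 1" "point_value ((wderiv ^^ 3) y) 1 = Y3 1"
    "Y0 0 = 0" "Y1 0 = 0" "y \<in> Hl 2"
    using Hl_4_rep[OF assms] .
  have pv: "point_value (wderiv y) 1 = Y1 1"
    by (rule point_value_eqI[OF H1_rep_continuous[OF Y(2)] Y(6)]) simp
  have xY1: "H1_rep (\<lambda>x. x * Y1 x) (\<lambda>x. x * Y2 x + Y1 x * 1)" by (rule H1_rep_mult[OF H1_rep_ident Y(2)])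
  have 1: "L2_inner (\<lambda>x. x * Y1 x) ((wderiv ^^ 4) y) + L2_inner Y3 (\<lambda>x. x * Y2 x + Y1 x * 1) = Y1 1 * Y3 1"
    using H1_rep_integration_by_parts_L2[OF xY1 Y(4)] by simp
  have 2: "L2_inner Y3 (\<lambda>x. x * Y2 x + Y1 x * 1) = L2_inner (\<lambda>x. x * Y3 x) Y2 + L2_inner Y3 Y1"
    using H1_rep_L2[OF Y(2)] H1_rep_L2[OF Y(3)]
    by (simp add: L2_inner_add_right L2_ident_mult L2_inner_ident_mult)
  have 3: "L2_inner (\<lambda>x. x * Y3 x) Y2 = ((Y2 1)\<^sup>2 - L2_inner Y2 Y2) / 2"
    by (rule L2_inner_multiplier[OF Y(3)])
  have 4: "L2_inner Y1 Y3 + L2_inner Y2 Y2 = Y1 1 * Y2 1"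
    using H1_rep_integration_by_parts_L2[OF Y(2,3)] Y by simp
  have 5: "L2_inner ((wderiv ^^ 2) y) ((wderiv ^^ 2) y) = L2_inner Y2 Y2"
    by (rule L2_inner_AE_cong[OF Y(7) Y(7) Hl_2_L2(3)[OF Y(12)] Hl_2_L2(3)[OF Y(12)]])
  have 6: "L2_inner (\<lambda>x. x * wderiv y x) ((wderiv ^^ 4) y) = L2_inner (\<lambda>x. x * Y1 x) ((wderiv ^^ 4) y)"
  proof (rule L2_inner_AE_cong)
    show "AE x in I01. x * wderiv y x = x * Y1 x" using Y(6) by eventually_elim simp
  qed (use H1_rep_L2(2)[OF Y(4)] L2_ident_mult[OF Hl_2_L2(2)[OF Y(12)]] in auto)
  show ?thesis unfolding 5 6 pv Y(8,9) using 1 2 3 4 L2_inner_commute[of Y1 Y3]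
    by (simp add: algebra_simps add_divide_distrib diff_divide_distrib)
qed

lemma Hl_2_multiplier:
  assumes "y \<in> Hl 2"
  shows "L2_inner (\<lambda>x. x * wderiv y x) y = ((point_value y 1)\<^sup>2 - L2_inner y y) / 2"
proof -
  obtain Y0 Y1 where Y': "H1_rep Y0 Y1" "H1_rep Y1 ((wderiv ^^ 2) y)"
    "AE x in I01. y x = Y0 x" "AE x in I01. wderiv y x = Y1 x"
    "\<forall>p\<in>{0..1}. point_value y p = Y0 p"
    "\<forall>p\<in>{0..1}. point_value (wderiv y) p = Y1 p" "Y0 0 = 0" "Y1 0 = 0"
    using Hl_2_rep[OF assms] .
  have Y: "H1_rep Y0 Y1" "AE x in I01. y x = Y0 x" "AE x in I01. wderiv y x = Y1 x" "point_value y 1 = Y0 1"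
    using bspec[OF Y'(5), of 1] by (simp_all add: Y'(1,3,4))
  have "L2_inner (\<lambda>x. x * wderiv y x) y = L2_inner (\<lambda>x. x * Y1 x) Y0"
  proof (rule L2_inner_AE_cong[OF _ Y(2)])
    show "AE x in I01. x * wderiv y x = x * Y1 x" using Y(3) by eventually_elim simp
  qed (use L2_ident_mult[OF Hl_2_L2(2)[OF assms]] Hl_2_L2[OF assms] in auto)
  moreover have "L2_inner y y = L2_inner Y0 Y0"
    by (rule L2_inner_AE_cong[OF Y(2) Y(2) Hl_2_L2(1)[OF assms] Hl_2_L2(1)[OF assms]])
  ultimately show ?thesis using L2_inner_multiplier[OF Y(1)] Y(4) by simp
qed

section \<open>Differentiation along a curve of states\<close>

abbreviation ac_on :: "real \<Rightarrow> real \<Rightarrow> (real \<Rightarrow> real) \<Rightarrow> bool" where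
  "ac_on a b g \<equiv> ac_increments a b (\<lambda>l r. \<bar>g r - g l\<bar>)"

lemma ac_on_continuous:
  assumes "ac_on a b g" shows "continuous_on {a..b} g"
  unfolding continuous_on_iff
proof (intro ballI allI impI)
  fix x e :: real assume x: "x \<in> {a..b}" and "e > 0"
  obtain d where d: "d > 0" "\<And>n l r. short_family a b d n l r \<Longrightarrow> (\<Sum>k<n. \<bar>g (r k) - g (l k)\<bar>) < e"
    using ac_incrementsE[OF assms \<open>e > 0\<close>] by blast
  have lr: "\<bar>g r - g l\<bar> < e" if "a \<le> l" "l \<le> r" "r \<le> b" "r - l < d" for l r
    using d(2)[of 1 "\<lambda>_. l" "\<lambda>_. r"] that by (simp add: short_family_def disjoint_family_on_def)
  have "dist (g y) (g x) < e" if "y \<in> {a..b}" "dist y x < d" for y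
    using lr[of x y] lr[of y x] x that by (cases "x \<le> y") (auto simp: dist_real_def abs_minus_commute)
  then show "\<exists>d>0. \<forall>y\<in>{a..b}. dist y x < d \<longrightarrow> dist (g y) (g x) < e" using d(1) by blast
qed

lemma ac_on_add:
  assumes "ac_on a b f" "ac_on a b g" shows "ac_on a b (\<lambda>t. f t + g t)"
  by (rule ac_increments_le[OF ac_increments_add[OF assms], of 1]) auto

lemma ac_on_mult:
  assumes f: "ac_on a b f" and g: "ac_on a b g" shows "ac_on a b (\<lambda>t. f t * g t)"
proof -
  obtain B1 where B1: "B1 \<ge> 0" "\<And>x. x \<in> {a..b} \<Longrightarrow> \<bar>f x\<bar> \<le> B1"
    using continuous_on_Icc_bounded[OF ac_on_continuous[OF f]] by blast
  obtain B2 where B2: "B2 \<ge> 0" "\<And>x. x \<in> {a..b} \<Longrightarrow> \<bar>g x\<bar> \<le> B2"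
    using continuous_on_Icc_bounded[OF ac_on_continuous[OF g]] by blast
  show ?thesis
  proof (rule ac_increments_le[OF ac_increments_add[OF f g], of "B1 + B2"])
    show "0 \<le> B1 + B2" using B1 B2 by simp
    fix l r assume lr: "a \<le> l" "l \<le> r" "r \<le> b"
    have "f r * g r - f l * g l = f r * (g r - g l) + g l * (f r - f l)" by (simp add: algebra_simps)
    also have "\<bar>\<dots>\<bar> \<le> \<bar>f r\<bar> * \<bar>g r - g l\<bar> + \<bar>g l\<bar> * \<bar>f r - f l\<bar>"
      unfolding abs_mult[symmetric] by linarith
    also have "\<dots> \<le> (B1 + B2) * \<bar>g r - g l\<bar> + (B1 + B2) * \<bar>f r - f l\<bar>"
      using B1(2)[of r] B2(2)[of l] B1(1) B2(1) lr by (intro add_mono mult_right_mono) auto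
    finally show "\<bar>f r * g r - f l * g l\<bar> \<le> (B1 + B2) * (\<bar>f r - f l\<bar> + \<bar>g r - g l\<bar>)"
      by (simp add: algebra_simps)
  qed
qed

lemma ac_on_Lipschitz:
  assumes "K \<ge> 0" "\<And>l r. a \<le> l \<Longrightarrow> l \<le> r \<Longrightarrow> r \<le> b \<Longrightarrow> \<bar>g r - g l\<bar> \<le> K * (r - l)"
  shows "ac_on a b g"
  by (rule ac_increments_le[OF ac_increments_length assms])

lemma ac_on_const: "ac_on a b (\<lambda>t. c)"
  by (rule ac_on_Lipschitz[of 0]) auto

lemma ac_on_diff_const: "ac_on a b f \<Longrightarrow> ac_on a b (\<lambda>t. f t - c)"
  using ac_on_add[OF _ ac_on_const, of a b f "- c"] by simp

lemma ac_on_exp: "ac_on a b (\<lambda>t. exp (\<beta> * t))"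
proof -
  have "continuous_on {a..b} (\<lambda>t. \<beta> * exp (\<beta> * t))" by (intro continuous_intros)
  then obtain B where B: "B \<ge> 0" "\<And>x. x \<in> {a..b} \<Longrightarrow> \<bar>\<beta> * exp (\<beta> * x)\<bar> \<le> B"
    using continuous_on_Icc_bounded by blast
  show ?thesis
  proof (rule ac_on_Lipschitz[OF B(1)])
    fix l r assume lr: "a \<le> l" "l \<le> r" "r \<le> b"
    have "norm (exp (\<beta> * r) - exp (\<beta> * l)) \<le> B * norm (r - l)"
      by (rule field_differentiable_bound[of "{a..b}" _ "\<lambda>t. \<beta> * exp (\<beta> * t)"])
         (use lr B in \<open>auto intro!: derivative_eq_intros\<close>)
    then show "\<bar>exp (\<beta> * r) - exp (\<beta> * l)\<bar> \<le> B * (r - l)" using lr by simp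
  qed
qed

text \<open>Besides the bilinear splitting of the increment, the two norms have to be bounded on the
  time interval; they are because, by the reverse triangle inequality, they are absolutely
  continuous too.\<close>

lemma L2_inner_ac_on:
  assumes L: "\<And>t. t \<in> {a..b} \<Longrightarrow> A t \<in> L2" "\<And>t. t \<in> {a..b} \<Longrightarrow> B t \<in> L2"
    and A: "ac_increments a b (\<lambda>l r. L2_norm (\<lambda>x. A r x - A l x))"
    and B: "ac_increments a b (\<lambda>l r. L2_norm (\<lambda>x. B r x - B l x))"
  shows "ac_on a b (\<lambda>t. L2_inner (A t) (B t))"
proof -
  have nA: "ac_on a b (\<lambda>t. L2_norm (A t))"
    by (rule ac_increments_le[OF A, of 1]) (use L2_norm_diff_le L in auto)
  obtain B1 where B1: "B1 \<ge> 0" "\<And>x. x \<in> {a..b} \<Longrightarrow> \<bar>L2_norm (A x)\<bar> \<le> B1"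
    using continuous_on_Icc_bounded[OF ac_on_continuous[OF nA]] by blast
  have nB: "ac_on a b (\<lambda>t. L2_norm (B t))"
    by (rule ac_increments_le[OF B, of 1]) (use L2_norm_diff_le L in auto)
  obtain B2 where B2: "B2 \<ge> 0" "\<And>x. x \<in> {a..b} \<Longrightarrow> \<bar>L2_norm (B x)\<bar> \<le> B2"
    using continuous_on_Icc_bounded[OF ac_on_continuous[OF nB]] by blast
  show ?thesis
  proof (rule ac_increments_le[OF ac_increments_add[OF A B], of "B1 + B2"])
    show "0 \<le> B1 + B2" using B1 B2 by simp
    fix l r assume lr: "a \<le> l" "l \<le> r" "r \<le> b"
    then have m: "A l \<in> L2" "A r \<in> L2" "B l \<in> L2" "B r \<in> L2" using L by auto
    have eq: "L2_inner (A r) (B r) - L2_inner (A l) (B l) =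
        L2_inner (\<lambda>x. A r x - A l x) (B r) + L2_inner (A l) (\<lambda>x. B r x - B l x)"
      using m by (simp add: L2_inner_diff_left L2_inner_diff_right)
    have "\<bar>L2_inner (A r) (B r) - L2_inner (A l) (B l)\<bar>
        \<le> L2_norm (\<lambda>x. A r x - A l x) * L2_norm (B r) + L2_norm (A l) * L2_norm (\<lambda>x. B r x - B l x)"
      unfolding eq using L2_Cauchy_Schwarz[OF L2_diff[OF m(2,1)] m(4)] L2_Cauchy_Schwarz[OF m(1) L2_diff[OF m(4,3)]] by linarith
    also have "\<dots> \<le> L2_norm (\<lambda>x. A r x - A l x) * (B1 + B2) + (B1 + B2) * L2_norm (\<lambda>x. B r x - B l x)"
    proof -
      have "L2_norm (B r) \<le> B1 + B2" "L2_norm (A l) \<le> B1 + B2"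
        using B1(2)[of l] B2(2)[of r] B1(1) B2(1) lr by auto
      then show ?thesis
        by (intro add_mono mult_left_mono mult_right_mono L2_norm_nonneg)
    qed
    finally show "\<bar>L2_inner (A r) (B r) - L2_inner (A l) (B l)\<bar>
        \<le> (B1 + B2) * (L2_norm (\<lambda>x. A r x - A l x) + L2_norm (\<lambda>x. B r x - B l x))"
      by (simp add: algebra_simps)
  qed
qed

text \<open>Product rule for curves whose difference quotients converge in the L2 norm. The values
  need to lie in \<open>L2\<close> only near \<open>t\<close>, which suits solutions defined for
  nonnegative times.\<close>

lemma L2_inner_derivative:
  assumes ev: "eventually (\<lambda>h. a (t + h) \<in> L2 \<and> b (t + h) \<in> L2) (at 0)"
    and L: "a t \<in> L2" "b t \<in> L2" "a' \<in> L2" "b' \<in> L2"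
    and a: "((\<lambda>h. L2_norm (\<lambda>x. (a (t + h) x - a t x) / h - a' x)) \<longlongrightarrow> 0) (at (0::real))"
    and b: "((\<lambda>h. L2_norm (\<lambda>x. (b (t + h) x - b t x) / h - b' x)) \<longlongrightarrow> 0) (at (0::real))"
  shows "((\<lambda>s. L2_inner (a s) (b s)) has_real_derivative L2_inner a' (b t) + L2_inner (a t) b') (at t)"
proof -
  define na where "na h = L2_norm (\<lambda>x. (a (t + h) x - a t x) / h - a' x)" for h
  define nb where "nb h = L2_norm (\<lambda>x. (b (t + h) x - b t x) / h - b' x)" for h
  \<comment> \<open>Majorant of the error: the first two terms come from the errors of the
    quotients, the last from the product of both increments divided by \<open>h\<close>.\<close>
  define R where "R h = na h * L2_norm (b t) + L2_norm (a t) * nb h + \<bar>h\<bar> * ((L2_norm a' + na h) * (L2_norm b' + nb h))" for h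
  define D where "D = L2_inner a' (b t) + L2_inner (a t) b'"
  have "(R \<longlongrightarrow> 0 * L2_norm (b t) + L2_norm (a t) * 0 + \<bar>0\<bar> * ((L2_norm a' + 0) * (L2_norm b' + 0))) (at 0)"
    unfolding R_def by (intro tendsto_intros a[folded na_def] b[folded nb_def])
  then have R: "(R \<longlongrightarrow> 0) (at 0)" by simp
  have ne: "eventually (\<lambda>h::real. h \<noteq> 0) (at 0)" by (simp add: eventually_at_filter)
  have "((\<lambda>h. (L2_inner (a (t + h)) (b (t + h)) - L2_inner (a t) (b t)) / h - D) \<longlongrightarrow> 0) (at 0)"
  proof (rule Lim_null_comparison[OF _ R])
    show "eventually (\<lambda>h. norm ((L2_inner (a (t + h)) (b (t + h)) - L2_inner (a t) (b t)) / h - D) \<le> R h) (at 0)"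
      using ev ne
    proof eventually_elim
      case (elim h)
      then have h: "a (t + h) \<in> L2 \<and> b (t + h) \<in> L2" and "h \<noteq> 0" by auto
      define da where "da x = (a (t + h) x - a t x) / h - a' x" for x
      define db where "db x = (b (t + h) x - b t x) / h - b' x" for x
      have "(\<lambda>x. (1 / h) * (a (t + h) x - a t x) - a' x) \<in> L2" "(\<lambda>x. (1 / h) * (b (t + h) x - b t x) - b' x) \<in> L2"
        using h L by (intro L2_diff L2_cmult; simp)+
      then have dL: "da \<in> L2" "db \<in> L2" by (simp_all add: da_def[abs_def] db_def[abs_def])
      have sL: "(\<lambda>x. a' x + da x) \<in> L2" "(\<lambda>x. b' x + db x) \<in> L2" by (intro L2_add dL L)+
      have eqs: "a (t + h) = (\<lambda>x. a t x + h * (a' x + da x))" "b (t + h) = (\<lambda>x. b t x + h * (b' x + db x))"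
        using \<open>h \<noteq> 0\<close> by (auto simp: da_def db_def)
      have "L2_inner (a (t + h)) (b (t + h)) - L2_inner (a t) (b t) =
          h * (L2_inner (\<lambda>x. a' x + da x) (b t) + L2_inner (a t) (\<lambda>x. b' x + db x))
          + h * (h * L2_inner (\<lambda>x. a' x + da x) (\<lambda>x. b' x + db x))"
        unfolding eqs using L dL sL
        by (simp add: L2_inner_add_left L2_inner_add_right L2_inner_cmult_left L2_inner_cmult_right
            L2_cmult L2_add algebra_simps)
      then have eq1: "(L2_inner (a (t + h)) (b (t + h)) - L2_inner (a t) (b t)) / h - D =
          (L2_inner (\<lambda>x. a' x + da x) (b t) + L2_inner (a t) (\<lambda>x. b' x + db x))
          + h * L2_inner (\<lambda>x. a' x + da x) (\<lambda>x. b' x + db x) - D"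
        using \<open>h \<noteq> 0\<close> by (simp add: add_divide_distrib)
      have eq2: "(L2_inner (\<lambda>x. a' x + da x) (b t) + L2_inner (a t) (\<lambda>x. b' x + db x))
          + h * L2_inner (\<lambda>x. a' x + da x) (\<lambda>x. b' x + db x) - D
          = L2_inner da (b t) + L2_inner (a t) db + h * L2_inner (\<lambda>x. a' x + da x) (\<lambda>x. b' x + db x)"
        unfolding D_def using L dL by (simp add: L2_inner_add_left[of a' da "b t"] L2_inner_add_right[of b' db "a t"])
      have "norm ((L2_inner (a (t + h)) (b (t + h)) - L2_inner (a t) (b t)) / h - D)
          \<le> \<bar>L2_inner da (b t)\<bar> + \<bar>L2_inner (a t) db\<bar> + \<bar>h\<bar> * \<bar>L2_inner (\<lambda>x. a' x + da x) (\<lambda>x. b' x + db x)\<bar>"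
        unfolding eq1 eq2 abs_mult[symmetric] real_norm_def by linarith
      also have "\<dots> \<le> L2_norm da * L2_norm (b t) + L2_norm (a t) * L2_norm db
          + \<bar>h\<bar> * ((L2_norm a' + L2_norm da) * (L2_norm b' + L2_norm db))"
      proof -
        have "\<bar>L2_inner (\<lambda>x. a' x + da x) (\<lambda>x. b' x + db x)\<bar> \<le> L2_norm (\<lambda>x. a' x + da x) * L2_norm (\<lambda>x. b' x + db x)"
          by (rule L2_Cauchy_Schwarz[OF sL])
        also have "\<dots> \<le> (L2_norm a' + L2_norm da) * (L2_norm b' + L2_norm db)"
          by (rule mult_mono[OF L2_norm_triangle[OF L(3) dL(1)] L2_norm_triangle[OF L(4) dL(2)]])
             (simp_all add: L2_norm_nonneg)
        finally have "\<bar>h\<bar> * \<bar>L2_inner (\<lambda>x. a' x + da x) (\<lambda>x. b' x + db x)\<bar>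
            \<le> \<bar>h\<bar> * ((L2_norm a' + L2_norm da) * (L2_norm b' + L2_norm db))"
          by (rule mult_left_mono) simp
        then show ?thesis
          using L2_Cauchy_Schwarz[OF dL(1) L(2)] L2_Cauchy_Schwarz[OF L(1) dL(2)] by linarith
      qed
      also have "\<dots> = R h" by (simp add: R_def na_def nb_def da_def[abs_def] db_def[abs_def])
      finally show "norm ((L2_inner (a (t + h)) (b (t + h)) - L2_inner (a t) (b t)) / h - D) \<le> R h" .
    qed
  qed
  then show ?thesis unfolding DERIV_def D_def[symmetric] by (rule LIM_zero_cancel)
qed

section \<open>States, their norm and their components\<close>

definition X_comb :: "real \<Rightarrow> state \<Rightarrow> real \<Rightarrow> state \<Rightarrow> state" where
  "X_comb a v b w = (\<lambda>x. a * fst v x + b * fst w x, \<lambda>x. a * fst (snd v) x + b * fst (snd w) x,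
     a * snd (snd v) + b * snd (snd w))"

lemma X_space_iff: "v \<in> X_space \<longleftrightarrow> fst v \<in> Hl 2 \<and> fst (snd v) \<in> L2"
  by (cases v) (auto simp: X_space_def)

lemma X_comb_X_space: "v \<in> X_space \<Longrightarrow> w \<in> X_space \<Longrightarrow> X_comb a v b w \<in> X_space"
  by (auto simp: X_space_iff X_comb_def intro!: Hl_2_lincomb(1) L2_add L2_cmult)

text \<open>Since |y|^2 \<le> P / 12 and \<rho> varpi^2 \<le> 9 EI, the negative term consumes at
  most three quarters of \<open>EI * P\<close>; a quarter remains. Only this positivity makes the
  square of the square root equal to the quadratic form.\<close>

lemma X_norm_power2:
  assumes "0 < EI" "0 < \<rho>" "\<bar>varpi\<bar> < 3 * sqrt (EI / \<rho>)" and v: "(y, z, \<omega>) \<in> X_space"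
  defines "P \<equiv> L2_inner ((wderiv ^^ 2) y) ((wderiv ^^ 2) y)"
  shows "(X_norm EI \<rho> varpi (y, z, \<omega>))\<^sup>2 = EI * P - \<rho> * varpi\<^sup>2 * L2_inner y y + \<rho> * L2_inner z z + \<omega>\<^sup>2"
    and "EI / 4 * P + \<rho> * L2_inner z z + \<omega>\<^sup>2 \<le> (X_norm EI \<rho> varpi (y, z, \<omega>))\<^sup>2"
proof -
  have y: "y \<in> Hl 2" and z: "z \<in> L2" using v by (auto simp: X_space_def)
  note yL = Hl_2_L2[OF y]
  have X: "X_inner EI \<rho> varpi (y, z, \<omega>) (y, z, \<omega>) = EI * P - \<rho> * varpi\<^sup>2 * L2_inner y y + \<rho> * L2_inner z z + \<omega>\<^sup>2"
    unfolding X_inner_def P_def L2_inner_def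
    using L2_mult_integrable[OF yL(1,1)] L2_mult_integrable[OF yL(3,3)] L2_mult_integrable[OF z z]
    by (simp add: mult.assoc power2_eq_square)
  have v2: "\<rho> * varpi\<^sup>2 \<le> 9 * EI"
  proof -
    have "varpi\<^sup>2 \<le> (3 * sqrt (EI / \<rho>))\<^sup>2" using assms(3) by (intro abs_le_square_iff[THEN iffD1]) auto
    also have "\<dots> = 9 * (EI / \<rho>)" using assms(1,2) by (simp add: power_mult_distrib)
    finally show ?thesis using assms(2) by (simp add: field_simps)
  qed
  have "\<rho> * varpi\<^sup>2 * L2_inner y y \<le> 9 * EI * (P / 12)"
    by (rule mult_mono[OF v2 Hl_2_bounds(1)[OF y, folded P_def]]) (use assms(1) in \<open>auto simp: L2_inner_nonneg\<close>)
  then have low: "EI / 4 * P + \<rho> * L2_inner z z + \<omega>\<^sup>2 \<le> X_inner EI \<rho> varpi (y, z, \<omega>) (y, z, \<omega>)"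
    unfolding X by simp
  moreover have "0 \<le> EI / 4 * P + \<rho> * L2_inner z z + \<omega>\<^sup>2"
    using assms(1,2) by (simp add: P_def L2_inner_nonneg)
  ultimately have sq: "(X_norm EI \<rho> varpi (y, z, \<omega>))\<^sup>2 = X_inner EI \<rho> varpi (y, z, \<omega>) (y, z, \<omega>)"
    by (simp add: X_norm_def)
  show "(X_norm EI \<rho> varpi (y, z, \<omega>))\<^sup>2 = EI * P - \<rho> * varpi\<^sup>2 * L2_inner y y + \<rho> * L2_inner z z + \<omega>\<^sup>2"
    using sq X by simp
  show "EI / 4 * P + \<rho> * L2_inner z z + \<omega>\<^sup>2 \<le> (X_norm EI \<rho> varpi (y, z, \<omega>))\<^sup>2"
    using sq low by simp
qed

text \<open>\<open>sqrt\<close> of a negative number is negative, so this rests on positivity of the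
  quadratic form.\<close>

lemma X_norm_nonneg:
  assumes "0 < EI" "0 < \<rho>" "\<bar>varpi\<bar> < 3 * sqrt (EI / \<rho>)" "v \<in> X_space"
  shows "0 \<le> X_norm EI \<rho> varpi v"
proof -
  obtain y z \<omega> where v: "v = (y, z, \<omega>)" by (cases v) auto
  have y: "y \<in> Hl 2" and z: "z \<in> L2" using assms(4) by (auto simp: X_space_def v)
  note yL = Hl_2_L2[OF y]
  have "X_inner EI \<rho> varpi v v = EI * L2_inner ((wderiv ^^ 2) y) ((wderiv ^^ 2) y)
      - \<rho> * varpi\<^sup>2 * L2_inner y y + \<rho> * L2_inner z z + \<omega>\<^sup>2"
    unfolding X_inner_def L2_inner_def v
    using L2_mult_integrable[OF yL(1,1)] L2_mult_integrable[OF yL(3,3)] L2_mult_integrable[OF z z]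
    by (simp add: mult.assoc power2_eq_square)
  also have "\<dots> = (X_norm EI \<rho> varpi v)\<^sup>2"
    using X_norm_power2(1)[OF assms(1-3), of y z \<omega>] assms(4) by (simp add: v)
  finally have "0 \<le> X_inner EI \<rho> varpi v v" by (metis zero_le_power2)
  then show ?thesis by (simp add: X_norm_def)
qed

text \<open>The linear maps from the state space to \<open>L\<^sup>2\<close>, bounded with respect to \<open>N\<close>. Linearity holds only
  almost everywhere, since \<open>wderiv\<close> picks an arbitrary representative.\<close>

definition X_component :: "(state \<Rightarrow> real) \<Rightarrow> (state \<Rightarrow> real \<Rightarrow> real) \<Rightarrow> bool" where
  "X_component N c \<longleftrightarrow>
     (\<forall>v\<in>X_space. c v \<in> L2) \<and>
     (\<forall>v\<in>X_space. \<forall>w\<in>X_space. \<forall>a b. AE x in I01. c (X_comb a v b w) x = a * c v x + b * c w x) \<and>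
     (\<exists>K\<ge>0. \<forall>v\<in>X_space. L2_norm (c v) \<le> K * N v)"

text \<open>The quantities from which the energy and the multiplier are built. The scalar \<omega>
  enters as a constant function, so that the same rules for absolute continuity and derivatives
  apply to it.\<close>

lemma X_components:
  assumes p: "0 < EI" "0 < \<rho>" "\<bar>varpi\<bar> < 3 * sqrt (EI / \<rho>)"
  defines "N \<equiv> X_norm EI \<rho> varpi"
  shows "X_component N fst"
    and "X_component N (\<lambda>v x. x * wderiv (fst v) x)"
    and "X_component N (\<lambda>v. (wderiv ^^ 2) (fst v))"
    and "X_component N (\<lambda>v. fst (snd v))"
    and "X_component N (\<lambda>v x. snd (snd v))"
proof -
  note NN = X_norm_nonneg[OF p, folded N_def]
  \<comment> \<open>Taken from EI / 4 * |p|^2 \<le> N^2; by \<open>Hl_2_bounds\<close> it also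
    serves y and x y_x.\<close>
  define K where "K = 2 / sqrt EI"
  have K: "K \<ge> 0" using p by (simp add: K_def)
  have bp: "L2_norm ((wderiv ^^ 2) (fst v)) \<le> K * N v" if v: "v \<in> X_space" for v
  proof (rule power2_le_imp_le)
    obtain y z \<omega> where vv: "v = (y, z, \<omega>)" by (cases v) auto
    have "EI / 4 * L2_inner ((wderiv ^^ 2) y) ((wderiv ^^ 2) y) \<le> (N v)\<^sup>2"
      using X_norm_power2(2)[OF p, of y z \<omega>] v L2_inner_nonneg[of z] p(2)
      unfolding N_def vv by (smt (verit) mult_nonneg_nonneg zero_le_power2)
    then show "(L2_norm ((wderiv ^^ 2) (fst v)))\<^sup>2 \<le> (K * N v)\<^sup>2"
      using p by (simp add: L2_norm_power2 power_mult_distrib K_def power_divide vv field_simps)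
  qed (use K NN[OF v] in simp)
  have bz: "L2_norm (fst (snd v)) \<le> (1 / sqrt \<rho>) * N v" if v: "v \<in> X_space" for v
  proof (rule power2_le_imp_le)
    obtain y z \<omega> where vv: "v = (y, z, \<omega>)" by (cases v) auto
    have "\<rho> * L2_inner z z \<le> (N v)\<^sup>2"
      using X_norm_power2(2)[OF p, of y z \<omega>] v L2_inner_nonneg[of "(wderiv ^^ 2) y"] p(1)
      unfolding N_def vv by (smt (verit) mult_nonneg_nonneg zero_le_power2 divide_nonneg_pos)
    then show "(L2_norm (fst (snd v)))\<^sup>2 \<le> ((1 / sqrt \<rho>) * N v)\<^sup>2"
      using p by (simp add: L2_norm_power2 power_mult_distrib power_divide vv field_simps)
  qed (use p NN[OF v] in simp)
  have bo: "L2_norm (\<lambda>x. snd (snd v)) \<le> 1 * N v" if v: "v \<in> X_space" for v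
  proof (rule power2_le_imp_le)
    obtain y z \<omega> where vv: "v = (y, z, \<omega>)" by (cases v) auto
    have "\<omega>\<^sup>2 \<le> (N v)\<^sup>2"
      using X_norm_power2(2)[OF p, of y z \<omega>] v L2_inner_nonneg[of "(wderiv ^^ 2) y"] L2_inner_nonneg[of z] p(1,2)
      unfolding N_def vv by (smt (verit) mult_nonneg_nonneg zero_le_power2 divide_nonneg_pos)
    moreover have "L2_inner (\<lambda>x. \<omega>) (\<lambda>x. \<omega>) = \<omega>\<^sup>2"
      using emeasure_I01 by (simp add: L2_inner_def power2_eq_square measure_def)
    ultimately show "(L2_norm (\<lambda>x. snd (snd v)))\<^sup>2 \<le> (1 * N v)\<^sup>2"
      by (simp add: L2_norm_power2 vv)
  qed (use NN[OF v] in simp)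
  have b0: "L2_norm (fst v) \<le> K * N v" if v: "v \<in> X_space" for v
  proof -
    have y: "fst v \<in> Hl 2" using v by (simp add: X_space_iff)
    have "L2_norm (fst v) \<le> L2_norm ((wderiv ^^ 2) (fst v))"
      unfolding L2_norm_def using Hl_2_bounds(1)[OF y] L2_inner_nonneg[of "(wderiv ^^ 2) (fst v)"]
      by (intro real_sqrt_le_mono) linarith
    then show ?thesis using bp[OF v] by simp
  qed
  have bx: "L2_norm (\<lambda>x. x * wderiv (fst v) x) \<le> K * N v" if v: "v \<in> X_space" for v
  proof -
    have y: "fst v \<in> Hl 2" using v by (simp add: X_space_iff)
    have "L2_norm (\<lambda>x. x * wderiv (fst v) x) \<le> L2_norm (wderiv (fst v))"
      by (rule L2_norm_bounded_mult[OF Hl_2_L2(2)[OF y]])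
         (auto intro!: L2_D(1) L2_continuous continuous_intros)
    also have "\<dots> \<le> L2_norm ((wderiv ^^ 2) (fst v))"
      unfolding L2_norm_def using Hl_2_bounds(2)[OF y] by (rule real_sqrt_le_mono)
    finally show ?thesis using bp[OF v] by simp
  qed
  show "X_component N fst"
    unfolding X_component_def
    by (intro conjI exI[of _ K]) (use K b0 in \<open>auto simp: X_space_iff X_comb_def Hl_2_L2\<close>)
  show "X_component N (\<lambda>v. fst (snd v))"
    unfolding X_component_def
    by (intro conjI exI[of _ "1 / sqrt \<rho>"]) (use p bz in \<open>auto simp: X_space_iff X_comb_def\<close>)
  show "X_component N (\<lambda>v x. snd (snd v))"
    unfolding X_component_def
    by (intro conjI exI[of _ 1]) (use bo L2_const in \<open>auto simp: X_comb_def\<close>)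
  show "X_component N (\<lambda>v. (wderiv ^^ 2) (fst v))"
    unfolding X_component_def
    by (intro conjI exI[of _ K])
       (use K bp in \<open>auto simp: X_space_iff X_comb_def Hl_2_L2 intro!: Hl_2_lincomb(3)\<close>)
  show "X_component N (\<lambda>v x. x * wderiv (fst v) x)"
    unfolding X_component_def
  proof (intro conjI exI[of _ K] ballI allI)
    fix v w :: state and a b :: real assume vw: "v \<in> X_space" "w \<in> X_space"
    show "AE x in I01. x * wderiv (fst (X_comb a v b w)) x = a * (x * wderiv (fst v) x) + b * (x * wderiv (fst w) x)"
      using Hl_2_lincomb(2)[of "fst v" "fst w" a b] vw
      by (auto simp: X_space_iff X_comb_def algebra_simps)
  qed (use K bx in \<open>auto simp: X_space_iff Hl_2_L2 intro!: L2_ident_mult\<close>)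
qed

lemma X_component_increment:
  assumes c: "X_component N c"
  obtains K where "K \<ge> 0" "\<And>v w. v \<in> X_space \<Longrightarrow> w \<in> X_space \<Longrightarrow> L2_norm (\<lambda>x. c v x - c w x) \<le> K * N (v - w)"
proof -
  obtain K where K: "K \<ge> 0" "\<forall>v\<in>X_space. L2_norm (c v) \<le> K * N v" using c by (auto simp: X_component_def)
  show thesis
  proof (rule that[OF K(1)])
    fix v w assume vw: "v \<in> X_space" "w \<in> X_space"
    have eq: "X_comb 1 v (-1) w = v - w" by (simp add: X_comb_def prod_eq_iff fun_eq_iff)
    have m: "v - w \<in> X_space" using X_comb_X_space[OF vw, of 1 "-1"] unfolding eq .
    have "AE x in I01. c (v - w) x = 1 * c v x + (-1) * c w x"
      using c vw unfolding X_component_def eq[symmetric] by blast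
    then have "AE x in I01. c (v - w) x = c v x - c w x" by simp
    then have "L2_norm (c (v - w)) = L2_norm (\<lambda>x. c v x - c w x)"
      by (rule L2_norm_AE_cong) (use c m in \<open>auto simp: X_component_def\<close>)
    then show "L2_norm (\<lambda>x. c v x - c w x) \<le> K * N (v - w)" using K m by auto
  qed
qed

lemma X_component_difference_quotient:
  assumes c: "X_component N c"
  obtains K where "K \<ge> 0" "\<And>v w e r. v \<in> X_space \<Longrightarrow> w \<in> X_space \<Longrightarrow> e \<in> X_space \<Longrightarrow>
     L2_norm (\<lambda>x. r * (c v x - c w x) + c e x) \<le> K * N (X_scale r (v - w) + e)"
proof -
  obtain K where K: "K \<ge> 0" "\<forall>v\<in>X_space. L2_norm (c v) \<le> K * N v" using c by (auto simp: X_component_def)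
  show thesis
  proof (rule that[OF K(1)])
    fix v w e r assume vw: "v \<in> X_space" "w \<in> X_space" and e: "e \<in> X_space"
    define d where "d = X_scale r (v - w) + e"
    have eq: "d = X_comb 1 (X_comb r v (-r) w) 1 e"
      by (simp add: d_def X_comb_def X_scale_def prod_eq_iff fun_eq_iff algebra_simps case_prod_unfold)
    note vw' = X_comb_X_space[OF vw, of r "-r"]
    have m: "d \<in> X_space" using X_comb_X_space[OF vw' e] unfolding eq .
    have 1: "AE x in I01. c d x = 1 * c (X_comb r v (-r) w) x + 1 * c e x"
      using c vw' e unfolding X_component_def eq by blast
    have 2: "AE x in I01. c (X_comb r v (-r) w) x = r * c v x + (-r) * c w x"
      using c vw unfolding X_component_def by blast
    have "AE x in I01. c d x = r * (c v x - c w x) + c e x"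
      using 1 2 by eventually_elim (simp add: algebra_simps)
    then have "L2_norm (c d) = L2_norm (\<lambda>x. r * (c v x - c w x) + c e x)"
      by (rule L2_norm_AE_cong) (use c m in \<open>auto simp: X_component_def\<close>)
    then show "L2_norm (\<lambda>x. r * (c v x - c w x) + c e x) \<le> K * N (X_scale r (v - w) + e)"
      using K m by (auto simp: d_def)
  qed
qed

lemma X_component_ac:
  assumes c: "X_component N c" and u: "abs_cont_on N a b u" and m: "\<And>t. t \<in> {a..b} \<Longrightarrow> u t \<in> X_space"
  shows "ac_increments a b (\<lambda>l r. L2_norm (\<lambda>x. c (u r) x - c (u l) x))"
proof -
  obtain K where K: "K \<ge> 0" "\<And>v w. v \<in> X_space \<Longrightarrow> w \<in> X_space \<Longrightarrow> L2_norm (\<lambda>x. c v x - c w x) \<le> K * N (v - w)"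
    using X_component_increment[OF c] by blast
  show ?thesis
    by (rule ac_increments_le[OF u[unfolded abs_cont_on_iff] K(1) K(2)]) (use m in auto)
qed

text \<open>Here \<open>- e\<close> is the derivative of the state, so that of the component is
  \<open>- c e\<close>; the double minus subtracts it in the shape that
  \<open>L2_inner_derivative\<close> expects.\<close>

lemma X_component_derivative:
  assumes c: "X_component N c" and N: "\<And>v. v \<in> X_space \<Longrightarrow> 0 \<le> N v"
    and m: "\<And>s. s \<ge> 0 \<Longrightarrow> u s \<in> X_space" and "t > 0" and e: "e \<in> X_space"
    and lim: "((\<lambda>h. N (X_scale (1 / h) (u (t + h) - u t) + e)) \<longlongrightarrow> 0) (at 0)"
  shows "((\<lambda>h. L2_norm (\<lambda>x. (c (u (t + h)) x - c (u t) x) / h - - c e x)) \<longlongrightarrow> 0) (at 0)"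
proof -
  obtain K where K: "K \<ge> 0" "\<And>v w e r. v \<in> X_space \<Longrightarrow> w \<in> X_space \<Longrightarrow> e \<in> X_space \<Longrightarrow>
     L2_norm (\<lambda>x. r * (c v x - c w x) + c e x) \<le> K * N (X_scale r (v - w) + e)"
    using X_component_difference_quotient[OF c] by blast
  have "((\<lambda>h. K * N (X_scale (1 / h) (u (t + h) - u t) + e)) \<longlongrightarrow> K * 0) (at 0)"
    by (intro tendsto_intros lim)
  then have z: "((\<lambda>h. K * N (X_scale (1 / h) (u (t + h) - u t) + e)) \<longlongrightarrow> 0) (at 0)" by simp
  \<comment> \<open>The curve is known to stay in the space at nonnegative times only;
    \<open>t > 0\<close> leaves room for negative \<open>h\<close>.\<close>
  have ev: "eventually (\<lambda>h::real. t + h \<ge> 0) (at 0)"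
    using \<open>t > 0\<close> by (auto simp: eventually_at dist_real_def intro!: exI[of _ t])
  show ?thesis
  proof (rule Lim_null_comparison[OF _ z])
    show "eventually (\<lambda>h. norm (L2_norm (\<lambda>x. (c (u (t + h)) x - c (u t) x) / h - - c e x))
        \<le> K * N (X_scale (1 / h) (u (t + h) - u t) + e)) (at 0)"
      using ev
    proof eventually_elim
      fix h :: real assume "t + h \<ge> 0"
      then have "L2_norm (\<lambda>x. (1 / h) * (c (u (t + h)) x - c (u t) x) + c e x)
        \<le> K * N (X_scale (1 / h) (u (t + h) - u t) + e)"
        using \<open>t > 0\<close> by (intro K m e) auto
      then show "norm (L2_norm (\<lambda>x. (c (u (t + h)) x - c (u t) x) / h - - c e x))
        \<le> K * N (X_scale (1 / h) (u (t + h) - u t) + e)"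
        by (simp add: L2_norm_nonneg)
    qed
  qed
qed

lemma X_component_inner_derivative:
  assumes c: "X_component N c" and d: "X_component N d" and N: "\<And>v. v \<in> X_space \<Longrightarrow> 0 \<le> N v"
    and m: "\<And>s. s \<ge> 0 \<Longrightarrow> u s \<in> X_space" and "t > 0" and e: "e \<in> X_space"
    and lim: "((\<lambda>h. N (X_scale (1 / h) (u (t + h) - u t) + e)) \<longlongrightarrow> 0) (at 0)"
  shows "((\<lambda>s. L2_inner (c (u s)) (d (u s))) has_real_derivative
           - (L2_inner (c e) (d (u t)) + L2_inner (c (u t)) (d e))) (at t)"
proof -
  have cd: "c v \<in> L2" "d v \<in> L2" if "v \<in> X_space" for v using c d that by (auto simp: X_component_def)
  have ev: "eventually (\<lambda>h::real. t + h \<ge> 0) (at 0)"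
    using \<open>t > 0\<close> by (auto simp: eventually_at dist_real_def intro!: exI[of _ t])
  have "((\<lambda>s. L2_inner (c (u s)) (d (u s))) has_real_derivative
      L2_inner (\<lambda>x. - c e x) (d (u t)) + L2_inner (c (u t)) (\<lambda>x. - d e x)) (at t)"
  proof (rule L2_inner_derivative)
    show "eventually (\<lambda>h. c (u (t + h)) \<in> L2 \<and> d (u (t + h)) \<in> L2) (at 0)"
      using ev by eventually_elim (auto intro!: cd m)
    show "((\<lambda>h. L2_norm (\<lambda>x. (c (u (t + h)) x - c (u t) x) / h - - c e x)) \<longlongrightarrow> 0) (at 0)"
      by (rule X_component_derivative[OF c N m \<open>t > 0\<close> e lim])
    show "((\<lambda>h. L2_norm (\<lambda>x. (d (u (t + h)) x - d (u t) x) / h - - d e x)) \<longlongrightarrow> 0) (at 0)"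
      by (rule X_component_derivative[OF d N m \<open>t > 0\<close> e lim])
    show "c (u t) \<in> L2" "d (u t) \<in> L2" "(\<lambda>x. - c e x) \<in> L2" "(\<lambda>x. - d e x) \<in> L2"
      using cd[OF m[of t]] L2_minus[OF cd(1)[OF e]] L2_minus[OF cd(2)[OF e]] \<open>t > 0\<close> by simp_all
  qed
  then show ?thesis
    using L2_inner_cmult_left[of "-1" "c e" "d (u t)"] L2_inner_cmult_right[of "c (u t)" "-1" "d e"] by simp
qed

section \<open>The Lyapunov functional\<close>

text \<open>Weighting \<open>(\<omega> - \<varpi>)\<^sup>2\<close> with \<open>I\<^sub>d + \<rho> |y|\<^sup>2\<close> makes the coupling terms of beam and disk cancel
  in the time derivative.\<close>

definition beam_energy :: "real \<Rightarrow> real \<Rightarrow> real \<Rightarrow> real \<Rightarrow> state \<Rightarrow> real" where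
  "beam_energy EI \<rho> I_d varpi v =
     (EI * L2_inner ((wderiv ^^ 2) (fst v)) ((wderiv ^^ 2) (fst v)) - \<rho> * varpi\<^sup>2 * L2_inner (fst v) (fst v)
       + \<rho> * L2_inner (fst (snd v)) (fst (snd v))) / 2
     + (I_d + \<rho> * L2_inner (fst v) (fst v)) / 2 * (snd (snd v) - varpi)\<^sup>2"

definition beam_multiplier :: "real \<Rightarrow> state \<Rightarrow> real" where
  "beam_multiplier \<rho> v = \<rho> * L2_inner (\<lambda>x. x * wderiv (fst v) x) (fst (snd v))"

lemma energy_derivative:
  fixes q1 q2 q3 q4 :: "real \<Rightarrow> real"
  assumes "(q1 has_real_derivative d1) (at t)" "(q2 has_real_derivative d2) (at t)"
    "(q3 has_real_derivative d3) (at t)" "(q4 has_real_derivative d4) (at t)"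
  shows "((\<lambda>t. (k * q1 t - l * q2 t + m * q3 t) / 2 + (n + m * q2 t) / 2 * (q4 t - c)\<^sup>2) has_real_derivative
    (k * d1 - l * d2 + m * d3) / 2 + (m * d2 / 2 * (q4 t - c)\<^sup>2 + (n + m * q2 t) / 2 * (2 * (q4 t - c) * d4))) (at t)"
  using assms by (auto intro!: derivative_eq_intros simp: field_simps)

text \<open>With \<open>e\<close> the value of the full operator at \<open>u t\<close>, each
  component of the solution has derivative minus that component of \<open>e\<close>. The product
  rule then gives every inner product in the functionals its derivative, and the boundary terms come
  from the identities above.\<close>

lemma beam_derivatives:
  fixes u :: "real \<Rightarrow> state"
  assumes par: "0 < EI" "0 < \<rho>" "0 < I_d" "\<bar>varpi\<bar> < 3 * sqrt (EI / \<rho>)"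
    and m: "\<And>s. s \<ge> 0 \<Longrightarrow> u s \<in> X_space" and "t > 0"
    and ut: "u t = (y, z, \<omega>)" and dom: "(y, z) \<in> dom_A f"
    and lim: "((\<lambda>h. X_norm EI \<rho> varpi (X_scale (1 / h) (u (t + h) - u t)
        + (calA EI \<rho> varpi (u t) + calB \<rho> I_d varpi \<gamma> (u t)))) \<longlongrightarrow> 0) (at 0)"
  defines "a \<equiv> point_value z 1" and "b \<equiv> point_value (wderiv z) 1"
    and "r \<equiv> point_value (wderiv y) 1" and "s \<equiv> point_value y 1"
  shows "((\<lambda>t. beam_energy EI \<rho> I_d varpi (u t)) has_real_derivative
      - \<gamma> (\<omega> - varpi) * (\<omega> - varpi) - EI * (f a * a + f b * b)) (at t)"
    and "((\<lambda>t. beam_multiplier \<rho> (u t)) has_real_derivative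
      \<rho> / 2 * (a\<^sup>2 - L2_inner z z)
      + EI * (- 3 / 2 * L2_inner ((wderiv ^^ 2) y) ((wderiv ^^ 2) y) - r * f a - r * f b + (f b)\<^sup>2 / 2)
      + \<rho> * \<omega>\<^sup>2 / 2 * (s\<^sup>2 - L2_inner y y)) (at t)"
proof -
  define N where "N = X_norm EI \<rho> varpi"
  define e where "e = calA EI \<rho> varpi (u t) + calB \<rho> I_d varpi \<gamma> (u t)"
  define J where "J = I_d + \<rho> * L2_inner y y"
  define g where "g = (\<gamma> (\<omega> - varpi) + 2 * \<rho> * \<omega> * L2_inner y z) / J"
  have y4: "y \<in> Hl 4" and z2: "z \<in> Hl 2" using dom by (auto simp: dom_A_def)
  have y2: "y \<in> Hl 2" and w4: "(wderiv ^^ 4) y \<in> L2" using Hl_4_rep[OF y4] H1_rep_L2(2) by blast+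
  note yL = Hl_2_L2[OF y2] and zL = Hl_2_L2[OF z2]
  \<comment> \<open>The vanishing summand brings \<open>- z\<close> into the form of
    \<open>Hl_2_lincomb\<close>.\<close>
  have e1: "fst e = (\<lambda>x. (-1) * z x + 0 * z x)"
    by (simp add: e_def calA_def calB_def op_A_def ut fun_eq_iff)
  \<comment> \<open>The contributions of \<open>varpi\<close> from both operators cancel and leave
    the actual rotation \<omega>.\<close>
  have e2: "fst (snd e) = (\<lambda>x. EI / \<rho> * (wderiv ^^ 4) y x - \<omega>\<^sup>2 * y x)"
    by (simp add: e_def calA_def calB_def op_A_def ut fun_eq_iff algebra_simps)
  have e3: "snd (snd e) = g"
    by (simp add: e_def calA_def calB_def op_A_def ut g_def J_def)
  have eX: "e \<in> X_space"
    unfolding X_space_iff e1 e2 by (intro conjI Hl_2_lincomb(1)[OF z2 z2] L2_diff L2_cmult w4 yL)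
  have N: "0 \<le> N v" if "v \<in> X_space" for v unfolding N_def using X_norm_nonneg[OF par(1,2,4) that] .
  note comp = X_components[OF par(1,2,4), folded N_def]
  have lim': "((\<lambda>h. N (X_scale (1 / h) (u (t + h) - u t) + e)) \<longlongrightarrow> 0) (at 0)"
    using lim by (simp add: N_def e_def)
  note ider = X_component_inner_derivative[where u=u, OF _ _ N m \<open>t > 0\<close> eX lim']
  have "AE x in I01. (wderiv ^^ 2) (fst e) x = (-1) * (wderiv ^^ 2) z x + 0 * (wderiv ^^ 2) z x"
    unfolding e1 by (rule Hl_2_lincomb(3)[OF z2 z2])
  then have pe: "AE x in I01. (wderiv ^^ 2) (fst e) x = (-1) * (wderiv ^^ 2) z x" by simp
  have "AE x in I01. wderiv (fst e) x = (-1) * wderiv z x + 0 * wderiv z x"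
    unfolding e1 by (rule Hl_2_lincomb(2)[OF z2 z2])
  then have xe: "AE x in I01. x * wderiv (fst e) x = (-1) * (x * wderiv z x)" by eventually_elim simp
  have eH: "fst e \<in> Hl 2" using eX by (simp add: X_space_iff)
  note eL = Hl_2_L2[OF eH]
  have Q1: "((\<lambda>t. L2_inner ((wderiv ^^ 2) (fst (u t))) ((wderiv ^^ 2) (fst (u t)))) has_real_derivative
      2 * L2_inner ((wderiv ^^ 2) y) ((wderiv ^^ 2) z)) (at t)"
  proof -
    have "L2_inner ((wderiv ^^ 2) (fst e)) ((wderiv ^^ 2) y) = L2_inner (\<lambda>x. (-1) * (wderiv ^^ 2) z x) ((wderiv ^^ 2) y)"
      by (rule L2_inner_AE_cong[OF pe _ eL(3) yL(3)]) simp
    then have "L2_inner ((wderiv ^^ 2) (fst e)) ((wderiv ^^ 2) y) = - L2_inner ((wderiv ^^ 2) y) ((wderiv ^^ 2) z)"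
      unfolding L2_inner_cmult_left by (simp add: L2_inner_commute)
    then show ?thesis using ider[OF comp(3) comp(3)] by (simp add: ut L2_inner_commute)
  qed
  have Q2: "((\<lambda>t. L2_inner (fst (u t)) (fst (u t))) has_real_derivative 2 * L2_inner y z) (at t)"
  proof -
    have "L2_inner (fst e) y = - L2_inner y z"
      unfolding e1 using L2_inner_cmult_left[of "-1" z y] by (simp add: L2_inner_commute)
    then show ?thesis using ider[OF comp(1) comp(1)] by (simp add: ut L2_inner_commute)
  qed
  have ez: "L2_inner v (fst (snd e)) = EI / \<rho> * L2_inner v ((wderiv ^^ 4) y) - \<omega>\<^sup>2 * L2_inner v y" if "v \<in> L2" for v
    unfolding e2 using that w4 yL by (simp only: L2_inner_diff_right L2_cmult L2_inner_cmult_right)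
  have Q3: "((\<lambda>t. L2_inner (fst (snd (u t))) (fst (snd (u t)))) has_real_derivative
      - 2 * (EI / \<rho> * L2_inner z ((wderiv ^^ 4) y) - \<omega>\<^sup>2 * L2_inner z y)) (at t)"
  proof (rule DERIV_cong[OF ider[OF comp(4) comp(4)]])
    have "- (L2_inner (fst (snd e)) z + L2_inner z (fst (snd e))) = - 2 * L2_inner z (fst (snd e))"
      by (simp add: L2_inner_commute[of "fst (snd e)" z])
    then show "- (L2_inner (fst (snd e)) (fst (snd (u t))) + L2_inner (fst (snd (u t))) (fst (snd e)))
        = - 2 * (EI / \<rho> * L2_inner z ((wderiv ^^ 4) y) - \<omega>\<^sup>2 * L2_inner z y)"
      unfolding ut fst_conv snd_conv ez[OF zL(1)] .
  qed
  have Q4: "((\<lambda>t. L2_inner (\<lambda>x. x * wderiv (fst (u t)) x) (fst (snd (u t)))) has_real_derivative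
      L2_inner (\<lambda>x. x * wderiv z x) z - (EI / \<rho> * L2_inner (\<lambda>x. x * wderiv y x) ((wderiv ^^ 4) y)
        - \<omega>\<^sup>2 * L2_inner (\<lambda>x. x * wderiv y x) y)) (at t)"
  proof -
    have "L2_inner (\<lambda>x. x * wderiv (fst e) x) z = L2_inner (\<lambda>x. (-1) * (x * wderiv z x)) z"
      by (rule L2_inner_AE_cong[OF xe _ L2_ident_mult[OF eL(2)] zL(1)]) simp
    then have "L2_inner (\<lambda>x. x * wderiv (fst e) x) z = - L2_inner (\<lambda>x. x * wderiv z x) z"
      unfolding L2_inner_cmult_left by simp
    then show ?thesis using ider[OF comp(2) comp(4)] ez[OF L2_ident_mult[OF yL(2)]] by (simp add: ut)
  qed
  have Q5: "((\<lambda>t. snd (snd (u t))) has_real_derivative - g) (at t)"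
  proof -
    \<comment> \<open>The interval has measure 1, so the L2 norm of a constant is its absolute value
      and the convergence becomes that of a real difference quotient.\<close>
    have c: "L2_inner (\<lambda>x. p) (\<lambda>x. q) = p * q" for p q
      using emeasure_I01 by (simp add: L2_inner_def measure_def)
    have "((\<lambda>h. L2_norm (\<lambda>x. (snd (snd (u (t + h))) - snd (snd (u t))) / h - - snd (snd e))) \<longlongrightarrow> 0) (at 0)"
      using X_component_derivative[where u=u, OF comp(5) N m \<open>t > 0\<close> eX lim'] .
    then have "((\<lambda>h. \<bar>(snd (snd (u (t + h))) - snd (snd (u t))) / h - - g\<bar>) \<longlongrightarrow> 0) (at 0)"
      unfolding L2_norm_def c e3 by (simp add: real_sqrt_mult_self)
    then have "((\<lambda>h. (snd (snd (u (t + h))) - snd (snd (u t))) / h - - g) \<longlongrightarrow> 0) (at 0)"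
      by (rule tendsto_rabs_zero_cancel)
    then show ?thesis unfolding DERIV_def by (rule LIM_zero_cancel)
  qed
  have J: "J > 0" using par L2_inner_nonneg[of y] by (simp add: J_def add_pos_nonneg)
  then have gJ: "J * g = \<gamma> (\<omega> - varpi) + 2 * \<rho> * \<omega> * L2_inner y z" by (simp add: g_def)
  have diss: "L2_inner ((wderiv ^^ 2) y) ((wderiv ^^ 2) z) - L2_inner z ((wderiv ^^ 4) y) = - (f a * a + f b * b)"
    using dom_A_dissipation[OF dom] by (simp add: a_def b_def L2_inner_commute[of z])
  define PZ where "PZ = L2_inner ((wderiv ^^ 2) y) ((wderiv ^^ 2) z)"
  define Z4 where "Z4 = L2_inner z ((wderiv ^^ 4) y)"
  define S where "S = L2_inner y z"
  have "((\<lambda>t. beam_energy EI \<rho> I_d varpi (u t)) has_real_derivative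
     (EI * (2 * PZ) - \<rho> * varpi\<^sup>2 * (2 * S) + \<rho> * (- 2 * (EI / \<rho> * Z4 - \<omega>\<^sup>2 * S))) / 2
      + (\<rho> * (2 * S) / 2 * (\<omega> - varpi)\<^sup>2 + J / 2 * (2 * (\<omega> - varpi) * - g))) (at t)"
    unfolding beam_energy_def
    by (rule DERIV_cong[OF energy_derivative[OF Q1 Q2 Q3 Q5]])
       (simp add: ut PZ_def Z4_def S_def J_def L2_inner_commute[of z y])
  moreover have "(EI * (2 * PZ) - \<rho> * varpi\<^sup>2 * (2 * S) + \<rho> * (- 2 * (EI / \<rho> * Z4 - \<omega>\<^sup>2 * S))) / 2
      + (\<rho> * (2 * S) / 2 * (\<omega> - varpi)\<^sup>2 + J / 2 * (2 * (\<omega> - varpi) * - g))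
      = EI * (PZ - Z4) + \<rho> * S * (\<omega>\<^sup>2 - varpi\<^sup>2 + (\<omega> - varpi)\<^sup>2) - (\<omega> - varpi) * (J * g)"
    using par(2) by (simp add: field_simps)
  \<comment> \<open>The bracket equals 2 \<omega> (\<omega> - varpi); multiplied by
    \<open>\<rho> * S\<close> it cancels the coupling term contained in
    \<open>J * g\<close>.\<close>
  moreover have "\<dots> = - \<gamma> (\<omega> - varpi) * (\<omega> - varpi) - EI * (f a * a + f b * b)"
    unfolding gJ S_def[symmetric] diss[folded PZ_def Z4_def]
    by (simp add: power2_eq_square algebra_simps)
  ultimately show "((\<lambda>t. beam_energy EI \<rho> I_d varpi (u t)) has_real_derivative
      - \<gamma> (\<omega> - varpi) * (\<omega> - varpi) - EI * (f a * a + f b * b)) (at t)" by simp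
  have bc: "point_value ((wderiv ^^ 3) y) 1 = f a" "point_value ((wderiv ^^ 2) y) 1 = - f b"
    using dom by (auto simp: dom_A_def a_def b_def)
  have m1: "L2_inner (\<lambda>x. x * wderiv z x) z = (a\<^sup>2 - L2_inner z z) / 2"
    unfolding a_def by (rule Hl_2_multiplier[OF z2])
  have m2: "L2_inner (\<lambda>x. x * wderiv y x) y = (s\<^sup>2 - L2_inner y y) / 2"
    unfolding s_def by (rule Hl_2_multiplier[OF y2])
  have m3: "L2_inner (\<lambda>x. x * wderiv y x) ((wderiv ^^ 4) y) =
     r * (f a + f b) - (f b)\<^sup>2 / 2 + 3 / 2 * L2_inner ((wderiv ^^ 2) y) ((wderiv ^^ 2) y)"
    using Hl_4_multiplier[OF y4] unfolding bc r_def by simp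
  have "((\<lambda>t. beam_multiplier \<rho> (u t)) has_real_derivative
      \<rho> * (L2_inner (\<lambda>x. x * wderiv z x) z - (EI / \<rho> * L2_inner (\<lambda>x. x * wderiv y x) ((wderiv ^^ 4) y)
        - \<omega>\<^sup>2 * L2_inner (\<lambda>x. x * wderiv y x) y))) (at t)"
    unfolding beam_multiplier_def by (rule DERIV_cmult[OF Q4])
  then show "((\<lambda>t. beam_multiplier \<rho> (u t)) has_real_derivative
      \<rho> / 2 * (a\<^sup>2 - L2_inner z z)
      + EI * (- 3 / 2 * L2_inner ((wderiv ^^ 2) y) ((wderiv ^^ 2) y) - r * f a - r * f b + (f b)\<^sup>2 / 2)
      + \<rho> * \<omega>\<^sup>2 / 2 * (s\<^sup>2 - L2_inner y y)) (at t)"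
    unfolding m1 m2 m3 by (rule DERIV_cong) (use par(2) in \<open>simp add: field_simps\<close>)
qed

text \<open>The bound on \<open>varpi\<close> is used for \<open>D > 0\<close> in the proof.\<close>

lemma multiplier_rate_bound:
  fixes EI \<rho> varpi H S M :: real
  assumes par: "0 < EI" "0 < \<rho>" "\<rho> * varpi\<^sup>2 < 9 * EI" and "0 \<le> H" "0 \<le> S" "0 \<le> M"
  obtains d K1 K2 where "0 < d" "0 \<le> K1" "0 \<le> K2"
    "\<And>P Y Z a b r s fa fb \<eta>. \<lbrakk>0 \<le> Y; s\<^sup>2 \<le> P / 3; r\<^sup>2 \<le> P; \<bar>\<eta>\<bar> \<le> H; \<bar>s\<bar> \<le> S; \<bar>fa\<bar> \<le> M * \<bar>a\<bar>; \<bar>fb\<bar> \<le> M * \<bar>b\<bar>\<rbrakk> \<Longrightarrow>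
       \<rho> / 2 * (a\<^sup>2 - Z) + EI * (- 3 / 2 * P - r * fa - r * fb + fb\<^sup>2 / 2) + \<rho> * (varpi + \<eta>)\<^sup>2 / 2 * (s\<^sup>2 - Y)
       \<le> - \<rho> / 2 * Z - d * P + K1 * (a\<^sup>2 + b\<^sup>2) + K2 * \<eta>\<^sup>2"
proof -
  \<comment> \<open>What remains of 3/2 EI |p|^2 after y(1)^2 \<le> |p|^2 / 3 has been inserted in
    the rotation term. A sixth of \<open>D\<close> goes to each of the two products with
    \<open>r\<close>, a third to the terms in \<eta>, and a third is left as the rate.\<close>
  define D where "D = 3 / 2 * EI - \<rho> * varpi\<^sup>2 / 6"
  define B where "B = \<rho> * (H + 2 * \<bar>varpi\<bar>) * S / 2"
  define K1 where "K1 = \<rho> / 2 + 3 / 2 * EI\<^sup>2 * M\<^sup>2 / D + EI * M\<^sup>2 / 2"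
  define K2 where "K2 = B\<^sup>2 / (4 * D)"
  have D: "D > 0" using par by (simp add: D_def)
  \<comment> \<open>The weight is free: a small multiple of the interior energy is traded for a
    large multiple of a dissipated quantity.\<close>
  have young: "p * q \<le> k * p\<^sup>2 + q\<^sup>2 / (4 * k)" if "k > 0" for p q k :: real
  proof -
    have "0 \<le> (2 * k * p - q)\<^sup>2 / (4 * k)" using that by simp
    also have "\<dots> = k * p\<^sup>2 + q\<^sup>2 / (4 * k) - p * q"
      using that by (simp add: field_simps power2_eq_square)
    finally show ?thesis by simp
  qed
  show thesis
  proof (rule that[of "D / 3" K1 K2])
    fix P Y Z a b r s fa fb \<eta> :: real
    assume Y: "0 \<le> Y" and s: "s\<^sup>2 \<le> P / 3" and r: "r\<^sup>2 \<le> P" and \<eta>: "\<bar>\<eta>\<bar> \<le> H" and S: "\<bar>s\<bar> \<le> S"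
      and fa: "\<bar>fa\<bar> \<le> M * \<bar>a\<bar>" and fb: "\<bar>fb\<bar> \<le> M * \<bar>b\<bar>"
    have fa2: "fa\<^sup>2 \<le> M\<^sup>2 * a\<^sup>2"
      using power_mono[OF fa, of 2] by (simp add: power_mult_distrib)
    have fb2: "fb\<^sup>2 \<le> M\<^sup>2 * b\<^sup>2"
      using power_mono[OF fb, of 2] by (simp add: power_mult_distrib)
    have ya: "EI * (- r * f) \<le> D / 6 * P + 3 / 2 * EI\<^sup>2 / D * f\<^sup>2" for f
    proof -
      have "(- r) * (EI * f) \<le> D / 6 * (- r)\<^sup>2 + (EI * f)\<^sup>2 / (4 * (D / 6))"
        using D by (intro young) simp
      also have "\<dots> \<le> D / 6 * P + 3 / 2 * EI\<^sup>2 / D * f\<^sup>2"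
      proof -
        have "D / 6 * r\<^sup>2 \<le> D / 6 * P" by (rule mult_left_mono[OF r]) (use D in simp)
        moreover have eq: "(EI * f)\<^sup>2 / (4 * (D / 6)) = 3 / 2 * EI\<^sup>2 / D * f\<^sup>2"
          using D by (simp add: power_mult_distrib)
        ultimately show ?thesis unfolding eq by (simp only: power2_minus add_le_cancel_right)
      qed
      finally show ?thesis by (simp add: algebra_simps)
    qed
    have ca: "3 / 2 * EI\<^sup>2 / D * fa\<^sup>2 \<le> 3 / 2 * EI\<^sup>2 / D * (M\<^sup>2 * a\<^sup>2)"
      "3 / 2 * EI\<^sup>2 / D * fb\<^sup>2 \<le> 3 / 2 * EI\<^sup>2 / D * (M\<^sup>2 * b\<^sup>2)"
      by (rule mult_left_mono[OF fa2], use D in simp, rule mult_left_mono[OF fb2], use D in simp)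
    have cb: "EI * (fb\<^sup>2 / 2) \<le> EI * (M\<^sup>2 * b\<^sup>2 / 2)"
      using par fb2 by (intro mult_left_mono) auto
    have cs: "\<rho> * varpi\<^sup>2 / 2 * s\<^sup>2 \<le> \<rho> * varpi\<^sup>2 / 6 * P"
      using mult_left_mono[OF s, of "\<rho> * varpi\<^sup>2 / 2"] par by simp
    \<comment> \<open>One factor each of |\<eta>| and |s| is kept, and the others are replaced by
      the a priori bounds \<open>H\<close> and \<open>S\<close>. Young's inequality applied to |s|
      (B |\<eta>|) then yields quadratic terms only.\<close>
    have ce: "\<rho> * \<eta> * (\<eta> + 2 * varpi) / 2 * s\<^sup>2 \<le> D / 3 * P + K2 * \<eta>\<^sup>2"
    proof -
      have "\<eta> * (\<eta> + 2 * varpi) * s\<^sup>2 \<le> \<bar>\<eta>\<bar> * (H + 2 * \<bar>varpi\<bar>) * (\<bar>s\<bar> * S)"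
      proof -
        have 1: "\<eta> * (\<eta> + 2 * varpi) \<le> \<bar>\<eta>\<bar> * (H + 2 * \<bar>varpi\<bar>)"
        proof -
          have "\<eta> * (\<eta> + 2 * varpi) \<le> \<bar>\<eta>\<bar> * \<bar>\<eta> + 2 * varpi\<bar>"
            unfolding abs_mult[symmetric] by (rule abs_ge_self)
          also have "\<dots> \<le> \<bar>\<eta>\<bar> * (H + 2 * \<bar>varpi\<bar>)" using \<eta> by (intro mult_left_mono) auto
          finally show ?thesis .
        qed
        have 2: "s\<^sup>2 \<le> \<bar>s\<bar> * S"
          using mult_left_mono[OF S, of "\<bar>s\<bar>"] by (simp add: power2_eq_square)
        show ?thesis
          by (rule mult_mono[OF 1 2]) (use \<open>0 \<le> H\<close> in auto)
      qed
      then have "\<rho> / 2 * (\<eta> * (\<eta> + 2 * varpi) * s\<^sup>2) \<le> \<rho> / 2 * (\<bar>\<eta>\<bar> * (H + 2 * \<bar>varpi\<bar>) * (\<bar>s\<bar> * S))"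
        using par by (intro mult_left_mono) auto
      also have "\<dots> = \<bar>s\<bar> * (B * \<bar>\<eta>\<bar>)" by (simp add: B_def)
      also have "\<dots> \<le> D * \<bar>s\<bar>\<^sup>2 + (B * \<bar>\<eta>\<bar>)\<^sup>2 / (4 * D)" by (rule young[OF D])
      also have "\<dots> \<le> D / 3 * P + K2 * \<eta>\<^sup>2"
        using mult_left_mono[OF s, of D] D by (simp add: K2_def power_mult_distrib)
      finally show ?thesis by (simp add: mult.assoc)
    qed
    \<comment> \<open>The contribution of \<open>Y\<close> has a favourable sign and is
      dropped.\<close>
    have cy: "0 \<le> \<rho> * (varpi + \<eta>)\<^sup>2 / 2 * Y" using par Y by simp
    have K1: "K1 * (a\<^sup>2 + b\<^sup>2) = \<rho> / 2 * a\<^sup>2 + \<rho> / 2 * b\<^sup>2 + 3 / 2 * EI\<^sup>2 / D * (M\<^sup>2 * a\<^sup>2)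
        + 3 / 2 * EI\<^sup>2 / D * (M\<^sup>2 * b\<^sup>2) + EI * (M\<^sup>2 * a\<^sup>2 / 2) + EI * (M\<^sup>2 * b\<^sup>2 / 2)"
      by (simp add: K1_def algebra_simps add_divide_distrib)
    have nn: "0 \<le> \<rho> / 2 * b\<^sup>2" "0 \<le> EI * (M\<^sup>2 * a\<^sup>2 / 2)" using par by auto
    have "\<rho> / 2 * (a\<^sup>2 - Z) + EI * (- 3 / 2 * P - r * fa - r * fb + fb\<^sup>2 / 2) + \<rho> * (varpi + \<eta>)\<^sup>2 / 2 * (s\<^sup>2 - Y)
      = \<rho> / 2 * a\<^sup>2 - \<rho> / 2 * Z - 3 / 2 * EI * P + EI * (- r * fa) + EI * (- r * fb) + EI * (fb\<^sup>2 / 2)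
        + \<rho> * varpi\<^sup>2 / 2 * s\<^sup>2 + \<rho> * \<eta> * (\<eta> + 2 * varpi) / 2 * s\<^sup>2 - \<rho> * (varpi + \<eta>)\<^sup>2 / 2 * Y"
      by (simp add: power2_eq_square field_simps)
    also have "\<dots> \<le> - \<rho> / 2 * Z - D / 3 * P + K1 * (a\<^sup>2 + b\<^sup>2) + K2 * \<eta>\<^sup>2"
    proof -
      have "3 / 2 * EI * P = D * P + \<rho> * varpi\<^sup>2 / 6 * P" by (simp add: D_def algebra_simps)
      moreover have "D / 6 * P = (D * P) / 6" "D / 3 * P = (D * P) / 3" by simp_all
      ultimately show ?thesis
        using ya[of fa] ya[of fb] ca cb cs ce cy nn unfolding K1 by linarith
    qed
    finally show "\<rho> / 2 * (a\<^sup>2 - Z) + EI * (- 3 / 2 * P - r * fa - r * fb + fb\<^sup>2 / 2) + \<rho> * (varpi + \<eta>)\<^sup>2 / 2 * (s\<^sup>2 - Y)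
      \<le> - \<rho> / 2 * Z - D / 3 * P + K1 * (a\<^sup>2 + b\<^sup>2) + K2 * \<eta>\<^sup>2" .
  qed (use D par in \<open>auto simp: K1_def K2_def\<close>)
qed

text \<open>Monotonicity and \<open>f 0 = 0\<close> give \<open>f s\<close> the sign of
  \<open>s\<close>, which turns bounds on absolute values into bounds on the product; minimum and
  maximum merge the regimes of small and large arguments.\<close>

lemma sector_bounds:
  fixes f :: "real \<Rightarrow> real"
  assumes "mono f" "f 0 = 0" "0 < c" "0 < c1" "0 < c2"
    and "\<And>s. \<bar>s\<bar> < \<sigma> \<Longrightarrow> c * \<bar>s\<bar> \<le> \<bar>f s\<bar> \<and> \<bar>f s\<bar> \<le> inverse c * \<bar>s\<bar>"
    and "\<And>s. \<bar>s\<bar> \<ge> \<sigma> \<Longrightarrow> c1 * \<bar>s\<bar> \<le> \<bar>f s\<bar> \<and> \<bar>f s\<bar> \<le> c2 * \<bar>s\<bar>"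
  shows "min c c1 * s\<^sup>2 \<le> f s * s" and "\<bar>f s\<bar> \<le> max (inverse c) c2 * \<bar>s\<bar>"
proof -
  have "min c c1 * \<bar>s\<bar> \<le> c * \<bar>s\<bar>" "min c c1 * \<bar>s\<bar> \<le> c1 * \<bar>s\<bar>"
    "inverse c * \<bar>s\<bar> \<le> max (inverse c) c2 * \<bar>s\<bar>" "c2 * \<bar>s\<bar> \<le> max (inverse c) c2 * \<bar>s\<bar>"
    by (intro mult_right_mono; simp)+
  then have *: "min c c1 * \<bar>s\<bar> \<le> \<bar>f s\<bar>" "\<bar>f s\<bar> \<le> max (inverse c) c2 * \<bar>s\<bar>"
    using assms(6,7)[of s] by (cases "\<bar>s\<bar> < \<sigma>"; force)+
  show "\<bar>f s\<bar> \<le> max (inverse c) c2 * \<bar>s\<bar>" by (rule *(2))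
  have "f s * s = \<bar>f s\<bar> * \<bar>s\<bar>"
    using monoD[OF assms(1), of 0 s] monoD[OF assms(1), of s 0] assms(2)
    by (cases "s \<ge> 0") auto
  moreover have "(min c c1 * \<bar>s\<bar>) * \<bar>s\<bar> \<le> \<bar>f s\<bar> * \<bar>s\<bar>" using *(1) by (rule mult_right_mono) simp
  ultimately show "min c c1 * s\<^sup>2 \<le> f s * s"
    by (metis abs_mult_self_eq mult.assoc power2_eq_square)
qed

text \<open>Time 0, where no two-sided derivative is available, is put into the exceptional
  set.\<close>

lemma ac_on_nonincreasing:
  assumes "0 \<le> T" "ac_on 0 T g" "negligible N"
    and "\<And>t. t > 0 \<Longrightarrow> t \<notin> N \<Longrightarrow> \<exists>D\<le>0. (g has_real_derivative D) (at t)"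
  shows "g T \<le> g 0"
proof (rule ac_nonincreasing[OF assms(1,2), of "insert 0 N"])
  show "negligible (insert 0 N)" using assms(3) by simp
  show "\<exists>D\<le>0. (g has_real_derivative D) (at t within {0..T})" if "t \<in> {0..T} - insert 0 N" for t
    using assms(4)[of t] that has_field_derivative_at_within by fastforce
qed

lemma beam_ac:
  assumes par: "0 < EI" "0 < \<rho>" "\<bar>varpi\<bar> < 3 * sqrt (EI / \<rho>)"
    and m: "\<And>s. s \<ge> 0 \<Longrightarrow> u s \<in> X_space" and ac: "abs_cont_on (X_norm EI \<rho> varpi) 0 T u"
  shows "ac_on 0 T (\<lambda>t. beam_energy EI \<rho> I_d varpi (u t))" and "ac_on 0 T (\<lambda>t. beam_multiplier \<rho> (u t))"
proof -
  note comp = X_components[OF par]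
  have L: "c (u t) \<in> L2" if "X_component (X_norm EI \<rho> varpi) c" "t \<in> {0..T}" for c t
    using that m by (auto simp: X_component_def)
  have inner: "ac_on 0 T (\<lambda>t. L2_inner (c (u t)) (d (u t)))"
    if "X_component (X_norm EI \<rho> varpi) c" "X_component (X_norm EI \<rho> varpi) d" for c d
    by (intro L2_inner_ac_on L that X_component_ac[OF _ ac] m) auto
  have const: "L2_norm (\<lambda>x. k) = \<bar>k\<bar>" for k
    using emeasure_I01 by (simp add: L2_norm_def L2_inner_def measure_def)
  have "ac_increments 0 T (\<lambda>l r. L2_norm (\<lambda>x. snd (snd (u r)) - snd (snd (u l))))"
    by (rule X_component_ac[OF comp(5) ac]) (use m in auto)
  then have om: "ac_on 0 T (\<lambda>t. snd (snd (u t)))" unfolding const .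
  have cm: "ac_on 0 T (\<lambda>t. k * g t)" if "ac_on 0 T g" for k g
    by (rule ac_on_mult[OF ac_on_const that])
  have "ac_on 0 T (\<lambda>t. EI / 2 * L2_inner ((wderiv ^^ 2) (fst (u t))) ((wderiv ^^ 2) (fst (u t)))
      + (- (\<rho> * varpi\<^sup>2 / 2)) * L2_inner (fst (u t)) (fst (u t))
      + \<rho> / 2 * L2_inner (fst (snd (u t))) (fst (snd (u t)))
      + (I_d / 2 + \<rho> / 2 * L2_inner (fst (u t)) (fst (u t)))
          * ((snd (snd (u t)) - varpi) * (snd (snd (u t)) - varpi)))"
    by (rule ac_on_add[OF ac_on_add[OF ac_on_add[OF cm[OF inner[OF comp(3,3)]] cm[OF inner[OF comp(1,1)]]]
            cm[OF inner[OF comp(4,4)]]]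
          ac_on_mult[OF ac_on_add[OF ac_on_const cm[OF inner[OF comp(1,1)]]]
            ac_on_mult[OF ac_on_diff_const[OF om] ac_on_diff_const[OF om]]]])
  then show "ac_on 0 T (\<lambda>t. beam_energy EI \<rho> I_d varpi (u t))"
    unfolding beam_energy_def by (simp add: power2_eq_square diff_divide_distrib add_divide_distrib)
  show "ac_on 0 T (\<lambda>t. beam_multiplier \<rho> (u t))"
    unfolding beam_multiplier_def by (rule cm[OF inner[OF comp(2,4)]])
qed

text \<open>EI / 8 is half of EI - 9 EI / 12. The upper bound contains the quartic product of
  \<open>P\<close> and \<eta>^2, so it becomes quadratic only along solutions with bounded
  \<open>P\<close>. The multiplier is bounded using |x| \<le> 1 and the bound on the first
  derivative.\<close>

lemma beam_energy_bounds:
  assumes par: "0 < EI" "0 < \<rho>" "0 < I_d" "\<rho> * varpi\<^sup>2 \<le> 9 * EI" and v: "(y, z, \<omega>) \<in> X_space"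
  defines "P \<equiv> L2_inner ((wderiv ^^ 2) y) ((wderiv ^^ 2) y)" and "Z \<equiv> L2_inner z z" and "\<eta> \<equiv> \<omega> - varpi"
  shows "EI / 8 * P + \<rho> / 2 * Z + I_d / 2 * \<eta>\<^sup>2 \<le> beam_energy EI \<rho> I_d varpi (y, z, \<omega>)"
    and "beam_energy EI \<rho> I_d varpi (y, z, \<omega>) \<le> EI / 2 * P + \<rho> / 2 * Z + (I_d + \<rho> * P / 12) / 2 * \<eta>\<^sup>2"
    and "\<bar>beam_multiplier \<rho> (y, z, \<omega>)\<bar> \<le> \<rho> / 2 * (P + Z)"
proof -
  have y: "y \<in> Hl 2" and z: "z \<in> L2" using v by (auto simp: X_space_def)
  define Y where "Y = L2_inner y y"
  have Y: "0 \<le> Y" "Y \<le> P / 12" using Hl_2_bounds(1)[OF y] by (auto simp: Y_def P_def L2_inner_nonneg)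
  have E: "beam_energy EI \<rho> I_d varpi (y, z, \<omega>) =
      (EI * P - \<rho> * varpi\<^sup>2 * Y + \<rho> * Z) / 2 + (I_d + \<rho> * Y) / 2 * \<eta>\<^sup>2"
    by (simp add: beam_energy_def P_def Y_def Z_def \<eta>_def)
  have "\<rho> * varpi\<^sup>2 * Y \<le> 9 * EI * (P / 12)"
    by (rule mult_mono[OF par(4) Y(2)]) (use par Y in auto)
  moreover have "I_d * \<eta>\<^sup>2 \<le> (I_d + \<rho> * Y) * \<eta>\<^sup>2"
    using par Y by (intro mult_right_mono) auto
  ultimately show "EI / 8 * P + \<rho> / 2 * Z + I_d / 2 * \<eta>\<^sup>2 \<le> beam_energy EI \<rho> I_d varpi (y, z, \<omega>)"
    unfolding E by (simp add: algebra_simps add_divide_distrib diff_divide_distrib)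
  have "0 \<le> \<rho> * varpi\<^sup>2 * Y" using par Y by simp
  moreover have "(I_d + \<rho> * Y) * \<eta>\<^sup>2 \<le> (I_d + \<rho> * P / 12) * \<eta>\<^sup>2"
    using par mult_left_mono[OF Y(2), of \<rho>] by (intro mult_right_mono) auto
  ultimately show "beam_energy EI \<rho> I_d varpi (y, z, \<omega>) \<le> EI / 2 * P + \<rho> / 2 * Z + (I_d + \<rho> * P / 12) / 2 * \<eta>\<^sup>2"
    unfolding E by (simp add: algebra_simps add_divide_distrib diff_divide_distrib)
  define A where "A = (\<lambda>x. x * wderiv y x)"
  have A: "A \<in> L2" unfolding A_def by (rule L2_ident_mult[OF Hl_2_L2(2)[OF y]])
  have "L2_norm A \<le> L2_norm (wderiv y)" unfolding A_def
    by (rule L2_norm_bounded_mult[OF Hl_2_L2(2)[OF y]])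
       (auto intro!: L2_D(1) L2_continuous continuous_intros)
  then have "(L2_norm A)\<^sup>2 \<le> (L2_norm (wderiv y))\<^sup>2" by (rule power_mono) (rule L2_norm_nonneg)
  then have A2: "(L2_norm A)\<^sup>2 \<le> P" using Hl_2_bounds(2)[OF y] by (simp add: L2_norm_power2 P_def)
  have "2 * L2_norm A * L2_norm z \<le> (L2_norm A)\<^sup>2 + (L2_norm z)\<^sup>2" by (rule sum_squares_bound)
  then have "\<bar>L2_inner A z\<bar> \<le> (P + Z) / 2"
    using L2_Cauchy_Schwarz[OF A z] A2 by (simp add: L2_norm_power2[of z] Z_def)
  from mult_left_mono[OF this, of \<rho>] show "\<bar>beam_multiplier \<rho> (y, z, \<omega>)\<bar> \<le> \<rho> / 2 * (P + Z)"
    using par by (simp add: beam_multiplier_def A_def abs_mult)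
qed

lemma AE_lebesgue_on_negligible:
  assumes "AE t in lebesgue_on S. P t" "S \<in> sets lebesgue"
  obtains N where "negligible N" "\<forall>t\<in>S - N. P t"
proof -
  have "AE t in lebesgue. t \<in> S \<longrightarrow> P t" using assms by (simp add: AE_restrict_space_iff)
  then obtain N where "N \<in> null_sets lebesgue" "\<And>t. t \<notin> N \<Longrightarrow> t \<in> S \<longrightarrow> P t"
    unfolding completion.AE_iff_null_sets by auto
  then show thesis by (intro that[of N]) (auto simp: negligible_iff_null_sets)
qed

section \<open>Exponential decay along a strong solution\<close>

theorem theorem5p1:
  fixes EI \<rho> I_d varpi c c1 c2 \<sigma> \<kappa> :: real
    and f \<gamma> :: "real \<Rightarrow> real"
    and y0 y1 :: "real \<Rightarrow> real" and \<omega>0 :: real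
    and u :: "real \<Rightarrow> state"
  assumes "EI > 0" and "\<rho> > 0" and "I_d > 0"
    and "\<bar>varpi\<bar> < 3 * sqrt (EI / \<rho>)"
    and "mono f" and "\<And>s. f differentiable (at s)" and "f 0 = 0"
    and "c > 0" and "c1 > 0" and "c2 > 0" and "\<sigma> > 0"
    and "\<And>s. \<bar>s\<bar> < \<sigma> \<Longrightarrow> c * \<bar>s\<bar> \<le> \<bar>f s\<bar> \<and> \<bar>f s\<bar> \<le> inverse c * \<bar>s\<bar>"
    and "\<And>s. \<bar>s\<bar> \<ge> \<sigma> \<Longrightarrow> c1 * \<bar>s\<bar> \<le> \<bar>f s\<bar> \<and> \<bar>f s\<bar> \<le> c2 * \<bar>s\<bar>"
    and "\<And>S. bounded S \<Longrightarrow> \<exists>L. L-lipschitz_on S \<gamma>"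
    and "\<kappa> > 0" and "\<And>s. \<gamma> s * s \<ge> 0" and "\<And>s. \<bar>\<gamma> s\<bar> \<ge> \<kappa> * \<bar>s\<bar>"
    and "(y0, y1, \<omega>0) \<in> dom_calA f"
    and "strong_solution EI \<rho> I_d varpi f \<gamma> (y0, y1, \<omega>0) u"
  shows "\<exists>C>0. \<exists>\<alpha>>0. \<forall>t\<ge>0.
           X_norm EI \<rho> varpi (u t - ((\<lambda>x. 0), (\<lambda>x. 0), varpi)) \<le> C * exp (- \<alpha> * t)"
proof -
  note par = assms(1-4)
  define G where "G t \<longleftrightarrow> u t \<in> dom_calA f \<and>
      ((\<lambda>h. X_norm EI \<rho> varpi (X_scale (1 / h) (u (t + h) - u t)
        + (calA EI \<rho> varpi (u t) + calB \<rho> I_d varpi \<gamma> (u t)))) \<longlongrightarrow> 0) (at 0)" for t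
  have "AE t in lebesgue_on {0<..}. G t"
    using assms(19) unfolding strong_solution_def G_def by blast
  moreover have "{0<..} \<in> sets (lebesgue :: real measure)" by simp
  ultimately obtain N where N: "negligible N" and N': "\<forall>t\<in>{0<..} - N. G t"
    using AE_lebesgue_on_negligible by blast
  have good: "u t \<in> dom_calA f"
      "((\<lambda>h. X_norm EI \<rho> varpi (X_scale (1 / h) (u (t + h) - u t)
        + (calA EI \<rho> varpi (u t) + calB \<rho> I_d varpi \<gamma> (u t)))) \<longlongrightarrow> 0) (at 0)"
    if "t > 0" "t \<notin> N" for t
  proof -
    have "G t" using N' that by simp
    then show "u t \<in> dom_calA f"
      "((\<lambda>h. X_norm EI \<rho> varpi (X_scale (1 / h) (u (t + h) - u t)
        + (calA EI \<rho> varpi (u t) + calB \<rho> I_d varpi \<gamma> (u t)))) \<longlongrightarrow> 0) (at 0)"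
      unfolding G_def by blast+
  qed
  have m: "u s \<in> X_space" if "s \<ge> 0" for s using assms(19) that by (simp add: strong_solution_def)
  have ac: "abs_cont_on (X_norm EI \<rho> varpi) 0 T u" if "T > 0" for T
    using assms(19) that by (simp add: strong_solution_def)
  have v2: "\<rho> * varpi\<^sup>2 < 9 * EI"
  proof -
    have "varpi\<^sup>2 < (3 * sqrt (EI / \<rho>))\<^sup>2"
      using par(4) power_strict_mono[of "\<bar>varpi\<bar>" "3 * sqrt (EI / \<rho>)" 2] by simp
    also have "\<dots> = 9 * (EI / \<rho>)" using par by (simp add: power_mult_distrib)
    finally show ?thesis using par by (simp add: field_simps)
  qed
  define m0 where "m0 = min c c1"
  define M where "M = max (inverse c) c2"
  have m0: "m0 > 0" "M \<ge> 0" using assms(8-10) by (auto simp: m0_def M_def le_max_iff_disj)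
  have sec: "m0 * s\<^sup>2 \<le> f s * s" "\<bar>f s\<bar> \<le> M * \<bar>s\<bar>" for s
    unfolding m0_def M_def
    by (rule sector_bounds[where \<sigma>=\<sigma>, OF assms(5,7,8,9,10)], fact, fact)+
  have gam: "\<kappa> * s\<^sup>2 \<le> \<gamma> s * s" for s
  proof -
    have "\<kappa> * \<bar>s\<bar> * \<bar>s\<bar> \<le> \<bar>\<gamma> s\<bar> * \<bar>s\<bar>" using assms(17)[of s] by (rule mult_right_mono) simp
    also have "\<dots> = \<gamma> s * s" using assms(16)[of s] by (simp add: abs_mult[symmetric])
    finally show ?thesis by (simp add: power2_eq_square mult.assoc)
  qed

  define p where "p t = L2_inner ((wderiv ^^ 2) (fst (u t))) ((wderiv ^^ 2) (fst (u t)))" for t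
  define q where "q t = L2_inner (fst (snd (u t))) (fst (snd (u t)))" for t
  define \<eta> where "\<eta> t = snd (snd (u t)) - varpi" for t
  define V where "V t = beam_energy EI \<rho> I_d varpi (u t)" for t
  define F where "F t = beam_multiplier \<rho> (u t)" for t
  have pq: "0 \<le> p t" "0 \<le> q t" for t by (simp_all add: p_def q_def L2_inner_nonneg)
  have uX: "(fst (u t), fst (snd (u t)), snd (snd (u t))) \<in> X_space" if "t \<ge> 0" for t using m[OF that] by simp
  note eb = beam_energy_bounds[OF par(1-3) less_imp_le[OF v2] uX]
  have Vlow: "EI / 8 * p t + \<rho> / 2 * q t + I_d / 2 * (\<eta> t)\<^sup>2 \<le> V t" if "t \<ge> 0" for t
    using eb(1)[OF that] by (simp add: p_def q_def \<eta>_def V_def)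
  have Vup: "V t \<le> EI / 2 * p t + \<rho> / 2 * q t + (I_d + \<rho> * p t / 12) / 2 * (\<eta> t)\<^sup>2" if "t \<ge> 0" for t
    using eb(2)[OF that] by (simp add: p_def q_def \<eta>_def V_def)
  have Fb: "\<bar>F t\<bar> \<le> \<rho> / 2 * (p t + q t)" if "t \<ge> 0" for t
    using eb(3)[OF that] by (simp add: p_def q_def F_def)

  have Vac: "ac_on 0 T V" "ac_on 0 T F" if "T > 0" for T
    using beam_ac[OF par(1,2,4) m ac[OF that]] unfolding V_def[abs_def] F_def[abs_def] by blast+
  \<comment> \<open>The inner quantifier lies in the scope of \<open>a\<close> and \<open>b\<close>:
    both derivatives must involve the same tip velocities, since the dissipation of \<open>V\<close>
    is to absorb the boundary terms of \<open>F\<close>.\<close>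
  have rates: "\<exists>a b. (V has_real_derivative - \<gamma> (\<eta> t) * \<eta> t - EI * (f a * a + f b * b)) (at t) \<and>
      (\<exists>r s Y. 0 \<le> Y \<and> s\<^sup>2 \<le> p t / 3 \<and> r\<^sup>2 \<le> p t \<and>
        (F has_real_derivative \<rho> / 2 * (a\<^sup>2 - q t)
          + EI * (- 3 / 2 * p t - r * f a - r * f b + (f b)\<^sup>2 / 2) + \<rho> * (varpi + \<eta> t)\<^sup>2 / 2 * (s\<^sup>2 - Y)) (at t))"
    if t: "t > 0" "t \<notin> N" for t
  proof -
    obtain y z \<omega> where ut: "u t = (y, z, \<omega>)" by (cases "u t") auto
    have dom: "(y, z) \<in> dom_A f" using good(1)[OF t] by (simp add: ut dom_calA_def)
    have y: "y \<in> Hl 2" using m[of t] t by (simp add: ut X_space_def)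
    note d = beam_derivatives[OF par m t(1) ut dom good(2)[OF t]]
    note bd = Hl_2_bounds(3,4)[OF y]
    show ?thesis
      by (intro exI[of _ "point_value z 1"] exI[of _ "point_value (wderiv z) 1"]
            exI[of _ "point_value (wderiv y) 1"] exI[of _ "point_value y 1"] exI[of _ "L2_inner y y"] conjI)
         (use d bd L2_inner_nonneg[of y] in \<open>simp_all add: V_def[abs_def] F_def[abs_def] \<eta>_def p_def q_def ut\<close>)
  qed
  have diss: "- \<gamma> (\<eta> t) * \<eta> t - EI * (f a * a + f b * b) \<le> - \<kappa> * (\<eta> t)\<^sup>2 - EI * m0 * (a\<^sup>2 + b\<^sup>2)" for a b t
  proof -
    have "EI * (m0 * a\<^sup>2 + m0 * b\<^sup>2) \<le> EI * (f a * a + f b * b)"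
      using par(1) sec(1)[of a] sec(1)[of b] by (intro mult_left_mono add_mono) auto
    then show ?thesis using gam[of "\<eta> t"] by (simp add: algebra_simps)
  qed
  have Vmono: "V T \<le> V 0" if "T \<ge> 0" for T
  proof (cases "T = 0")
    case False
    then have "T > 0" using that by simp
    show ?thesis
    proof (rule ac_on_nonincreasing[OF that Vac(1)[OF \<open>T > 0\<close>] N])
      fix t assume t: "t > 0" "t \<notin> N"
      obtain a b where "(V has_real_derivative - \<gamma> (\<eta> t) * \<eta> t - EI * (f a * a + f b * b)) (at t)"
        using rates[OF t] by blast
      moreover have "0 \<le> \<kappa> * (\<eta> t)\<^sup>2" "0 \<le> EI * m0 * (a\<^sup>2 + b\<^sup>2)"
        using assms(15) par m0 by simp_all
      then have "- \<gamma> (\<eta> t) * \<eta> t - EI * (f a * a + f b * b) \<le> 0" using diss[of t a b] by linarith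
      ultimately show "\<exists>D\<le>0. (V has_real_derivative D) (at t)" by blast
    qed
  qed simp
  \<comment> \<open>\<open>P0\<close> and \<open>H\<close> are read off the lower bound for
    \<open>V\<close> together with \<open>V t \<le> V 0\<close>; \<open>S\<close> bounds the tip
    value through y(1)^2 \<le> p / 3.\<close>
  define P0 where "P0 = 8 * V 0 / EI"
  define H where "H = sqrt (2 * V 0 / I_d)"
  define S where "S = sqrt (P0 / 3)"
  have bounds: "p t \<le> P0" "\<bar>\<eta> t\<bar> \<le> H" if "t \<ge> 0" for t
  proof -
    have nn: "0 \<le> EI / 8 * p t" "0 \<le> \<rho> / 2 * q t" "0 \<le> I_d / 2 * (\<eta> t)\<^sup>2"
      using par pq by simp_all
    then have "EI / 8 * p t \<le> V 0" "I_d / 2 * (\<eta> t)\<^sup>2 \<le> V 0"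
      using Vlow[OF that] Vmono[OF that] by linarith+
    then have "p t \<le> P0" "(\<eta> t)\<^sup>2 \<le> 2 * V 0 / I_d" using par by (simp_all add: P0_def field_simps)
    then show "p t \<le> P0" "\<bar>\<eta> t\<bar> \<le> H"
      by (simp, metis H_def real_sqrt_abs real_sqrt_le_iff)
  qed
  have "0 \<le> P0" using bounds(1)[of 0] pq(1)[of 0] by simp
  have "0 \<le> H" using bounds(2)[of 0] by (meson abs_ge_zero order_refl order_trans)
  have "0 \<le> S" using \<open>0 \<le> P0\<close> by (simp add: S_def)
  obtain d K1 K2 where K: "0 < d" "0 \<le> K1" "0 \<le> K2"
    and rate: "\<And>P Y Z a b r s fa fb \<eta>. \<lbrakk>0 \<le> Y; s\<^sup>2 \<le> P / 3; r\<^sup>2 \<le> P; \<bar>\<eta>\<bar> \<le> H; \<bar>s\<bar> \<le> S; \<bar>fa\<bar> \<le> M * \<bar>a\<bar>; \<bar>fb\<bar> \<le> M * \<bar>b\<bar>\<rbrakk> \<Longrightarrow>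
       \<rho> / 2 * (a\<^sup>2 - Z) + EI * (- 3 / 2 * P - r * fa - r * fb + fb\<^sup>2 / 2) + \<rho> * (varpi + \<eta>)\<^sup>2 / 2 * (s\<^sup>2 - Y)
       \<le> - \<rho> / 2 * Z - d * P + K1 * (a\<^sup>2 + b\<^sup>2) + K2 * \<eta>\<^sup>2"
    using multiplier_rate_bound[OF par(1,2) v2 \<open>0 \<le> H\<close> \<open>0 \<le> S\<close> m0(2)] by metis
  \<comment> \<open>The first two bounds keep \<epsilon> F within half of the \<open>p\<close> and
    \<open>q\<close> terms in the lower bound of \<open>V\<close>. The third preserves half of the
    damping \<kappa>, the fourth lets the boundary dissipation absorb the tip terms. Adding 1 to
    \<open>K1\<close> and \<open>K2\<close>, which may be 0, keeps the quotients meaningful.\<close>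
  define \<epsilon> where "\<epsilon> = min (min (1 / 2) (EI / (8 * \<rho>))) (min (\<kappa> / (2 * (K2 + 1))) (EI * m0 / (K1 + 1)))"
  have \<epsilon>: "0 < \<epsilon>" "\<epsilon> \<le> 1 / 2" "\<epsilon> * \<rho> \<le> EI / 8" "\<epsilon> * K2 \<le> \<kappa> / 2" "\<epsilon> * K1 \<le> EI * m0"
  proof -
    show "0 < \<epsilon>" using par K m0 assms(15) by (simp add: \<epsilon>_def)
    show "\<epsilon> \<le> 1 / 2" unfolding \<epsilon>_def by (meson min.cobounded1 min.cobounded2 order_trans)
    have "\<epsilon> \<le> EI / (8 * \<rho>)" unfolding \<epsilon>_def by (meson min.cobounded1 min.cobounded2 order_trans)
    then show "\<epsilon> * \<rho> \<le> EI / 8" using par by (simp add: field_simps)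
    have "\<epsilon> \<le> \<kappa> / (2 * (K2 + 1))" unfolding \<epsilon>_def by (meson min.cobounded1 min.cobounded2 order_trans)
    then have "\<epsilon> * (K2 + 1) \<le> \<kappa> / 2" using K by (simp add: field_simps)
    then show "\<epsilon> * K2 \<le> \<kappa> / 2" using \<open>0 < \<epsilon>\<close> by (simp add: algebra_simps)
    have "\<epsilon> \<le> EI * m0 / (K1 + 1)" unfolding \<epsilon>_def by (meson min.cobounded1 min.cobounded2 order_trans)
    then have "\<epsilon> * (K1 + 1) \<le> EI * m0" using K by (simp add: field_simps)
    then show "\<epsilon> * K1 \<le> EI * m0" using \<open>0 < \<epsilon>\<close> by (simp add: algebra_simps)
  qed
  define W where "W t = V t + \<epsilon> * F t" for t
  define Q where "Q t = p t + q t + (\<eta> t)\<^sup>2" for t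
  have Q: "0 \<le> Q t" for t using pq by (simp add: Q_def)
  have \<epsilon>F: "\<bar>\<epsilon> * F t\<bar> \<le> EI / 16 * p t + \<rho> / 4 * q t" if "t \<ge> 0" for t
  proof -
    have "\<bar>\<epsilon> * F t\<bar> \<le> \<epsilon> * (\<rho> / 2 * (p t + q t))"
      using mult_left_mono[OF Fb[OF that], of \<epsilon>] \<epsilon>(1) by (simp add: abs_mult)
    also have "\<dots> = (\<epsilon> * \<rho>) * (p t / 2) + \<epsilon> * (\<rho> / 2 * q t)" by (simp add: algebra_simps)
    also have "\<dots> \<le> (EI / 8) * (p t / 2) + (1 / 2) * (\<rho> / 2 * q t)"
      using \<epsilon> par pq by (intro add_mono mult_right_mono) auto
    finally show ?thesis by simp
  qed
  define c0 where "c0 = min (EI / 16) (min (\<rho> / 4) (I_d / 2))"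
  \<comment> \<open>The last entry bounds half the weight I_d + \<rho> |y|^2 of \<eta>^2, with
    \<open>p t \<le> P0\<close> inserted.\<close>
  define C0 where "C0 = max EI (max \<rho> (I_d / 2 + \<rho> * P0 / 24))"
  have c0: "0 < c0" "c0 \<le> EI / 16" "c0 \<le> \<rho> / 4" "c0 \<le> I_d / 2" using par unfolding c0_def by (simp, (meson min.cobounded1 min.cobounded2 order_trans)+)
  have C0: "0 < C0" "EI \<le> C0" "\<rho> \<le> C0" "I_d / 2 + \<rho> * P0 / 24 \<le> C0"
    using par unfolding C0_def by (simp add: less_max_iff_disj, (meson max.cobounded1 max.cobounded2 order_trans)+)
  have Wlow: "c0 * Q t \<le> W t" if "t \<ge> 0" for t
  proof -
    have "c0 * p t \<le> EI / 16 * p t" "c0 * q t \<le> \<rho> / 4 * q t" "c0 * (\<eta> t)\<^sup>2 \<le> I_d / 2 * (\<eta> t)\<^sup>2"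
      by (rule mult_right_mono[OF c0(2) pq(1)], rule mult_right_mono[OF c0(3) pq(2)],
          rule mult_right_mono[OF c0(4) zero_le_power2])
    then have "c0 * Q t \<le> EI / 16 * p t + \<rho> / 4 * q t + I_d / 2 * (\<eta> t)\<^sup>2"
      by (simp add: Q_def algebra_simps)
    then show ?thesis using Vlow[OF that] \<epsilon>F[OF that] unfolding W_def by linarith
  qed
  have Wup: "W t \<le> C0 * Q t" if "t \<ge> 0" for t
  proof -
    have "(I_d + \<rho> * p t / 12) / 2 * (\<eta> t)\<^sup>2 \<le> C0 * (\<eta> t)\<^sup>2"
    proof (rule mult_right_mono)
      have "\<rho> * p t \<le> \<rho> * P0" using bounds(1)[OF that] par by simp
      then show "(I_d + \<rho> * p t / 12) / 2 \<le> C0" using C0(4) by simp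
    qed simp
    moreover have "EI * p t \<le> C0 * p t" "\<rho> * q t \<le> C0 * q t"
      by (rule mult_right_mono[OF C0(2) pq(1)], rule mult_right_mono[OF C0(3) pq(2)])
    moreover have "0 \<le> EI * p t" "0 \<le> \<rho> * q t" using par pq by simp_all
    ultimately show ?thesis using Vup[OF that] \<epsilon>F[OF that]
      unfolding W_def Q_def distrib_left by linarith
  qed
  \<comment> \<open>The smallest of the three decay coefficients left for \<eta>^2, \<open>q\<close>
    and \<open>p\<close>.\<close>
  define \<delta> where "\<delta> = min (\<kappa> / 2) (min (\<epsilon> * \<rho> / 2) (\<epsilon> * d))"
  have \<delta>: "0 < \<delta>" "\<delta> \<le> \<kappa> / 2" "\<delta> \<le> \<epsilon> * \<rho> / 2" "\<delta> \<le> \<epsilon> * d"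
    using \<epsilon> par K assms(15) unfolding \<delta>_def
    by (simp, (meson min.cobounded1 min.cobounded2 order_trans)+)
  \<comment> \<open>Chosen so that W' \<le> - \<delta> Q and W \<le> C0 Q combine to W' \<le> -
    \<beta> W.\<close>
  define \<beta> where "\<beta> = \<delta> / C0"
  have \<beta>: "0 < \<beta>" using \<delta> C0 by (simp add: \<beta>_def)
  have Wder: "\<exists>D\<le>- \<delta> * Q t. (W has_real_derivative D) (at t)" if t: "t > 0" "t \<notin> N" for t
  proof -
    obtain a b r s Y where V': "(V has_real_derivative - \<gamma> (\<eta> t) * \<eta> t - EI * (f a * a + f b * b)) (at t)"
      and c: "0 \<le> Y" "s\<^sup>2 \<le> p t / 3" "r\<^sup>2 \<le> p t"
      and F': "(F has_real_derivative \<rho> / 2 * (a\<^sup>2 - q t)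
          + EI * (- 3 / 2 * p t - r * f a - r * f b + (f b)\<^sup>2 / 2) + \<rho> * (varpi + \<eta> t)\<^sup>2 / 2 * (s\<^sup>2 - Y)) (at t)"
      using rates[OF t] by blast
    define DF where "DF = \<rho> / 2 * (a\<^sup>2 - q t)
          + EI * (- 3 / 2 * p t - r * f a - r * f b + (f b)\<^sup>2 / 2) + \<rho> * (varpi + \<eta> t)\<^sup>2 / 2 * (s\<^sup>2 - Y)"
    have tt: "t \<ge> 0" using t by simp
    have "s\<^sup>2 \<le> P0 / 3" using c(2) bounds(1)[OF tt] by simp
    then have "\<bar>s\<bar> \<le> S" unfolding S_def by (metis real_sqrt_abs real_sqrt_le_iff)
    then have DF: "DF \<le> - \<rho> / 2 * q t - d * p t + K1 * (a\<^sup>2 + b\<^sup>2) + K2 * (\<eta> t)\<^sup>2"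
      unfolding DF_def by (intro rate c bounds(2)[OF tt] sec(2))
    have "\<epsilon> * DF \<le> \<epsilon> * (- \<rho> / 2 * q t - d * p t + K1 * (a\<^sup>2 + b\<^sup>2) + K2 * (\<eta> t)\<^sup>2)"
      using DF \<epsilon>(1) by (intro mult_left_mono) auto
    also have "\<dots> = - (\<epsilon> * \<rho> / 2) * q t - (\<epsilon> * d) * p t + (\<epsilon> * K1) * (a\<^sup>2 + b\<^sup>2) + (\<epsilon> * K2) * (\<eta> t)\<^sup>2"
      by (simp add: algebra_simps)
    finally have 1: "\<epsilon> * DF \<le> - (\<epsilon> * \<rho> / 2) * q t - (\<epsilon> * d) * p t + (\<epsilon> * K1) * (a\<^sup>2 + b\<^sup>2) + (\<epsilon> * K2) * (\<eta> t)\<^sup>2" .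
    have 2: "(\<epsilon> * K1) * (a\<^sup>2 + b\<^sup>2) \<le> EI * m0 * (a\<^sup>2 + b\<^sup>2)" "(\<epsilon> * K2) * (\<eta> t)\<^sup>2 \<le> \<kappa> / 2 * (\<eta> t)\<^sup>2"
      by (rule mult_right_mono[OF \<epsilon>(5)], simp, rule mult_right_mono[OF \<epsilon>(4) zero_le_power2])
    have 3: "\<delta> * q t \<le> (\<epsilon> * \<rho> / 2) * q t" "\<delta> * p t \<le> (\<epsilon> * d) * p t" "\<delta> * (\<eta> t)\<^sup>2 \<le> \<kappa> / 2 * (\<eta> t)\<^sup>2"
      by (rule mult_right_mono[OF \<delta>(3) pq(2)], rule mult_right_mono[OF \<delta>(4) pq(1)],
          rule mult_right_mono[OF \<delta>(2) zero_le_power2])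
    have "- \<gamma> (\<eta> t) * \<eta> t - EI * (f a * a + f b * b) + \<epsilon> * DF \<le> - \<delta> * Q t"
      using diss[of t a b] 1 2 3 unfolding Q_def distrib_left by linarith
    moreover have "(W has_real_derivative - \<gamma> (\<eta> t) * \<eta> t - EI * (f a * a + f b * b) + \<epsilon> * DF) (at t)"
      unfolding W_def[abs_def] by (rule DERIV_add[OF V' DERIV_cmult[OF F'[folded DF_def]]])
    ultimately show ?thesis by blast
  qed
  have decay: "exp (\<beta> * T) * W T \<le> W 0" if "T \<ge> 0" for T
  proof (cases "T = 0")
    case False
    then have "T > 0" using that by simp
    have "exp (\<beta> * T) * W T \<le> exp (\<beta> * 0) * W 0"
    \<comment> \<open>Multiplication by the integrating factor turns the differential inequality
      into monotonicity, so no Gronwall argument at exceptional times is required.\<close>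
    proof (rule ac_on_nonincreasing[where g="\<lambda>t. exp (\<beta> * t) * W t", OF that _ N])
      show "ac_on 0 T (\<lambda>t. exp (\<beta> * t) * W t)" unfolding W_def
        by (rule ac_on_mult[OF ac_on_exp ac_on_add[OF Vac(1)[OF \<open>T > 0\<close>] ac_on_mult[OF ac_on_const Vac(2)[OF \<open>T > 0\<close>]]]])
      fix t assume t: "t > 0" "t \<notin> N"
      obtain D where D: "D \<le> - \<delta> * Q t" "(W has_real_derivative D) (at t)" using Wder[OF t] by blast
      have "\<beta> * W t \<le> \<beta> * (C0 * Q t)" using Wup[of t] t \<beta> by (intro mult_left_mono) auto
      also have "\<dots> = \<delta> * Q t" using C0(1) by (simp add: \<beta>_def)
      finally have "\<beta> * W t + D \<le> 0" using D(1) by simp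
      then have "exp (\<beta> * t) * (\<beta> * W t + D) \<le> 0" by (simp add: mult_nonneg_nonpos)
      moreover have "((\<lambda>t. exp (\<beta> * t) * W t) has_real_derivative exp (\<beta> * t) * (\<beta> * W t + D)) (at t)"
        by (auto intro!: derivative_eq_intros D(2) simp: algebra_simps)
      ultimately show "\<exists>D\<le>0. ((\<lambda>t. exp (\<beta> * t) * W t) has_real_derivative D) (at t)" by blast
    qed
    then show ?thesis by simp
  qed simp
  define C1 where "C1 = max EI (max \<rho> 1)"
  have C1: "0 < C1" "EI \<le> C1" "\<rho> \<le> C1" "1 \<le> C1" 
    using par unfolding C1_def by (simp add: less_max_iff_disj, (meson max.cobounded1 max.cobounded2 order_trans)+)
  have W0: "0 \<le> W 0" using Wlow[of 0] Q[of 0] c0(1) by (meson less_imp_le mult_nonneg_nonneg order_refl order_trans)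
  \<comment> \<open>The squared norm is at most C1 Q, and Q is at most W / c0.\<close>
  define K where "K = C1 / c0 * W 0"
  have K0: "0 \<le> K" using C1 c0 W0 by (simp add: K_def)
  have final: "X_norm EI \<rho> varpi (u t - ((\<lambda>x. 0), (\<lambda>x. 0), varpi)) \<le> (sqrt K + 1) * exp (- (\<beta> / 2) * t)" if t: "t \<ge> 0" for t
  proof (rule power2_le_imp_le)
    obtain y z \<omega> where ut: "u t = (y, z, \<omega>)" by (cases "u t") auto
    have w: "u t - ((\<lambda>x. 0), (\<lambda>x. 0), varpi) = (y, z, \<eta> t)" by (simp add: ut \<eta>_def fun_eq_iff)
    have X: "(y, z, \<eta> t) \<in> X_space" using m[OF t] by (simp add: ut X_space_def)
    have "(X_norm EI \<rho> varpi (y, z, \<eta> t))\<^sup>2 = EI * p t - \<rho> * varpi\<^sup>2 * L2_inner y y + \<rho> * q t + (\<eta> t)\<^sup>2"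
      using X_norm_power2(1)[OF par(1,2,4) X] by (simp add: p_def q_def ut)
    also have "\<dots> \<le> C1 * Q t"
    proof -
      have "0 \<le> \<rho> * varpi\<^sup>2 * L2_inner y y" using par L2_inner_nonneg[of y] by simp
      moreover have "EI * p t \<le> C1 * p t" "\<rho> * q t \<le> C1 * q t" "1 * (\<eta> t)\<^sup>2 \<le> C1 * (\<eta> t)\<^sup>2"
        by (rule mult_right_mono[OF C1(2) pq(1)], rule mult_right_mono[OF C1(3) pq(2)],
            rule mult_right_mono[OF C1(4) zero_le_power2])
      ultimately show ?thesis unfolding Q_def distrib_left by linarith
    qed
    also have "\<dots> \<le> K * exp (- \<beta> * t)"
    proof -
      have "W t \<le> W 0 * exp (- \<beta> * t)"
        using decay[OF t] by (simp add: exp_minus field_simps)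
      then have "c0 * Q t \<le> W 0 * exp (- \<beta> * t)" using Wlow[OF t] by simp
      then have "C1 / c0 * (c0 * Q t) \<le> C1 / c0 * (W 0 * exp (- \<beta> * t))"
        using C1 c0 by (intro mult_left_mono) auto
      then show ?thesis using c0(1) by (simp add: K_def mult.assoc)
    qed
    \<comment> \<open>The added 1 keeps the final constant positive even if \<open>K = 0\<close>.
      The rate is halved because \<open>W\<close> compares with the square of the norm.\<close>
    also have "\<dots> \<le> (sqrt K + 1)\<^sup>2 * exp (- \<beta> * t)"
      using K0 by (intro mult_right_mono) (simp_all add: power2_sum)
    also have "\<dots> = ((sqrt K + 1) * exp (- (\<beta> / 2) * t))\<^sup>2"
      by (simp add: power_mult_distrib exp_double[symmetric])
    finally show "(X_norm EI \<rho> varpi (u t - ((\<lambda>x. 0), (\<lambda>x. 0), varpi)))\<^sup>2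
        \<le> ((sqrt K + 1) * exp (- (\<beta> / 2) * t))\<^sup>2" unfolding w .
  qed (use K0 in simp)
  show ?thesis
    by (rule exI[of _ "sqrt K + 1"], intro conjI exI[of _ "\<beta> / 2"] allI impI final)
       (use K0 \<beta> in \<open>auto simp: add_nonneg_pos\<close>)
qed

end
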